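(* The functor $k:\mathcal{PSMF}\rightarrow \mathrm{Igr}_+$ (reduced K-theory of pre-special hyperfields) is left adjoint to the functor $\Gamma:\mathrm{Igr}_+\rightarrow\mathcal{PSMF}$. The unit of the adjunction is the natural transformation $\phi:1_{\mathcal{PSMF}}\rightarrow\Gamma\circ k$ defined, for $F\in\mathcal{PSMF}$, by $\phi_F=e_{k(F)}\circ\rho_F$ on $\dot F$ (and $\phi_F(0)=0$). That is, for every pre-special hyperfield $F$, every $R\in\mathrm{Igr}_+$ and every morphism $f:F\to\Gamma(R)$ in $\mathcal{PSMF}$, there is a unique morphism $f^\sharp:k(F)\to R$ in $\mathrm{Igr}_+$ such that $\Gamma(f^\sharp)\circ\phi_F=f$.
   Context: **Hyperfields.** A commutative multigroup is $(G,+,-,0)$ with $+:G\times G\to\mathcal P(G)\setminus\{\emptyset\}$, $-:G\to G$, such that: $z\in x+y$ implies $x\in z+(-y)$ and $y\in(-x)+z$; $y\in 0+x$ iff $x=y$; $+$ is associative (with $x+(y+z)=\bigcup_{w\in y+z}x+w$ and similarly on the other side) and commutative. A multiring is $(R,+,\cdot,-,0,1)$ with $(R,+,-,0)$ a commutative multigroup, $(R,\cdot,1)$ a commutative monoid, $a\cdot 0=0$, and $(a+b)d\subseteq ad+bd$. A hyperfield is a multiring in which every non-zero element is invertible; $\dot F=F\setminus\{0\}$. A morphism of multirings is a map $f$ with $c\in a+b\Rightarrow f(c)\in f(a)+f(b)$, $f(-a)=-f(a)$, $f(0)=0$, $f(ab)=f(a)f(b)$, $f(1)=1$. A hyperfield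 is hyperbolic if $1-1=F$. A pre-special hyperfield is a hyperbolic hyperfield $F$ with $a^2=1$ and $(1-a)(1-a)\subseteq 1-a$ for all $a\in\dot F$. $\mathcal{PSMF}$ is the category of pre-special hyperfields and multiring morphisms. **K-theory.** $K_0F=\mathbb Z$; $K_1F$ is $\dot F$ written additively, with canonical isomorphism $\rho=\rho_F:\dot F\to K_1F$, $\rho(ab)=\rho(a)+\rho(b)$; $K_*F$ is the quotient of the tensor algebra of $K_1F$ over $\mathbb Z$ by the homogeneous ideal generated by all $\rho(a)\otimes\rho(b)$ with $a\in\dot F$, $a\neq 1$, $b\in 1-a$. The reduced K-theory is $k_nF=K_nF/2K_nF$ for all $n\ge 0$. One writes $\rho(a_1)\cdots\rho(a_n)$ for the class of $\rho(a_1)\otimes\cdots\otimes\rho(a_n)$. For a pre-special hyperfield $k_1F=K_1F$. $k(F)=k_*F$ is regarded as an inductive graded ring with $\top_0=1$, $\top_n=\rho(-1)^n$, $h_n=\rho(-1)\cdot(\_)$, and a morphism $\varphi:F\to L$ induces $\rho(a_1)\cdots\rho(a_n)\mapsto\rho(\varphi(a_1))\cdots\rho(\varphi(a_n))$. **Inductive graded rings.** An inductive graded ring (object of $\mathrm{Igr}$) is $R=((R_n)_{n\ge0},(h_n)_{n\ge0},\ast_{nm})$ where $R_0\cong\mathbb F_2$; each $R_n$ is a group of exponent 2 with a distinguished element $\top_n$; $h_n:R_n\to R_{n+1}$ is a group homomorphism with $h_n(\top_n)=\top_{n+1}$; $h_n=\top_1\ast_{1n}(\_)$ for all $n\ge 0$;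 $\bigoplus_n R_n$ with products $\ast_{nm}:R_n\times R_m\to R_{n+m}$ is a commutative graded ring; and with $h_s^t=h_{t-1}\circ\cdots\circ h_s$ ($h_s^s=\mathrm{Id}$), $h^p_n(x)\ast h^q_m(y)=h^{p+q}_{n+m}(x\ast y)$ for $p\ge n,q\ge m$, $x\in R_n,y\in R_m$. A morphism $f:R\to S$ is a family of homomorphisms of pointed groups $f_n:R_n\to S_n$ such that $\bigoplus f_n$ is a homomorphism of commutative unital rings. $\mathrm{Igr}_+$ is the full subcategory of those $R$ such that (1) for $n\ge 2$ every element of $R_n$ is a finite sum of products $a_1\ast\cdots\ast a_n$ with $a_i\in R_1$, and (2) $(\top_1+a)\ast_{11}a=0$ in $R_2$ for all $a\in R_1$. **The functor $\Gamma$.** For $R$ in $\mathrm{Igr}_+$, fix an isomorphism $e_R:(R_1,+,0,\top_1)\to(G(R),\cdot,1,-1)$ onto a multiplicatively written group, and write $x\ast_{11}y$ for $e_R^{-1}(x)\ast_{11}e_R^{-1}(y)$, $x,y\in G(R)$. Put $\Gamma(R)=G(R)\cup\{0\}$ with $-a=(-1)\cdot a$, $a\cdot 0=0\cdot a=0$, $a+0=0+a=\{a\}$, $a+(-a)=\Gamma(R)$ for $a\ne0$, and for $a,b\ne0$, $a\ne-b$: $$a+b=\{c\in\Gamma(R): \text{there is } d\in G(R)\text{ with } a\cdot b=c\cdot d\text{ and }a\ast_{11}b=c\ast_{11}d\text{ in }R_2\}.$$ It is part of the set-up of the statement that $\Gamma(R)$ is an object of $\mathcal{PSMF}$. For $f\in\mathrm{Igr}_+(R,S)$,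 $\Gamma(f)(0)=0$ and $\Gamma(f)(x)=e_S(f_1(e_R^{-1}(x)))$ for $x\in G(R)$.
   Formalization: Γ(R) need not have associative addition for every R in Igr₊, so Γ(R) is shown to be a pre-special hyperfield only when its addition is associative; functoriality, naturality of φ and the universal property are proved for all R in Igr₊, with maps into Γ(R) satisfying the multiring morphism conditions. *)

theory Defs
  imports "HOL-Algebra.QuotRing" "HOL-Algebra.Elementary_Groups" "HOL-Algebra.Product_Groups" "HOL-Library.Poly_Mapping"
begin

section \<open>Pre-special hyperfields\<close>

record 'a multistruct = "'a monoid" +
  hadd :: "'a \<Rightarrow> 'a \<Rightarrow> 'a set" (infixl \<open>\<boxplus>\<index>\<close> 65)
  hneg :: "'a \<Rightarrow> 'a" (\<open>\<boxminus>\<index> _\<close> [81] 80)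
  hzero :: 'a

locale comm_multigroup =
  fixes F :: "'a multistruct" (structure)
  assumes hzero_closed: "hzero F \<in> carrier F"
    and hneg_closed: "x \<in> carrier F \<Longrightarrow> \<boxminus> x \<in> carrier F"
    and hadd_closed: "\<lbrakk>x \<in> carrier F; y \<in> carrier F\<rbrakk> \<Longrightarrow> x \<boxplus> y \<subseteq> carrier F"
    and hadd_nonempty: "\<lbrakk>x \<in> carrier F; y \<in> carrier F\<rbrakk> \<Longrightarrow> x \<boxplus> y \<noteq> {}"
    and hadd_reversible:
      "\<lbrakk>x \<in> carrier F; y \<in> carrier F; z \<in> x \<boxplus> y\<rbrakk> \<Longrightarrow> x \<in> z \<boxplus> (\<boxminus> y) \<and> y \<in> (\<boxminus> x) \<boxplus> z"
    and hadd_zero: "\<lbrakk>x \<in> carrier F; y \<in> carrier F\<rbrakk> \<Longrightarrow> y \<in> hzero F \<boxplus> x \<longleftrightarrow> x = y"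
    and hadd_assoc:
      "\<lbrakk>x \<in> carrier F; y \<in> carrier F; z \<in> carrier F\<rbrakk>
        \<Longrightarrow> (\<Union>w\<in>y \<boxplus> z. x \<boxplus> w) = (\<Union>w\<in>x \<boxplus> y. w \<boxplus> z)"
    and hadd_comm: "\<lbrakk>x \<in> carrier F; y \<in> carrier F\<rbrakk> \<Longrightarrow> x \<boxplus> y = y \<boxplus> x"

locale multiring = comm_multigroup F + comm_monoid F for F :: "'a multistruct" (structure) +
  assumes mult_hzero: "a \<in> carrier F \<Longrightarrow> a \<otimes> hzero F = hzero F"
    and hadd_distrib:
      "\<lbrakk>a \<in> carrier F; b \<in> carrier F; d \<in> carrier F\<rbrakk>
        \<Longrightarrow> (\<lambda>x. x \<otimes> d) ` (a \<boxplus> b) \<subseteq> (a \<otimes> d) \<boxplus> (b \<otimes> d)"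

text \<open>As for fields, \<open>1 \<noteq> 0\<close> is part of the notion of a hyperfield; it makes the set of
  non-zero elements a group.\<close>

locale hyperfield = multiring F for F :: "'a multistruct" (structure) +
  assumes one_not_hzero: "\<one> \<noteq> hzero F"
    and nonzero_invertible: "carrier F - {hzero F} \<subseteq> Units F"

locale pre_special_hyperfield = hyperfield F for F :: "'a multistruct" (structure) +
  assumes hyperbolic: "\<one> \<boxplus> (\<boxminus> \<one>) = carrier F"
    and square_one: "a \<in> carrier F - {hzero F} \<Longrightarrow> a [^] (2::nat) = \<one>"
    and represented_mult_closed:
      "\<lbrakk>a \<in> carrier F - {hzero F}; x \<in> \<one> \<boxplus> (\<boxminus> a); y \<in> \<one> \<boxplus> (\<boxminus> a)\<rbrakk>
        \<Longrightarrow> x \<otimes> y \<in> \<one> \<boxplus> (\<boxminus> a)"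

text \<open>Morphisms are extensional functions, so that equality of morphisms is equality in HOL;
  identities are \<^term>\<open>\<lambda>x\<in>carrier F. x\<close> and composition is \<^const>\<open>compose\<close>.\<close>

definition multiring_hom :: "'a multistruct \<Rightarrow> 'b multistruct \<Rightarrow> ('a \<Rightarrow> 'b) set" where
  "multiring_hom F L = {f \<in> carrier F \<rightarrow>\<^sub>E carrier L.
     (\<forall>a\<in>carrier F. \<forall>b\<in>carrier F. \<forall>c\<in>a \<boxplus>\<^bsub>F\<^esub> b. f c \<in> f a \<boxplus>\<^bsub>L\<^esub> f b) \<and>
     (\<forall>a\<in>carrier F. f (\<boxminus>\<^bsub>F\<^esub> a) = \<boxminus>\<^bsub>L\<^esub> f a) \<and>
     f (hzero F) = hzero L \<and>
     (\<forall>a\<in>carrier F. \<forall>b\<in>carrier F. f (a \<otimes>\<^bsub>F\<^esub> b) = f a \<otimes>\<^bsub>L\<^esub> f b) \<and>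
     f \<one>\<^bsub>F\<^esub> = \<one>\<^bsub>L\<^esub>}"


section \<open>Inductive graded rings\<close>

text \<open>The groups \<open>R\<^sub>n\<close> are groups in the sense of \<^theory>\<open>HOL-Algebra.Group\<close>, hence written
  multiplicatively: their operation \<open>\<otimes>\<close> is the addition of the graded ring, their \<open>\<one>\<close> is its
  \<open>0\<close>. The product \<open>R\<^sub>n \<times> R\<^sub>m \<rightarrow> R\<^sub>n\<^sub>+\<^sub>m\<close> is \<open>igr_mult R n m\<close>.\<close>

record 'r igr =
  igr_group :: "nat \<Rightarrow> 'r monoid"
  igr_top :: "nat \<Rightarrow> 'r"
  igr_h :: "nat \<Rightarrow> 'r \<Rightarrow> 'r"
  igr_mult :: "nat \<Rightarrow> nat \<Rightarrow> 'r \<Rightarrow> 'r \<Rightarrow> 'r"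

text \<open>The ring \<open>\<Oplus>\<^sub>n R\<^sub>n\<close>. Its unit is \<open>\<top>\<^sub>0\<close>, the non-zero element of \<open>R\<^sub>0 \<cong> \<bbbF>\<^sub>2\<close>.\<close>

definition igr_ring :: "'r igr \<Rightarrow> (nat \<Rightarrow> 'r) ring" where
  "igr_ring R = (let S = sum_group UNIV (igr_group R) in
     \<lparr>carrier = carrier S,
      monoid.mult = (\<lambda>x y n. \<Otimes>\<^bsub>igr_group R n\<^esub>i\<in>{..n}. igr_mult R i (n - i) (x i) (y (n - i))),
      monoid.one = (\<lambda>n. if n = 0 then igr_top R 0 else \<one>\<^bsub>igr_group R n\<^esub>),
      ring.zero = monoid.one S,
      ring.add = monoid.mult S\<rparr>)"

text \<open>\<open>h\<^sub>s\<^sup>t = h\<^sub>t\<^sub>-\<^sub>1 \<circ> \<dots> \<circ> h\<^sub>s\<close>\<close>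

definition igr_h_iter :: "'r igr \<Rightarrow> nat \<Rightarrow> nat \<Rightarrow> 'r \<Rightarrow> 'r" where
  "igr_h_iter R s t = fold (igr_h R) [s..<t]"

definition is_igr :: "'r igr \<Rightarrow> bool" where
  "is_igr R \<longleftrightarrow>
     igr_group R 0 \<cong> integer_mod_group 2 \<and> igr_top R 0 \<noteq> \<one>\<^bsub>igr_group R 0\<^esub> \<and>
     (\<forall>n. group (igr_group R n) \<and>
        (\<forall>x\<in>carrier (igr_group R n). x [^]\<^bsub>igr_group R n\<^esub> (2::nat) = \<one>\<^bsub>igr_group R n\<^esub>) \<and>
        igr_top R n \<in> carrier (igr_group R n)) \<and>
     (\<forall>n. igr_h R n \<in> hom (igr_group R n) (igr_group R (Suc n)) \<and>
        igr_h R n (igr_top R n) = igr_top R (Suc n) \<and>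
        (\<forall>x\<in>carrier (igr_group R n). igr_h R n x = igr_mult R 1 n (igr_top R 1) x)) \<and>
     (\<forall>n m. \<forall>x\<in>carrier (igr_group R n). igr_mult R n m x \<in> hom (igr_group R m) (igr_group R (n + m))) \<and>
     (\<forall>n m. \<forall>y\<in>carrier (igr_group R m).
        (\<lambda>x. igr_mult R n m x y) \<in> hom (igr_group R n) (igr_group R (n + m))) \<and>
     cring (igr_ring R) \<and>
     (\<forall>n m p q. n \<le> p \<longrightarrow> m \<le> q \<longrightarrow>
        (\<forall>x\<in>carrier (igr_group R n). \<forall>y\<in>carrier (igr_group R m).
           igr_mult R p q (igr_h_iter R n p x) (igr_h_iter R m q y) =
           igr_h_iter R (n + m) (p + q) (igr_mult R n m x y)))"

text \<open>\<open>a\<^sub>1 * \<dots> * a\<^sub>n\<close> for \<open>a\<^sub>i \<in> R\<^sub>1\<close>\<close>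

fun igr_prod :: "'r igr \<Rightarrow> 'r list \<Rightarrow> 'r" where
  "igr_prod R [] = igr_top R 0"
| "igr_prod R (a # as) = igr_mult R 1 (length as) a (igr_prod R as)"

definition is_igr_plus :: "'r igr \<Rightarrow> bool" where
  "is_igr_plus R \<longleftrightarrow> is_igr R \<and>
     (\<forall>n\<ge>2. \<forall>x\<in>carrier (igr_group R n). \<exists>k c.
        (\<forall>i<k. length (c i) = n \<and> set (c i) \<subseteq> carrier (igr_group R 1)) \<and>
        x = (\<Otimes>\<^bsub>igr_group R n\<^esub>i\<in>{..<k::nat}. igr_prod R (c i))) \<and>
     (\<forall>a\<in>carrier (igr_group R 1).
        igr_mult R 1 1 (igr_top R 1 \<otimes>\<^bsub>igr_group R 1\<^esub> a) a = \<one>\<^bsub>igr_group R 2\<^esub>)"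

definition igr_hom :: "'r igr \<Rightarrow> 's igr \<Rightarrow> (nat \<Rightarrow> 'r \<Rightarrow> 's) set" where
  "igr_hom R S = {f.
     (\<forall>n. f n \<in> hom (igr_group R n) (igr_group S n) \<inter> extensional (carrier (igr_group R n)) \<and>
        f n (igr_top R n) = igr_top S n) \<and>
     (\<lambda>x n. f n (x n)) \<in> ring_hom (igr_ring R) (igr_ring S)}"

definition igr_id :: "'r igr \<Rightarrow> nat \<Rightarrow> 'r \<Rightarrow> 'r" where
  "igr_id R n = (\<lambda>x\<in>carrier (igr_group R n). x)"

definition igr_compose :: "'r igr \<Rightarrow> (nat \<Rightarrow> 's \<Rightarrow> 't) \<Rightarrow> (nat \<Rightarrow> 'r \<Rightarrow> 's) \<Rightarrow> nat \<Rightarrow> 'r \<Rightarrow> 't" where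
  "igr_compose R g f n = compose (carrier (igr_group R n)) (g n) (f n)"


section \<open>The tensor algebra of an abelian group over the integers\<close>

text \<open>Lists under concatenation form a monoid. This makes \<^typ>\<open>'a list \<Rightarrow>\<^sub>0 int\<close> the monoid ring of
  the free monoid, i.e. the free associative ring on \<^typ>\<open>'a\<close>.\<close>

instantiation list :: (type) monoid_add
begin

definition zero_list_def: "0 = []"

definition plus_list_def: "xs + ys = xs @ ys"

instance
  by standard (simp_all add: zero_list_def plus_list_def)

end

definition free_ring :: "'a set \<Rightarrow> ('a list \<Rightarrow>\<^sub>0 int) ring" where
  "free_ring S =
     \<lparr>carrier = {p. Poly_Mapping.keys p \<subseteq> lists S}, monoid.mult = (*), monoid.one = 1, ring.zero = 0, ring.add = (+)\<rparr>"

definition free_gen :: "'a \<Rightarrow> ('a list \<Rightarrow>\<^sub>0 int)" where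
  "free_gen x = Poly_Mapping.single [x] 1"

text \<open>The two-sided ideal of \<open>\<int>\<langle>M\<rangle>\<close> generated by \<open>[x y] - [x] - [y]\<close> is additively spanned by the
  multilinearity relations between words of equal length. Hence in degree \<open>n\<close> the quotient
  \<open>tensor_algebra M\<close> is the usual construction of the \<open>n\<close>-fold tensor power of \<open>M\<close> over \<open>\<int>\<close>:
  the free abelian group on \<open>M\<^sup>n\<close> modulo multilinearity.\<close>

definition tensor_rel :: "'a monoid \<Rightarrow> ('a list \<Rightarrow>\<^sub>0 int) set" where
  "tensor_rel M = Idl\<^bsub>free_ring (carrier M)\<^esub>
     {free_gen (x \<otimes>\<^bsub>M\<^esub> y) - free_gen x - free_gen y | x y. x \<in> carrier M \<and> y \<in> carrier M}"

definition tensor_algebra :: "'a monoid \<Rightarrow> ('a list \<Rightarrow>\<^sub>0 int) set ring" where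
  "tensor_algebra M = free_ring (carrier M) Quot tensor_rel M"

definition tensor_gen :: "'a monoid \<Rightarrow> 'a \<Rightarrow> ('a list \<Rightarrow>\<^sub>0 int) set" where
  "tensor_gen M x = tensor_rel M +>\<^bsub>free_ring (carrier M)\<^esub> free_gen x"

definition tensor_power :: "'a monoid \<Rightarrow> nat \<Rightarrow> ('a list \<Rightarrow>\<^sub>0 int) set set" where
  "tensor_power M n = {tensor_rel M +>\<^bsub>free_ring (carrier M)\<^esub> p | p.
     p \<in> carrier (free_ring (carrier M)) \<and> (\<forall>w\<in>Poly_Mapping.keys p. length w = n)}"


section \<open>K-theory and reduced K-theory\<close>

definition nonzero_group :: "'a multistruct \<Rightarrow> 'a monoid" where
  "nonzero_group F = \<lparr>carrier = carrier F - {hzero F}, monoid.mult = monoid.mult F, monoid.one = monoid.one F\<rparr>"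

definition K_rel :: "'a multistruct \<Rightarrow> ('a list \<Rightarrow>\<^sub>0 int) set set" where
  "K_rel F = Idl\<^bsub>tensor_algebra (nonzero_group F)\<^esub>
     {tensor_gen (nonzero_group F) a \<otimes>\<^bsub>tensor_algebra (nonzero_group F)\<^esub> tensor_gen (nonzero_group F) b
       | a b. a \<in> carrier F - {hzero F} \<and> a \<noteq> \<one>\<^bsub>F\<^esub> \<and> b \<in> \<one>\<^bsub>F\<^esub> \<boxplus>\<^bsub>F\<^esub> (\<boxminus>\<^bsub>F\<^esub> a)}"

definition K_ring :: "'a multistruct \<Rightarrow> ('a list \<Rightarrow>\<^sub>0 int) set set ring" where
  "K_ring F = tensor_algebra (nonzero_group F) Quot K_rel F"

definition K_rho :: "'a multistruct \<Rightarrow> 'a \<Rightarrow> ('a list \<Rightarrow>\<^sub>0 int) set set" where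
  "K_rho F a = K_rel F +>\<^bsub>tensor_algebra (nonzero_group F)\<^esub> tensor_gen (nonzero_group F) a"

text \<open>\<open>K\<^sub>n F\<close>, the degree \<open>n\<close> part of \<^const>\<open>K_ring\<close>\<close>

definition K_group :: "'a multistruct \<Rightarrow> nat \<Rightarrow> ('a list \<Rightarrow>\<^sub>0 int) set set monoid" where
  "K_group F n =
     \<lparr>carrier = (\<lambda>t. K_rel F +>\<^bsub>tensor_algebra (nonzero_group F)\<^esub> t) ` tensor_power (nonzero_group F) n,
      monoid.mult = ring.add (K_ring F), monoid.one = ring.zero (K_ring F)\<rparr>"

definition K_double :: "'a multistruct \<Rightarrow> nat \<Rightarrow> ('a list \<Rightarrow>\<^sub>0 int) set set set" where
  "K_double F n = {x \<oplus>\<^bsub>K_ring F\<^esub> x | x. x \<in> carrier (K_group F n)}"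

definition k_group :: "'a multistruct \<Rightarrow> nat \<Rightarrow> ('a list \<Rightarrow>\<^sub>0 int) set set set monoid" where
  "k_group F n = K_group F n Mod K_double F n"

definition k_class :: "'a multistruct \<Rightarrow> nat \<Rightarrow> ('a list \<Rightarrow>\<^sub>0 int) set set \<Rightarrow> ('a list \<Rightarrow>\<^sub>0 int) set set set" where
  "k_class F n x = K_double F n #>\<^bsub>K_group F n\<^esub> x"

text \<open>\<open>\<rho>(a\<^sub>1) \<dots> \<rho>(a\<^sub>n)\<close> in \<open>k\<^sub>n F\<close>\<close>

definition k_symbol :: "'a multistruct \<Rightarrow> 'a list \<Rightarrow> ('a list \<Rightarrow>\<^sub>0 int) set set set" where
  "k_symbol F as = k_class F (length as)
     (foldr (\<lambda>a x. K_rho F a \<otimes>\<^bsub>K_ring F\<^esub> x) as \<one>\<^bsub>K_ring F\<^esub>)"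

text \<open>The product of classes, in the style of \<^const>\<open>rcoset_mult\<close>: a union of equal cosets.\<close>

definition k_mult :: "'a multistruct \<Rightarrow> nat \<Rightarrow> nat \<Rightarrow>
    ('a list \<Rightarrow>\<^sub>0 int) set set set \<Rightarrow> ('a list \<Rightarrow>\<^sub>0 int) set set set \<Rightarrow> ('a list \<Rightarrow>\<^sub>0 int) set set set" where
  "k_mult F n m X Y = (\<Union>x\<in>X. \<Union>y\<in>Y. k_class F (n + m) (x \<otimes>\<^bsub>K_ring F\<^esub> y))"

definition k_obj :: "'a multistruct \<Rightarrow> ('a list \<Rightarrow>\<^sub>0 int) set set set igr" where
  "k_obj F =
     \<lparr>igr_group = k_group F,
      igr_top = (\<lambda>n. k_symbol F (replicate n (\<boxminus>\<^bsub>F\<^esub> \<one>\<^bsub>F\<^esub>))),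
      igr_h = (\<lambda>n. k_mult F 1 n (k_symbol F [\<boxminus>\<^bsub>F\<^esub> \<one>\<^bsub>F\<^esub>])),
      igr_mult = k_mult F\<rparr>"

definition k_map :: "'a multistruct \<Rightarrow> 'b multistruct \<Rightarrow> ('a \<Rightarrow> 'b) \<Rightarrow>
    nat \<Rightarrow> ('a list \<Rightarrow>\<^sub>0 int) set set set \<Rightarrow> ('b list \<Rightarrow>\<^sub>0 int) set set set" where
  "k_map F L f = (THE g. g \<in> igr_hom (k_obj F) (k_obj L) \<and>
     (\<forall>as\<in>lists (carrier F - {hzero F}). g (length as) (k_symbol F as) = k_symbol L (map f as)))"


section \<open>The functor $\Gamma$\<close>

text \<open>\<open>G(R)\<close> is the disjoint copy of \<open>R\<^sub>1\<close> in the option type, with \<open>e\<^sub>R = Some\<close>, and the added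
  zero is \<^const>\<open>None\<close>. As \<open>R\<^sub>1\<close> is already written multiplicatively, \<open>-1 = Some \<top>\<^sub>1\<close> and
  \<open>a = -b\<close> reads \<open>a = \<top>\<^sub>1 \<otimes> b\<close>.

  Associativity of \<open>\<boxplus>\<close> does not follow from \<^const>\<open>is_igr_plus\<close>: let \<open>R\<^sub>1\<close> have the basis
  \<open>y, a, u, v\<close>, let \<open>\<top>\<^sub>n = 0\<close> for \<open>n \<ge> 1\<close>, let \<open>R\<^sub>2\<close> be the exterior square of \<open>R\<^sub>1\<close> modulo
  \<open>y \<and> a\<close> and \<open>u \<and> v\<close>, and \<open>R\<^sub>n = 0\<close> for \<open>n \<ge> 3\<close>. Then \<open>0 \<in> R\<^sub>1\<close> lies in \<open>a \<boxplus> (b \<boxplus> c)\<close> but not in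
  \<open>(a \<boxplus> b) \<boxplus> c\<close> for \<open>b = y + u\<close>, \<open>c = y + v\<close>. \<^const>\<open>multiring_hom\<close> does not depend on
  associativity, so that the morphisms into \<open>\<Gamma>(R)\<close> make sense for every object \<open>R\<close>.\<close>

definition Gamma_obj :: "'r igr \<Rightarrow> 'r option multistruct" where
  "Gamma_obj R = (let G = igr_group R 1 in
     \<lparr>carrier = insert None (Some ` carrier G),
      monoid.mult = (\<lambda>x y. case (x, y) of (Some a, Some b) \<Rightarrow> Some (a \<otimes>\<^bsub>G\<^esub> b) | _ \<Rightarrow> None),
      monoid.one = Some \<one>\<^bsub>G\<^esub>,
      hadd = (\<lambda>x y. case (x, y) of
           (None, _) \<Rightarrow> {y}
         | (_, None) \<Rightarrow> {x}
         | (Some a, Some b) \<Rightarrow>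
             if a = igr_top R 1 \<otimes>\<^bsub>G\<^esub> b then insert None (Some ` carrier G)
             else {Some c | c. c \<in> carrier G \<and> (\<exists>d\<in>carrier G.
                     a \<otimes>\<^bsub>G\<^esub> b = c \<otimes>\<^bsub>G\<^esub> d \<and> igr_mult R 1 1 a b = igr_mult R 1 1 c d)}),
      hneg = map_option (\<lambda>a. igr_top R 1 \<otimes>\<^bsub>G\<^esub> a),
      hzero = None\<rparr>)"

definition Gamma_map :: "'r igr \<Rightarrow> (nat \<Rightarrow> 'r \<Rightarrow> 's) \<Rightarrow> 'r option \<Rightarrow> 's option" where
  "Gamma_map R f = (\<lambda>x\<in>carrier (Gamma_obj R). map_option (f 1) x)"

definition phi :: "'a multistruct \<Rightarrow> 'a \<Rightarrow> ('a list \<Rightarrow>\<^sub>0 int) set set set option" where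
  "phi F = (\<lambda>a\<in>carrier F. if a = hzero F then None else Some (k_symbol F [a]))"

end

(*
  In reduced K-theory the relation rho(a) rho(-a) = 0 gives graded commutativity, and K_*F has a
  universal property: a map rho(a) |-> f(a) into a ring extends as soon as f is additive and
  f(a) f(b) = 0 for b in 1 - a. Applied to the ring of an inductive graded ring R, which has
  characteristic 2, such an extension descends to k(F). In Gamma(R), an element c lies in a + b
  exactly when (t + a + b) * (a + c) = 0 in R_2, where t = -1; in particular c lies in 1 - a exactly
  when a * c = 0. So a morphism F -> Gamma(R) is the same as data f satisfying the hypotheses of
  the universal property.
*)
theory Submission
  imports Defs "HOL-Algebra.Free_Abelian_Groups" "HOL-Algebra.IntRing"
begin

text \<open>The criterion for \<open>c \<in> a + b\<close> arises as follows. From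
  \<open>ab = cd\<close> and exponent 2 the element \<open>d\<close> must be \<open>abc\<close>.
  Then \<open>a * b = c * d\<close>, expanded with \<open>c * c = t * c\<close>, says that
  \<open>t * c + a * c + a * b + b * c\<close> vanishes, and \<open>a * a = t * a\<close> turns this
  into the product \<open>(t + a + b) * (a + c)\<close>. Written multiplicatively, its factors are
  \<open>-ab\<close> and \<open>ac\<close>. On the other side, multiplying
  \<open>c \<in> a + b\<close> by \<open>a\<close>, with \<open>aa = 1\<close>, gives
  \<open>ac \<in> 1 - (-ab)\<close>: the same pair, now as a defining relation of K-theory. This
  coincidence is why relations of the special form \<open>1 - a\<close> control all sums.

  The relations leave out \<open>a = 1\<close>, since \<open>1 - 1\<close> contains zero. As rho(1)
  = 0 nothing is lost, but that case is split off when a relation is applied to an arbitrary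
  element.

  The universal property produces a map into the whole direct sum of the groups \<open>R_n\<close>.
  To obtain maps from \<open>k_n F\<close> to \<open>R_n\<close> one has to see that degree
  \<open>n\<close> lands in degree \<open>n\<close>, and that the value does not depend on the
  representative modulo doubles.\<close>

section \<open>The ring of an inductive graded ring\<close>

text \<open>\<open>is_igr\<close> asks only for groups; exponent 2 supplies the commutativity that
  the finite products in \<open>igr_ring\<close> rely on.\<close>

lemma group_exp2_imp_comm_group:
  assumes "group G" and "\<And>x. x \<in> carrier G \<Longrightarrow> x [^]\<^bsub>G\<^esub> (2::nat) = \<one>\<^bsub>G\<^esub>"
  shows "comm_group G"
proof -
  interpret group G by (rule assms(1))
  have sq: "x \<otimes>\<^bsub>G\<^esub> x = \<one>\<^bsub>G\<^esub>" if "x \<in> carrier G" for x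
    using assms(2)[OF that] that by (simp add: numeral_2_eq_2)
  show ?thesis
  proof (rule group_comm_groupI)
    fix x y assume xy: "x \<in> carrier G" "y \<in> carrier G"
    then have "inv\<^bsub>G\<^esub> x = x" "inv\<^bsub>G\<^esub> y = y" "inv\<^bsub>G\<^esub> (x \<otimes>\<^bsub>G\<^esub> y) = x \<otimes>\<^bsub>G\<^esub> y"
      by (auto intro!: inv_equality sq)
    then show "x \<otimes>\<^bsub>G\<^esub> y = y \<otimes>\<^bsub>G\<^esub> x"
      using inv_mult_group xy by metis
  qed
qed

section \<open>Iterated structure maps and graded pairings\<close>

lemma igr_h_iter_same [simp]: "igr_h_iter R n n x = x"
  by (simp add: igr_h_iter_def)

lemma igr_h_iter_Suc: "n \<le> p \<Longrightarrow> igr_h_iter R n (Suc p) x = igr_h R p (igr_h_iter R n p x)"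
  by (simp add: igr_h_iter_def)

lemma igr_h_iter_trans:
  assumes "n \<le> p" "p \<le> q"
  shows "igr_h_iter R p q (igr_h_iter R n p x) = igr_h_iter R n q x"
  using assms(2,1) by (induction q rule: dec_induct) (simp_all add: igr_h_iter_Suc)

text \<open>Weak enough to be instantiated at \<open>k_obj F\<close> before the ring laws of its
  direct sum are known. Those laws are then derived by \<open>cring_igr_ring\<close>.\<close>

locale graded_pairing =
  fixes R :: "'r igr"
  assumes comm: "\<And>n. comm_group (igr_group R n)"
    and mult_hom_right:
      "\<And>n m x. x \<in> carrier (igr_group R n) \<Longrightarrow>
        igr_mult R n m x \<in> hom (igr_group R m) (igr_group R (n + m))"
    and mult_hom_left:
      "\<And>n m y. y \<in> carrier (igr_group R m) \<Longrightarrow>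
        (\<lambda>x. igr_mult R n m x y) \<in> hom (igr_group R n) (igr_group R (n + m))"
    and top_closed: "igr_top R 0 \<in> carrier (igr_group R 0)"
begin

abbreviation "C n \<equiv> carrier (igr_group R n)"
abbreviation "Z n \<equiv> \<one>\<^bsub>igr_group R n\<^esub>"
abbreviation "B \<equiv> igr_mult R"

sublocale grp: comm_group "igr_group R n" for n
  by (rule comm)

lemma mult_closed [simp]: "\<lbrakk>x \<in> C n; y \<in> C m\<rbrakk> \<Longrightarrow> B n m x y \<in> C (n + m)"
  using mult_hom_right by (rule hom_in_carrier)

lemma mult_add_right:
  "\<lbrakk>x \<in> C n; y \<in> C m; z \<in> C m\<rbrakk> \<Longrightarrow>
    B n m x (y \<otimes>\<^bsub>igr_group R m\<^esub> z) = B n m x y \<otimes>\<^bsub>igr_group R (n + m)\<^esub> B n m x z"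
  using mult_hom_right by (rule hom_mult)

lemma mult_add_left:
  "\<lbrakk>x \<in> C n; y \<in> C n; z \<in> C m\<rbrakk> \<Longrightarrow>
    B n m (x \<otimes>\<^bsub>igr_group R n\<^esub> y) z = B n m x z \<otimes>\<^bsub>igr_group R (n + m)\<^esub> B n m y z"
  using hom_mult[OF mult_hom_left] .

lemma mult_zero_right [simp]: "x \<in> C n \<Longrightarrow> B n m x (Z m) = Z (n + m)"
  by (rule hom_one[OF mult_hom_right]) auto

lemma mult_zero_left [simp]: "y \<in> C m \<Longrightarrow> B n m (Z n) y = Z (n + m)"
  using hom_one[OF mult_hom_left[of y m n]] by auto

lemma carrier_igr_ring: "carrier (igr_ring R) = {x. (\<forall>n. x n \<in> C n) \<and> finite {n. x n \<noteq> Z n}}"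
  by (auto simp: igr_ring_def carrier_sum_group PiE_def extensional_def)

lemma add_igr_ring: "x \<oplus>\<^bsub>igr_ring R\<^esub> y = (\<lambda>n. x n \<otimes>\<^bsub>igr_group R n\<^esub> y n)"
  by (simp add: igr_ring_def restrict_def)

lemma zero_igr_ring: "\<zero>\<^bsub>igr_ring R\<^esub> = Z"
  by (auto simp: igr_ring_def)

lemma mult_igr_ring:
  "x \<otimes>\<^bsub>igr_ring R\<^esub> y = (\<lambda>n. \<Otimes>\<^bsub>igr_group R n\<^esub>i\<in>{..n}. B i (n - i) (x i) (y (n - i)))"
  by (simp add: igr_ring_def)

lemma mult_closed_diff [simp]: "\<lbrakk>i \<le> n; x \<in> C i; y \<in> C (n - i)\<rbrakk> \<Longrightarrow> B i (n - i) x y \<in> C n"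
  using mult_closed[of x i y "n - i"] by simp

lemma abelian_group_igr_ring: "abelian_group (igr_ring R)"
proof (rule abelian_groupI)
  fix x y assume xy: "x \<in> carrier (igr_ring R)" "y \<in> carrier (igr_ring R)"
  have "{n. x n \<otimes>\<^bsub>igr_group R n\<^esub> y n \<noteq> Z n} \<subseteq> {n. x n \<noteq> Z n} \<union> {n. y n \<noteq> Z n}"
    by auto
  with xy show "x \<oplus>\<^bsub>igr_ring R\<^esub> y \<in> carrier (igr_ring R)"
    by (auto simp: carrier_igr_ring add_igr_ring intro: finite_subset)
next
  fix x assume x: "x \<in> carrier (igr_ring R)"
  then show "\<exists>y\<in>carrier (igr_ring R). y \<oplus>\<^bsub>igr_ring R\<^esub> x = \<zero>\<^bsub>igr_ring R\<^esub>"
    by (intro bexI[of _ "\<lambda>n. inv\<^bsub>igr_group R n\<^esub> x n"])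
      (auto simp: carrier_igr_ring add_igr_ring zero_igr_ring cong: conj_cong)
qed (auto simp: carrier_igr_ring add_igr_ring zero_igr_ring grp.m_ac)

text \<open>Let \<open>x\<close> vanish from degree \<open>N\<close> on and \<open>y\<close> from
  degree \<open>M\<close> on. In degree \<open>n \<ge> N + M\<close> every summand has
  \<open>i \<ge> N\<close> or \<open>n - i \<ge> M\<close>, hence a trivial factor.\<close>

lemma igr_ring_mult_closed:
  assumes x: "x \<in> carrier (igr_ring R)" and y: "y \<in> carrier (igr_ring R)"
  shows "x \<otimes>\<^bsub>igr_ring R\<^esub> y \<in> carrier (igr_ring R)"
proof -
  have xc: "x n \<in> C n" and yc: "y n \<in> C n" for n
    using x y by (auto simp: carrier_igr_ring)
  have bound: "\<exists>N. \<forall>n. u n \<noteq> Z n \<longrightarrow> n < N" if "u \<in> carrier (igr_ring R)" for u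
    using that by (auto simp: carrier_igr_ring finite_nat_iff_bounded)
  obtain N M where N: "\<And>n. x n \<noteq> Z n \<Longrightarrow> n < N" and M: "\<And>n. y n \<noteq> Z n \<Longrightarrow> n < M"
    using bound[OF x] bound[OF y] by blast
  have "(x \<otimes>\<^bsub>igr_ring R\<^esub> y) n = Z n" if "n \<ge> N + M" for n
    unfolding mult_igr_ring
  proof (rule grp.finprod_one_eqI)
    fix i assume i: "i \<in> {..n}"
    show "B i (n - i) (x i) (y (n - i)) = Z n"
    proof (cases "i < N")
      case True
      then have "y (n - i) = Z (n - i)" using M that by force
      then show ?thesis using mult_zero_right[of "x i" i "n - i"] i xc by simp
    next
      case False
      then have "x i = Z i" using N by blast
      then show ?thesis using mult_zero_left[of "y (n - i)" "n - i" i] i yc by simp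
    qed
  qed
  then have "{n. (x \<otimes>\<^bsub>igr_ring R\<^esub> y) n \<noteq> Z n} \<subseteq> {..<N + M}"
    by (auto simp flip: not_le)
  then have "finite {n. (x \<otimes>\<^bsub>igr_ring R\<^esub> y) n \<noteq> Z n}"
    using finite_subset by blast
  moreover have "(x \<otimes>\<^bsub>igr_ring R\<^esub> y) n \<in> C n" for n
    unfolding mult_igr_ring by (rule grp.finprod_closed) (auto simp: xc yc)
  ultimately show ?thesis
    by (simp add: carrier_igr_ring)
qed

lemma igr_ring_distr_right:
  assumes "x \<in> carrier (igr_ring R)" "y \<in> carrier (igr_ring R)" "z \<in> carrier (igr_ring R)"
  shows "z \<otimes>\<^bsub>igr_ring R\<^esub> (x \<oplus>\<^bsub>igr_ring R\<^esub> y) =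
    z \<otimes>\<^bsub>igr_ring R\<^esub> x \<oplus>\<^bsub>igr_ring R\<^esub> z \<otimes>\<^bsub>igr_ring R\<^esub> y"
proof
  fix n
  have c: "x k \<in> C k" "y k \<in> C k" "z k \<in> C k" for k
    using assms by (auto simp: carrier_igr_ring)
  have "B i (n - i) (z i) (x (n - i) \<otimes>\<^bsub>igr_group R (n - i)\<^esub> y (n - i)) =
      B i (n - i) (z i) (x (n - i)) \<otimes>\<^bsub>igr_group R n\<^esub> B i (n - i) (z i) (y (n - i))" if "i \<le> n" for i
    using mult_add_right[of "z i" i "x (n - i)" "n - i" "y (n - i)"] c that by simp
  then show "(z \<otimes>\<^bsub>igr_ring R\<^esub> (x \<oplus>\<^bsub>igr_ring R\<^esub> y)) n =
      (z \<otimes>\<^bsub>igr_ring R\<^esub> x \<oplus>\<^bsub>igr_ring R\<^esub> z \<otimes>\<^bsub>igr_ring R\<^esub> y) n"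
    unfolding mult_igr_ring add_igr_ring
    by (subst grp.finprod_multf[symmetric])
      (auto intro!: grp.finprod_cong' simp: c simp del: grp.finprod_multf)
qed

lemma igr_ring_distr_left:
  assumes "x \<in> carrier (igr_ring R)" "y \<in> carrier (igr_ring R)" "z \<in> carrier (igr_ring R)"
  shows "(x \<oplus>\<^bsub>igr_ring R\<^esub> y) \<otimes>\<^bsub>igr_ring R\<^esub> z =
    x \<otimes>\<^bsub>igr_ring R\<^esub> z \<oplus>\<^bsub>igr_ring R\<^esub> y \<otimes>\<^bsub>igr_ring R\<^esub> z"
proof
  fix n
  have c: "x k \<in> C k" "y k \<in> C k" "z k \<in> C k" for k
    using assms by (auto simp: carrier_igr_ring)
  have "B i (n - i) (x i \<otimes>\<^bsub>igr_group R i\<^esub> y i) (z (n - i)) =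
      B i (n - i) (x i) (z (n - i)) \<otimes>\<^bsub>igr_group R n\<^esub> B i (n - i) (y i) (z (n - i))" if "i \<le> n" for i
    using mult_add_left[of "x i" i "y i" "z (n - i)" "n - i"] c that by simp
  then show "((x \<oplus>\<^bsub>igr_ring R\<^esub> y) \<otimes>\<^bsub>igr_ring R\<^esub> z) n =
      (x \<otimes>\<^bsub>igr_ring R\<^esub> z \<oplus>\<^bsub>igr_ring R\<^esub> y \<otimes>\<^bsub>igr_ring R\<^esub> z) n"
    unfolding mult_igr_ring add_igr_ring
    by (subst grp.finprod_multf[symmetric])
      (auto intro!: grp.finprod_cong' simp: c simp del: grp.finprod_multf)
qed

lemma igr_ring_zero_left:
  assumes "x \<in> carrier (igr_ring R)"
  shows "\<zero>\<^bsub>igr_ring R\<^esub> \<otimes>\<^bsub>igr_ring R\<^esub> x = \<zero>\<^bsub>igr_ring R\<^esub>"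
proof -
  interpret A: abelian_group "igr_ring R" by (rule abelian_group_igr_ring)
  have "(\<zero>\<^bsub>igr_ring R\<^esub> \<otimes>\<^bsub>igr_ring R\<^esub> x) \<oplus>\<^bsub>igr_ring R\<^esub> (\<zero>\<^bsub>igr_ring R\<^esub> \<otimes>\<^bsub>igr_ring R\<^esub> x) =
      \<zero>\<^bsub>igr_ring R\<^esub> \<otimes>\<^bsub>igr_ring R\<^esub> x"
    using assms by (subst igr_ring_distr_left[symmetric]) auto
  then show ?thesis
    using assms by (metis A.add.l_cancel_one' A.zero_closed igr_ring_mult_closed)
qed

lemma igr_ring_zero_right:
  assumes "x \<in> carrier (igr_ring R)"
  shows "x \<otimes>\<^bsub>igr_ring R\<^esub> \<zero>\<^bsub>igr_ring R\<^esub> = \<zero>\<^bsub>igr_ring R\<^esub>"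
proof -
  interpret A: abelian_group "igr_ring R" by (rule abelian_group_igr_ring)
  have "(x \<otimes>\<^bsub>igr_ring R\<^esub> \<zero>\<^bsub>igr_ring R\<^esub>) \<oplus>\<^bsub>igr_ring R\<^esub> (x \<otimes>\<^bsub>igr_ring R\<^esub> \<zero>\<^bsub>igr_ring R\<^esub>) =
      x \<otimes>\<^bsub>igr_ring R\<^esub> \<zero>\<^bsub>igr_ring R\<^esub>"
    using assms by (subst igr_ring_distr_right[symmetric]) auto
  then show ?thesis
    using assms by (metis A.add.l_cancel_one' A.zero_closed igr_ring_mult_closed)
qed

section \<open>Homogeneous elements and induction on the support\<close>

definition delta :: "nat \<Rightarrow> 'r \<Rightarrow> nat \<Rightarrow> 'r" where
  "delta n x = (\<lambda>k. if k = n then x else Z k)"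

lemma delta_same [simp]: "delta n x n = x"
  by (simp add: delta_def)

lemma delta_eq_iff [simp]: "delta n x = delta n y \<longleftrightarrow> x = y"
  by (metis delta_same)

lemma delta_closed [simp]: "x \<in> C n \<Longrightarrow> delta n x \<in> carrier (igr_ring R)"
  by (auto simp: carrier_igr_ring delta_def intro: finite_subset[of _ "{n}"])

lemma delta_add:
  "\<lbrakk>x \<in> C n; y \<in> C n\<rbrakk> \<Longrightarrow>
    delta n x \<oplus>\<^bsub>igr_ring R\<^esub> delta n y = delta n (x \<otimes>\<^bsub>igr_group R n\<^esub> y)"
  by (auto simp: add_igr_ring delta_def)

lemma delta_zero [simp]: "delta n (Z n) = \<zero>\<^bsub>igr_ring R\<^esub>"
  by (auto simp: zero_igr_ring delta_def)

lemma one_igr_ring: "\<one>\<^bsub>igr_ring R\<^esub> = delta 0 (igr_top R 0)"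
  by (auto simp: igr_ring_def delta_def)

text \<open>Of the convolution in degree \<open>n + m\<close> only the summand \<open>i = n\<close>
  survives. Together with \<open>delta_eq_iff\<close> this translates ring identities into
  identities for the products \<open>igr_mult\<close>, and back.\<close>

lemma delta_mult:
  assumes "x \<in> C n" "y \<in> C m"
  shows "delta n x \<otimes>\<^bsub>igr_ring R\<^esub> delta m y = delta (n + m) (B n m x y)"
proof
  fix k
  show "(delta n x \<otimes>\<^bsub>igr_ring R\<^esub> delta m y) k = delta (n + m) (B n m x y) k"
  proof (cases "k = n + m")
    case True
    have "(\<Otimes>\<^bsub>igr_group R k\<^esub>i\<in>{..k}. B i (k - i) (delta n x i) (delta m y (k - i))) =
        (\<Otimes>\<^bsub>igr_group R k\<^esub>i\<in>{..k}. if n = i then B n m x y else Z k)"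
      using True assms
    proof (intro grp.finprod_cong')
      fix i assume "i \<in> {..k}"
      then show "B i (k - i) (delta n x i) (delta m y (k - i)) = (if n = i then B n m x y else Z k)"
        using True assms mult_zero_left[of "delta m y (k - i)" "k - i" i]
        by (auto simp: delta_def)
    qed auto
    also have "\<dots> = B n m x y"
      using True assms by (subst grp.finprod_singleton) auto
    finally show ?thesis
      by (simp add: mult_igr_ring True)
  next
    case False
    have "B i (k - i) (delta n x i) (delta m y (k - i)) = Z k" if "i \<le> k" for i
      using that assms False mult_zero_left[of "delta m y (k - i)" "k - i" i]
        mult_zero_right[of "delta n x i" i "k - i"]
      by (cases "i = n") (auto simp: delta_def)
    then have "(\<Otimes>\<^bsub>igr_group R k\<^esub>i\<in>{..k}. B i (k - i) (delta n x i) (delta m y (k - i))) = Z k"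
      by (intro grp.finprod_one_eqI) auto
    then show ?thesis
      using False by (simp add: mult_igr_ring delta_def)
  qed
qed

text \<open>Induction on the finite support: the component at one degree is split off as a
  \<open>delta\<close>, and the rest has that degree removed.\<close>

lemma igr_ring_induct [consumes 1, case_names zero delta add]:
  assumes "x \<in> carrier (igr_ring R)"
    and "P \<zero>\<^bsub>igr_ring R\<^esub>"
    and "\<And>n a. a \<in> C n \<Longrightarrow> P (delta n a)"
    and "\<And>x y. \<lbrakk>x \<in> carrier (igr_ring R); y \<in> carrier (igr_ring R); P x; P y\<rbrakk> \<Longrightarrow> P (x \<oplus>\<^bsub>igr_ring R\<^esub> y)"
  shows "P x"
proof -
  have "finite {n. x n \<noteq> Z n}"
    using assms(1) by (simp add: carrier_igr_ring)
  then show ?thesis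
    using assms(1)
  proof (induction "{n. x n \<noteq> Z n}" arbitrary: x rule: finite_induct)
    case empty
    then have "x = \<zero>\<^bsub>igr_ring R\<^esub>" by (auto simp: zero_igr_ring)
    then show ?case using assms(2) by simp
  next
    case (insert k A)
    define y where "y = x(k := Z k)"
    have A: "A = {n. y n \<noteq> Z n}"
      using insert.hyps by (auto simp: y_def)
    have y: "y \<in> carrier (igr_ring R)"
      using insert.prems insert.hyps(1) A by (auto simp: carrier_igr_ring y_def)
    have xk: "x k \<in> C k" "\<And>n. x n \<in> C n"
      using insert.prems by (auto simp: carrier_igr_ring)
    have "x = delta k (x k) \<oplus>\<^bsub>igr_ring R\<^esub> y"
      using xk by (auto simp: add_igr_ring delta_def y_def)
    moreover have "P y"
      using insert.hyps(3)[OF A y] .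
    ultimately show ?case
      using assms(3)[OF xk(1)] assms(4)[of "delta k (x k)" y] xk y by (metis delta_closed)
  qed
qed

text \<open>Both sides of commutativity, associativity and the unit law are additive in each
  argument, so \<open>igr_ring_induct\<close> reduces them to homogeneous elements, where they are
  the three hypotheses.\<close>

lemma cring_igr_ring:
  assumes assoc: "\<And>n m l x y z. \<lbrakk>x \<in> C n; y \<in> C m; z \<in> C l\<rbrakk> \<Longrightarrow>
      B (n + m) l (B n m x y) z = B n (m + l) x (B m l y z)"
    and comm: "\<And>n m x y. \<lbrakk>x \<in> C n; y \<in> C m\<rbrakk> \<Longrightarrow> B n m x y = B m n y x"
    and one: "\<And>n x. x \<in> C n \<Longrightarrow> B 0 n (igr_top R 0) x = x"
  shows "cring (igr_ring R)"
proof -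
  let ?R = "igr_ring R"
  interpret A: abelian_group ?R by (rule abelian_group_igr_ring)
  note [simp] = igr_ring_mult_closed
  have one_closed: "\<one>\<^bsub>?R\<^esub> \<in> carrier ?R"
    by (simp add: one_igr_ring top_closed)
  have comm': "x \<otimes>\<^bsub>?R\<^esub> y = y \<otimes>\<^bsub>?R\<^esub> x" if "x \<in> carrier ?R" "y \<in> carrier ?R" for x y
    using that
  proof (induction x rule: igr_ring_induct)
    case zero
    then show ?case by (simp add: igr_ring_zero_left igr_ring_zero_right)
  next
    case (delta n a)
    from delta(2,1) show ?case
    proof (induction y rule: igr_ring_induct)
      case zero
      then show ?case by (simp add: igr_ring_zero_left igr_ring_zero_right)
    next
      case (delta m b)
      then show ?case
        using comm[of a n b m] by (simp add: delta_mult add.commute)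
    next
      case (add u v)
      then show ?case by (simp add: igr_ring_distr_left igr_ring_distr_right)
    qed
  next
    case (add u v)
    then show ?case by (simp add: igr_ring_distr_left igr_ring_distr_right)
  qed
  have assoc': "(x \<otimes>\<^bsub>?R\<^esub> y) \<otimes>\<^bsub>?R\<^esub> z = x \<otimes>\<^bsub>?R\<^esub> (y \<otimes>\<^bsub>?R\<^esub> z)"
    if x: "x \<in> carrier ?R" and y: "y \<in> carrier ?R" and z: "z \<in> carrier ?R" for x y z
  proof -
    \<comment> \<open>Associativity is freed from homogeneity one argument at a time, starting with
      the last: \<open>dd\<close> allows any third factor, \<open>dv\<close> also any second
      one.\<close>
    have dd: "(delta n a \<otimes>\<^bsub>?R\<^esub> delta m b) \<otimes>\<^bsub>?R\<^esub> w = delta n a \<otimes>\<^bsub>?R\<^esub> (delta m b \<otimes>\<^bsub>?R\<^esub> w)"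
      if "a \<in> C n" "b \<in> C m" "w \<in> carrier ?R" for n a m b w
      using that(3,1,2)
      by (induction w rule: igr_ring_induct)
        (simp_all add: igr_ring_zero_left igr_ring_zero_right delta_mult assoc add.assoc igr_ring_distr_left igr_ring_distr_right)
    have dv: "(delta n a \<otimes>\<^bsub>?R\<^esub> v) \<otimes>\<^bsub>?R\<^esub> z = delta n a \<otimes>\<^bsub>?R\<^esub> (v \<otimes>\<^bsub>?R\<^esub> z)"
      if "a \<in> C n" "v \<in> carrier ?R" for n a v
      using that(2,1) z
      by (induction v rule: igr_ring_induct)
        (simp_all add: igr_ring_zero_left igr_ring_zero_right dd igr_ring_distr_left igr_ring_distr_right)
    show ?thesis
      using x y z
      by (induction x rule: igr_ring_induct)
        (simp_all add: igr_ring_zero_left igr_ring_zero_right dv igr_ring_distr_left igr_ring_distr_right)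
  qed
  have one': "\<one>\<^bsub>?R\<^esub> \<otimes>\<^bsub>?R\<^esub> x = x" if "x \<in> carrier ?R" for x
    using that
    by (induction x rule: igr_ring_induct)
      (simp_all add: igr_ring_zero_right one_igr_ring delta_mult one top_closed igr_ring_distr_right)
  show ?thesis
  proof (rule cringI)
    show "Group.comm_monoid ?R"
      by (rule comm_monoidI) (auto intro: assoc' comm' simp: one' one_closed)
  qed (auto simp: A.abelian_group_axioms igr_ring_distr_left)
qed

text \<open>The compatibility of iterated \<open>h\<close> with products is derived here. As
  \<open>h\<close> is multiplication by \<open>igr_top R 1\<close>, it slides out of the left factor
  by associativity (\<open>left\<close>), and out of the right factor by swapping the factors, using
  \<open>left\<close>, and swapping back.\<close>

lemma is_igrI:
  assumes R0: "igr_group R 0 \<cong> integer_mod_group 2" and top0: "igr_top R 0 \<noteq> Z 0"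
    and exp2: "\<And>n x. x \<in> C n \<Longrightarrow> x \<otimes>\<^bsub>igr_group R n\<^esub> x = Z n"
    and top: "\<And>n. igr_top R n \<in> C n"
    and h: "\<And>n x. x \<in> C n \<Longrightarrow> igr_h R n x = B 1 n (igr_top R 1) x"
    and h_top: "\<And>n. igr_h R n (igr_top R n) = igr_top R (Suc n)"
    and assoc: "\<And>n m l x y z. \<lbrakk>x \<in> C n; y \<in> C m; z \<in> C l\<rbrakk> \<Longrightarrow>
      B (n + m) l (B n m x y) z = B n (m + l) x (B m l y z)"
    and comm: "\<And>n m x y. \<lbrakk>x \<in> C n; y \<in> C m\<rbrakk> \<Longrightarrow> B n m x y = B m n y x"
    and one: "\<And>n x. x \<in> C n \<Longrightarrow> B 0 n (igr_top R 0) x = x"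
  shows "is_igr R"
proof -
  have h_closed: "igr_h R n x \<in> C (Suc n)" if "x \<in> C n" for n x
    using mult_closed[OF top[of 1] that] that by (simp add: h)
  have h_hom: "igr_h R n \<in> hom (igr_group R n) (igr_group R (Suc n))" for n
    using h_closed mult_add_right[OF top[of 1], of _ n] by (auto intro!: homI simp: h)
  have iter_closed: "igr_h_iter R n p x \<in> C p" if "n \<le> p" "x \<in> C n" for n p x
    using that by (induction p rule: dec_induct) (simp_all add: igr_h_iter_Suc h_closed)
  have left: "B p m (igr_h_iter R n p x) y = igr_h_iter R (n + m) (p + m) (B n m x y)"
    if "n \<le> p" "x \<in> C n" "y \<in> C m" for n m p x y
    using that(1)
  proof (induction p rule: dec_induct)
    case (step p)
    let ?u = "igr_h_iter R n p x"
    have u: "?u \<in> C p" using iter_closed step that by simp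
    have "B (Suc p) m (igr_h_iter R n (Suc p) x) y = B (1 + p) m (B 1 p (igr_top R 1) ?u) y"
      using step u by (simp add: igr_h_iter_Suc h)
    also have "\<dots> = igr_h R (p + m) (B p m ?u y)"
      using assoc[OF top[of 1] u that(3)] mult_closed[OF u that(3)] by (simp add: h)
    also have "\<dots> = igr_h_iter R (n + m) (Suc p + m) (B n m x y)"
      using step by (simp add: igr_h_iter_Suc)
    finally show ?case .
  qed simp
  have iter: "B p q (igr_h_iter R n p x) (igr_h_iter R m q y) = igr_h_iter R (n + m) (p + q) (B n m x y)"
    if "n \<le> p" "m \<le> q" "x \<in> C n" "y \<in> C m" for n m p q x y
  proof -
    let ?u = "igr_h_iter R n p x" and ?v = "igr_h_iter R m q y"
    have u: "?u \<in> C p" and v: "?v \<in> C q" using iter_closed that by auto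
    have "B p q ?u ?v = igr_h_iter R (m + p) (q + p) (B m p y ?u)"
      using comm[OF u v] left[OF that(2,4) u] by simp
    also have "\<dots> = igr_h_iter R (p + m) (p + q) (igr_h_iter R (n + m) (p + m) (B n m x y))"
      using comm[OF that(4) u] left[OF that(1,3,4)] by (simp add: add.commute)
    also have "\<dots> = igr_h_iter R (n + m) (p + q) (B n m x y)"
      using that by (intro igr_h_iter_trans) auto
    finally show ?thesis .
  qed
  have cring: "cring (igr_ring R)"
    by (rule cring_igr_ring) (fact assoc comm one)+
  have sq: "x [^]\<^bsub>igr_group R n\<^esub> (2::nat) = Z n" if "x \<in> C n" for n x
    using that exp2 by (simp add: numeral_2_eq_2)
  show ?thesis
    unfolding is_igr_def
    by (intro conjI allI ballI impI)
      (assumption | rule R0 top0 grp.is_group sq top h_hom h_top h mult_hom_right mult_hom_left cring iter)+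
qed

end

lemma is_igr_graded_pairing:
  assumes "is_igr R"
  shows "graded_pairing R"
proof (rule graded_pairing.intro)
  show "comm_group (igr_group R n)" for n
    by (rule group_exp2_imp_comm_group) (use assms in \<open>auto simp: is_igr_def\<close>)
qed (use assms in \<open>auto simp: is_igr_def\<close>)

locale inductive_graded_ring = graded_pairing R for R :: "'r igr" +
  assumes igr: "is_igr R"
begin

lemma is_cring: "cring (igr_ring R)"
  using igr by (simp add: is_igr_def)

sublocale ring: cring "igr_ring R"
  by (rule is_cring)

lemma top_closed_all [simp]: "igr_top R n \<in> C n"
  using igr by (simp add: is_igr_def)

lemma sq_one [simp]: "x \<in> C n \<Longrightarrow> x \<otimes>\<^bsub>igr_group R n\<^esub> x = Z n"
  using igr grp.is_group[of n] by (auto simp: is_igr_def numeral_2_eq_2)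

lemma mult_comm:
  assumes "x \<in> C n" "y \<in> C m"
  shows "B n m x y = B m n y x"
proof -
  have "delta n x \<otimes>\<^bsub>igr_ring R\<^esub> delta m y = delta m y \<otimes>\<^bsub>igr_ring R\<^esub> delta n x"
    using assms by (simp add: ring.m_comm)
  then show ?thesis
    using assms by (simp add: delta_mult add.commute[of m n])
qed

lemma mult_top_left:
  assumes "x \<in> C n"
  shows "B 0 n (igr_top R 0) x = x"
proof -
  have "\<one>\<^bsub>igr_ring R\<^esub> \<otimes>\<^bsub>igr_ring R\<^esub> delta n x = delta n x"
    using assms by simp
  then show ?thesis
    using assms top_closed by (simp add: one_igr_ring delta_mult)
qed

lemma igr_prod_closed: "set as \<subseteq> C 1 \<Longrightarrow> igr_prod R as \<in> C (length as)"
proof (induction as)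
  case (Cons a as)
  then show ?case using mult_closed[of a 1 "igr_prod R as" "length as"] by simp
qed simp

lemma top_mult_top: "B 1 n (igr_top R 1) (igr_top R n) = igr_top R (Suc n)"
proof -
  have "igr_h R n (igr_top R n) = igr_top R (Suc n)" "\<forall>x\<in>C n. igr_h R n x = B 1 n (igr_top R 1) x"
    using igr by (simp_all add: is_igr_def)
  then show ?thesis by simp
qed

lemma igr_prod_replicate_top: "igr_prod R (replicate n (igr_top R 1)) = igr_top R n"
  using top_mult_top by (induction n) simp_all

end

section \<open>Morphisms of inductive graded rings in degreewise form\<close>

lemma is_igr_inductive_graded_ring: "is_igr R \<Longrightarrow> inductive_graded_ring R"
  by (simp add: inductive_graded_ring_def inductive_graded_ring_axioms_def is_igr_graded_pairing)

text \<open>The ring homomorphism condition concerns the direct sum. Evaluated at homogeneous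
  elements it is compatibility with each product; conversely, additivity extends that compatibility
  from homogeneous elements to their sums.\<close>

lemma igr_hom_iff:
  assumes "is_igr R" "is_igr S"
  shows "f \<in> igr_hom R S \<longleftrightarrow>
    (\<forall>n. f n \<in> hom (igr_group R n) (igr_group S n) \<and> f n \<in> extensional (carrier (igr_group R n)) \<and>
      f n (igr_top R n) = igr_top S n) \<and>
    (\<forall>n m. \<forall>x\<in>carrier (igr_group R n). \<forall>y\<in>carrier (igr_group R m).
      f (n + m) (igr_mult R n m x y) = igr_mult S n m (f n x) (f m y))"
    (is "_ \<longleftrightarrow> ?A \<and> ?M")
proof -
  interpret R: inductive_graded_ring R by (rule is_igr_inductive_graded_ring) fact
  interpret S: inductive_graded_ring S by (rule is_igr_inductive_graded_ring) fact
  define \<phi> where "\<phi> = (\<lambda>x n. f n (x n))"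
  have "\<phi> \<in> ring_hom (igr_ring R) (igr_ring S) \<longleftrightarrow> ?M" if A: ?A
  proof -
    have fc [simp]: "f n x \<in> S.C n" if "x \<in> R.C n" for n x
      using A that by (auto simp: hom_def)
    have f0 [simp]: "f n (R.Z n) = S.Z n" for n
      using A R.grp.is_group S.grp.is_group hom_one by blast
    have fadd: "f n (x \<otimes>\<^bsub>igr_group R n\<^esub> y) = f n x \<otimes>\<^bsub>igr_group S n\<^esub> f n y"
      if "x \<in> R.C n" "y \<in> R.C n" for n x y
      using A that by (auto simp: hom_def)
    have \<phi>c [simp]: "\<phi> x \<in> carrier (igr_ring S)" if "x \<in> carrier (igr_ring R)" for x
      using that by (auto simp: R.carrier_igr_ring S.carrier_igr_ring \<phi>_def
          intro: finite_subset[rotated])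
    have \<phi>d: "\<phi> (R.delta n x) = S.delta n (f n x)" for n x
      by (auto simp: \<phi>_def R.delta_def S.delta_def)
    have \<phi>0: "\<phi> \<zero>\<^bsub>igr_ring R\<^esub> = \<zero>\<^bsub>igr_ring S\<^esub>"
      by (simp add: \<phi>_def R.zero_igr_ring S.zero_igr_ring)
    have \<phi>add: "\<phi> (x \<oplus>\<^bsub>igr_ring R\<^esub> y) = \<phi> x \<oplus>\<^bsub>igr_ring S\<^esub> \<phi> y"
      if "x \<in> carrier (igr_ring R)" "y \<in> carrier (igr_ring R)" for x y
      using that by (auto simp: \<phi>_def R.add_igr_ring S.add_igr_ring R.carrier_igr_ring fadd)
    show ?thesis
    proof
      assume \<phi>: "\<phi> \<in> ring_hom (igr_ring R) (igr_ring S)"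
      have "f (n + m) (R.B n m x y) = S.B n m (f n x) (f m y)" if "x \<in> R.C n" "y \<in> R.C m" for n m x y
        using ring_hom_mult[OF \<phi>, of "R.delta n x" "R.delta m y"] that
        by (simp add: R.delta_mult S.delta_mult \<phi>d)
      then show ?M by blast
    next
      assume M: ?M
      have d: "\<phi> (R.delta n a \<otimes>\<^bsub>igr_ring R\<^esub> y) = \<phi> (R.delta n a) \<otimes>\<^bsub>igr_ring S\<^esub> \<phi> y"
        if "a \<in> R.C n" "y \<in> carrier (igr_ring R)" for n a y
        using that(2,1)
        by (induction y rule: R.igr_ring_induct)
          (simp_all add: \<phi>0 \<phi>d R.delta_mult S.delta_mult M R.ring.r_distr S.ring.r_distr \<phi>add)
      have "\<phi> (x \<otimes>\<^bsub>igr_ring R\<^esub> y) = \<phi> x \<otimes>\<^bsub>igr_ring S\<^esub> \<phi> y"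
        if "x \<in> carrier (igr_ring R)" "y \<in> carrier (igr_ring R)" for x y
        using that
        by (induction x rule: R.igr_ring_induct)
          (simp_all add: \<phi>0 d R.ring.l_distr S.ring.l_distr \<phi>add)
      then show "\<phi> \<in> ring_hom (igr_ring R) (igr_ring S)"
        by (intro ring_hom_memI) (simp_all add: \<phi>add R.one_igr_ring S.one_igr_ring \<phi>d A)
    qed
  qed
  then show ?thesis
    by (auto simp: igr_hom_def \<phi>_def)
qed

lemma igr_prod_hom:
  assumes "is_igr R" "is_igr S" "f \<in> igr_hom R S" "set as \<subseteq> carrier (igr_group R 1)"
  shows "f (length as) (igr_prod R as) = igr_prod S (map (f 1) as)"
proof -
  interpret R: inductive_graded_ring R by (rule is_igr_inductive_graded_ring) fact
  have f: "f n (igr_top R n) = igr_top S n"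
      "\<lbrakk>x \<in> R.C n; y \<in> R.C m\<rbrakk> \<Longrightarrow> f (n + m) (R.B n m x y) = igr_mult S n m (f n x) (f m y)"
    for n m x y
    using assms(3) unfolding igr_hom_iff[OF assms(1,2)] by blast+
  show ?thesis
    using assms(4)
  proof (induction as)
    case (Cons a as)
    then show ?case
      using f(2)[of a 1 "igr_prod R as" "length as"] by (simp add: R.igr_prod_closed)
  qed (simp add: f)
qed

lemma igr_id_hom:
  assumes "is_igr R"
  shows "igr_id R \<in> igr_hom R R"
proof -
  interpret R: inductive_graded_ring R by (rule is_igr_inductive_graded_ring) fact
  show ?thesis
    using assms by (auto simp: igr_hom_iff igr_id_def hom_def)
qed

lemma igr_compose_hom:
  assumes "is_igr R" "is_igr S" "is_igr T" "f \<in> igr_hom R S" "g \<in> igr_hom S T"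
  shows "igr_compose R g f \<in> igr_hom R T"
proof -
  interpret R: inductive_graded_ring R by (rule is_igr_inductive_graded_ring) fact
  have fg: "f n \<in> hom (igr_group R n) (igr_group S n)" "f n (igr_top R n) = igr_top S n"
      "g n \<in> hom (igr_group S n) (igr_group T n)" "g n (igr_top S n) = igr_top T n"
      "\<lbrakk>x \<in> R.C n; y \<in> R.C m\<rbrakk> \<Longrightarrow> f (n + m) (R.B n m x y) = igr_mult S n m (f n x) (f m y)"
      "\<lbrakk>x' \<in> carrier (igr_group S n); y' \<in> carrier (igr_group S m)\<rbrakk> \<Longrightarrow>
        g (n + m) (igr_mult S n m x' y') = igr_mult T n m (g n x') (g m y')"
    for n m x y x' y'
    using assms(4,5) unfolding igr_hom_iff[OF assms(1,2)] igr_hom_iff[OF assms(2,3)] by blast+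
  have fc: "x \<in> R.C n \<Longrightarrow> f n x \<in> carrier (igr_group S n)" for n x
    using fg(1) by (rule hom_in_carrier)
  have "compose (R.C n) (g n) (f n) \<in> hom (igr_group R n) (igr_group T n)" for n
    using fg(1,3)[of n] by (rule R.grp.hom_compose)
  then show ?thesis
    using assms(1,3) fg(2,4,5,6) by (auto simp: igr_hom_iff igr_compose_def fc compose_def)
qed

section \<open>Universal properties of the free ring and of K-theory\<close>

lemma carrier_free_ring [simp]: "p \<in> carrier (free_ring S) \<longleftrightarrow> Poly_Mapping.keys p \<subseteq> lists S"
  by (simp add: free_ring_def)

lemma free_ring_simps [simp]:
  "p \<oplus>\<^bsub>free_ring S\<^esub> q = p + q" "p \<otimes>\<^bsub>free_ring S\<^esub> q = p * q"
  "\<zero>\<^bsub>free_ring S\<^esub> = 0" "\<one>\<^bsub>free_ring S\<^esub> = 1"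
  by (simp_all add: free_ring_def)

lemma one_free_ring_eq_single: "(1 :: 'a list \<Rightarrow>\<^sub>0 int) = Poly_Mapping.single [] 1"
  by (metis single_one zero_list_def)

lemma keys_mult_lists:
  assumes "Poly_Mapping.keys p \<subseteq> lists S" "Poly_Mapping.keys q \<subseteq> lists S"
  shows "Poly_Mapping.keys (p * q) \<subseteq> lists S"
  using keys_mult[of p q] assms by (fastforce simp: plus_list_def)

lemma ring_free_ring: "ring (free_ring S)"
proof (rule ringI)
  show "abelian_group (free_ring S)"
  proof (rule abelian_groupI)
    fix x assume "x \<in> carrier (free_ring S)"
    then show "\<exists>y\<in>carrier (free_ring S). y \<oplus>\<^bsub>free_ring S\<^esub> x = \<zero>\<^bsub>free_ring S\<^esub>"
      by (intro bexI[of _ "- x"]) auto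
  qed (auto dest: subsetD[OF keys_add])
  show "Group.monoid (free_ring S)"
    by (rule monoidI) (simp_all add: keys_mult_lists mult.assoc zero_list_def)
qed (auto simp: algebra_simps)

text \<open>Additively the free ring is the free abelian group on words, which gives an additive
  extension of \<open>W\<close>. It is multiplicative because \<open>W\<close> turns concatenation
  into products; \<open>hmult1\<close> and \<open>hmult\<close> extend this from words to arbitrary
  elements, one factor after the other.\<close>

lemma free_ring_universal:
  assumes "ring A" and f: "f \<in> S \<rightarrow> carrier A"
  obtains h where "h \<in> ring_hom (free_ring S) A"
    and "\<And>w. w \<in> lists S \<Longrightarrow>
      h (Poly_Mapping.single w 1) = foldr (\<lambda>a x. f a \<otimes>\<^bsub>A\<^esub> x) w \<one>\<^bsub>A\<^esub>"
proof -
  interpret A: ring A by fact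
  define W where "W = (\<lambda>w. foldr (\<lambda>a x. f a \<otimes>\<^bsub>A\<^esub> x) w \<one>\<^bsub>A\<^esub>)"
  have Wc: "W w \<in> carrier A" if "w \<in> lists S" for w
    using that f by (induction w) (auto simp: W_def)
  have Wapp: "W (v @ w) = W v \<otimes>\<^bsub>A\<^esub> W w" if "v \<in> lists S" "w \<in> lists S" for v w
    using that
  proof (induction v)
    case Nil
    then show ?case using Wc[of w] by (simp add: W_def)
  next
    case (Cons a v)
    have "W (a # u) = f a \<otimes>\<^bsub>A\<^esub> W u" for u by (simp add: W_def)
    moreover have "f a \<in> carrier A" using f Cons.hyps by auto
    ultimately show ?case
      using Cons.IH Cons.hyps Cons.prems Wc[of v] Wc[of w] by (simp add: A.m_assoc)
  qed
  obtain h where h: "h \<in> hom (free_Abelian_group (lists S)) (add_monoid A)"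
    and hW: "\<And>w. w \<in> lists S \<Longrightarrow> h (Poly_Mapping.single w 1) = W w"
    by (rule A.add.free_Abelian_group_universal[of W "lists S"]) (use Wc in auto)
  have hc: "h p \<in> carrier A" if "Poly_Mapping.keys p \<subseteq> lists S" for p
    using hom_in_carrier[OF h] that by simp
  have hadd: "h (p + q) = h p \<oplus>\<^bsub>A\<^esub> h q"
    if "Poly_Mapping.keys p \<subseteq> lists S" "Poly_Mapping.keys q \<subseteq> lists S" for p q
    using hom_mult[OF h] that by simp
  have h0: "h 0 = \<zero>\<^bsub>A\<^esub>"
    using hom_one[OF h] A.add.is_group by simp
  \<comment> \<open>\<open>frag_induction\<close> reaches every element from single words by
    differences, so subtraction has to be respected explicitly.\<close>
  have hdiff: "h (p - q) = h p \<ominus>\<^bsub>A\<^esub> h q"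
    if "Poly_Mapping.keys p \<subseteq> lists S" "Poly_Mapping.keys q \<subseteq> lists S" for p q
  proof -
    have k: "Poly_Mapping.keys (p - q) \<subseteq> lists S"
      using keys_diff[of p q] that by blast
    have "h p = h (p - q) \<oplus>\<^bsub>A\<^esub> h q"
      using hadd[OF k that(2)] by simp
    then show ?thesis
      using hc[OF k] hc[OF that(2)] by (simp add: A.minus_eq A.a_assoc A.r_neg)
  qed
  have hmult1: "h (Poly_Mapping.single v 1 * q) = W v \<otimes>\<^bsub>A\<^esub> h q"
    if "Poly_Mapping.keys q \<subseteq> lists S" "v \<in> lists S" for v q
  proof -
    \<comment> \<open>The support condition is carried along in the claim, because the difference
      case of \<open>frag_induction\<close> yields nothing about \<open>a\<close> and
      \<open>b\<close> beyond the claim itself.\<close>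
    have "Poly_Mapping.keys q \<subseteq> lists S \<and> h (Poly_Mapping.single v 1 * q) = W v \<otimes>\<^bsub>A\<^esub> h q"
      using that(1)
    proof (induction q rule: frag_induction)
      case zero
      then show ?case using Wc that by (simp add: h0)
    next
      case (one w)
      then show ?case
        using that(2) by (simp add: mult_single plus_list_def hW Wapp)
    next
      case (diff a b)
      have "Poly_Mapping.keys (a - b) \<subseteq> lists S"
        using keys_diff[of a b] diff by blast
      then show ?case
        using diff that(2) hc[of a] hc[of b] Wc[of v]
          keys_mult_lists[of "Poly_Mapping.single v 1" S a]
          keys_mult_lists[of "Poly_Mapping.single v 1" S b]
        by (simp add: right_diff_distrib hdiff A.minus_eq A.r_distr A.r_minus)
    qed
    then show ?thesis ..
  qed
  have hmult: "h (p * q) = h p \<otimes>\<^bsub>A\<^esub> h q"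
    if "Poly_Mapping.keys p \<subseteq> lists S" "Poly_Mapping.keys q \<subseteq> lists S" for p q
  proof -
    have "Poly_Mapping.keys p \<subseteq> lists S \<and> h (p * q) = h p \<otimes>\<^bsub>A\<^esub> h q"
      using that(1)
    proof (induction p rule: frag_induction)
      case zero
      then show ?case using hc that by (simp add: h0)
    next
      case (one w)
      then show ?case
        using that(2) by (simp add: hmult1 hW)
    next
      case (diff a b)
      have "Poly_Mapping.keys (a - b) \<subseteq> lists S"
        using keys_diff[of a b] diff by blast
      then show ?case
        using diff that(2) hc[of a] hc[of b] hc[of q]
          keys_mult_lists[of a S q] keys_mult_lists[of b S q]
        by (simp add: left_diff_distrib hdiff A.minus_eq A.l_distr A.l_minus)
    qed
    then show ?thesis ..
  qed
  have "h 1 = \<one>\<^bsub>A\<^esub>"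
    using hW[of "[]"] by (simp add: one_free_ring_eq_single W_def)
  then have "h \<in> ring_hom (free_ring S) A"
    by (intro ring_hom_memI) (auto simp: hc hadd hmult)
  then show thesis
    using that hW by (simp add: W_def)
qed

text \<open>The kernel of \<open>h\<close> is an ideal containing \<open>X\<close>, hence contains
  the ideal generated by \<open>X\<close>, so \<open>h\<close> may be evaluated at any member of a
  coset. It serves both quotients: free ring to tensor algebra, and tensor algebra to
  K-theory.\<close>

lemma ring_hom_Quot_genideal:
  assumes "ring R" "ring A" and h: "h \<in> ring_hom R A"
    and X: "X \<subseteq> carrier R" and hX: "\<And>x. x \<in> X \<Longrightarrow> h x = \<zero>\<^bsub>A\<^esub>"
  obtains h' where "h' \<in> ring_hom (R Quot (Idl\<^bsub>R\<^esub> X)) A"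
    and "\<And>x. x \<in> carrier R \<Longrightarrow> h' (Idl\<^bsub>R\<^esub> X +>\<^bsub>R\<^esub> x) = h x"
proof -
  interpret R: ring R by fact
  interpret A: ring A by fact
  interpret H: ring_hom_ring R A h
    by (rule ring_hom_ringI2) fact+
  define I where "I = Idl\<^bsub>R\<^esub> X"
  interpret I: ideal I R
    unfolding I_def by (rule R.genideal_ideal) fact
  have "X \<subseteq> a_kernel R A h"
    unfolding a_kernel_def' using X hX by blast
  then have "I \<subseteq> a_kernel R A h"
    unfolding I_def by (rule R.genideal_minimal[OF H.kernel_is_ideal])
  then have I0: "h i = \<zero>\<^bsub>A\<^esub>" if "i \<in> I" for i
    using that unfolding a_kernel_def' by blast
  define h' where "h' = (\<lambda>Y. h (SOME y. y \<in> Y))"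
  have h': "h' (I +>\<^bsub>R\<^esub> x) = h x" if x: "x \<in> carrier R" for x
  proof -
    have "(SOME y. y \<in> I +>\<^bsub>R\<^esub> x) \<in> I +>\<^bsub>R\<^esub> x"
      using I.a_rcos_self[OF x] by (rule someI)
    then obtain i where "i \<in> I" "(SOME y. y \<in> I +>\<^bsub>R\<^esub> x) = i \<oplus>\<^bsub>R\<^esub> x"
      by (auto simp: a_r_coset_def')
    then show ?thesis
      using x I0 I.Icarr by (simp add: h'_def)
  qed
  have car: "\<exists>x\<in>carrier R. Y = I +>\<^bsub>R\<^esub> x" if "Y \<in> carrier (R Quot I)" for Y
    using that by (auto simp: FactRing_def A_RCOSETS_def')
  have "h' \<in> ring_hom (R Quot I) A"
  proof (rule ring_hom_memI)
    fix Y assume "Y \<in> carrier (R Quot I)"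
    then show "h' Y \<in> carrier A"
      using car h' by fastforce
  next
    fix Y Z assume "Y \<in> carrier (R Quot I)" "Z \<in> carrier (R Quot I)"
    then obtain y z where yz: "y \<in> carrier R" "z \<in> carrier R" "Y = I +>\<^bsub>R\<^esub> y" "Z = I +>\<^bsub>R\<^esub> z"
      using car by blast
    show "h' (Y \<otimes>\<^bsub>R Quot I\<^esub> Z) = h' Y \<otimes>\<^bsub>A\<^esub> h' Z"
      using yz ring_hom_mult[OF I.rcos_ring_hom yz(1,2)] h'[of "y \<otimes>\<^bsub>R\<^esub> z"] by (simp add: h')
    show "h' (Y \<oplus>\<^bsub>R Quot I\<^esub> Z) = h' Y \<oplus>\<^bsub>A\<^esub> h' Z"
      using yz ring_hom_add[OF I.rcos_ring_hom yz(1,2)] h'[of "y \<oplus>\<^bsub>R\<^esub> z"] by (simp add: h')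
  next
    show "h' \<one>\<^bsub>R Quot I\<^esub> = \<one>\<^bsub>A\<^esub>"
      using ring_hom_one[OF I.rcos_ring_hom] h'[of "\<one>\<^bsub>R\<^esub>"] by simp
  qed
  then show thesis
    using that h' by (simp add: I_def)
qed

section \<open>Arithmetic in pre-special hyperfields\<close>

context pre_special_hyperfield
begin

abbreviation "D \<equiv> carrier F - {hzero F}"

lemma D_one [simp]: "\<one> \<in> D"
  using one_not_hzero by simp

lemma D_sq [simp]: "a \<in> D \<Longrightarrow> a \<otimes> a = \<one>"
  using square_one[of a] by (simp add: numeral_2_eq_2)

lemma D_mult [simp]:
  assumes "a \<in> D" "b \<in> D"
  shows "a \<otimes> b \<in> D"
proof -
  have "a \<otimes> (a \<otimes> b) = b"
    using assms by (simp add: m_assoc[symmetric])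
  then have "a \<otimes> b \<noteq> hzero F"
    using assms mult_hzero by auto
  then show ?thesis using assms by simp
qed

lemma hadd_scale: "\<lbrakk>a \<in> carrier F; b \<in> carrier F; d \<in> carrier F; c \<in> a \<boxplus> b\<rbrakk> \<Longrightarrow> c \<otimes> d \<in> (a \<otimes> d) \<boxplus> (b \<otimes> d)"
  using hadd_distrib by blast

lemma hneg_unique:
  assumes "x \<in> carrier F" "y \<in> carrier F" "hzero F \<in> x \<boxplus> y"
  shows "y = \<boxminus> x"
proof -
  have "y \<in> (\<boxminus> x) \<boxplus> hzero F"
    using hadd_reversible assms hzero_closed by blast
  then have "y \<in> hzero F \<boxplus> (\<boxminus> x)"
    using hadd_comm assms hneg_closed hzero_closed by blast
  then show ?thesis
    using hadd_zero assms hneg_closed by blast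
qed

text \<open>Multiplying \<open>0 \<in> 1 - 1\<close> by \<open>a\<close> shows that
  \<open>(-1)a\<close> is an additive inverse of \<open>a\<close>, and such an inverse is
  unique.\<close>

lemma hneg_eq_mult:
  assumes "a \<in> carrier F"
  shows "\<boxminus> a = (\<boxminus> \<one>) \<otimes> a"
proof -
  have "hzero F \<in> \<one> \<boxplus> (\<boxminus> \<one>)"
    using hyperbolic hzero_closed by simp
  then have "hzero F \<otimes> a \<in> (\<one> \<otimes> a) \<boxplus> ((\<boxminus> \<one>) \<otimes> a)"
    using assms hneg_closed by (intro hadd_scale) auto
  then have "hzero F \<in> a \<boxplus> ((\<boxminus> \<one>) \<otimes> a)"
    using assms mult_hzero[of a] hzero_closed by (simp add: m_comm)
  then show ?thesis
    using hneg_unique[of a "(\<boxminus> \<one>) \<otimes> a"] assms hneg_closed by simp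
qed

lemma D_neg_one [simp]: "\<boxminus> \<one> \<in> D"
proof -
  have "\<boxminus> \<one> \<noteq> hzero F"
  proof
    assume "\<boxminus> \<one> = hzero F"
    then have "hzero F \<in> \<one> \<boxplus> hzero F"
      using hyperbolic hzero_closed by simp
    then have "hzero F \<in> hzero F \<boxplus> \<one>"
      using hadd_comm hzero_closed one_closed by blast
    then show False
      using hadd_zero[of "\<one>" "hzero F"] hzero_closed one_not_hzero by auto
  qed
  then show ?thesis using hneg_closed by simp
qed

lemma D_neg [simp]:
  assumes "a \<in> D"
  shows "\<boxminus> a \<in> D"
  using D_mult[OF D_neg_one assms] hneg_eq_mult[of a] assms by (metis DiffD1)

lemma hneg_hzero: "\<boxminus> hzero F = hzero F"
  using hneg_eq_mult[OF hzero_closed] mult_hzero hneg_closed by simp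

text \<open>Hyperbolicity puts \<open>a\<close> into \<open>1 - 1\<close>. Multiplying by
  \<open>a\<close> gives \<open>1 \<in> a - a\<close>, and reversibility moves \<open>a\<close> to
  the other side. For \<open>a \<noteq> 1\<close> this makes rho(a) rho(-a) = 0 one of the defining
  relations.\<close>

lemma neg_in_one_minus:
  assumes "a \<in> D"
  shows "\<boxminus> a \<in> \<one> \<boxplus> (\<boxminus> a)"
proof -
  have a: "a \<in> carrier F" and na: "\<boxminus> a \<in> carrier F" using assms hneg_closed by auto
  have "a \<in> \<one> \<boxplus> (\<boxminus> \<one>)"
    using hyperbolic a by simp
  then have "a \<otimes> a \<in> (\<one> \<otimes> a) \<boxplus> ((\<boxminus> \<one>) \<otimes> a)"
    using a hneg_closed by (intro hadd_scale) auto
  then have "\<one> \<in> a \<boxplus> (\<boxminus> a)"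
    using assms a hneg_eq_mult[OF a] by simp
  then have "\<boxminus> a \<in> (\<boxminus> a) \<boxplus> \<one>"
    using hadd_reversible[OF a na] by blast
  then show ?thesis
    using hadd_comm[OF na one_closed] by simp
qed

text \<open>Normalizes a general sum to one with first summand \<open>1\<close>, the only kind that
  occurs in the relations of K-theory. It uses \<open>aa = 1\<close>.\<close>

lemma scaled_sum:
  assumes "a \<in> D" "b \<in> D" "c \<in> a \<boxplus> b"
  shows "a \<otimes> c \<in> \<one> \<boxplus> (a \<otimes> b)"
proof -
  have "c \<in> carrier F" using assms hadd_closed by blast
  moreover have "c \<otimes> a \<in> (a \<otimes> a) \<boxplus> (b \<otimes> a)"
    using assms by (intro hadd_scale) auto
  ultimately show ?thesis
    using assms by (simp add: m_comm[of _ a])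
qed

lemma hneg_hneg [simp]: "a \<in> carrier F \<Longrightarrow> \<boxminus> (\<boxminus> a) = a"
  using hneg_eq_mult[of a] hneg_eq_mult[of "\<boxminus> a"] hneg_closed[of a] D_sq[OF D_neg_one]
  by (simp add: m_assoc[symmetric] hneg_closed)

lemma hzero_in_sum:
  assumes "a \<in> D" "b \<in> D"
  shows "hzero F \<in> a \<boxplus> b \<longleftrightarrow> b = \<boxminus> a"
proof
  assume "b = \<boxminus> a"
  moreover have "hzero F \<in> \<one> \<boxplus> (\<boxminus> \<one>)"
    using hyperbolic hzero_closed by simp
  then have "hzero F \<otimes> a \<in> (\<one> \<otimes> a) \<boxplus> ((\<boxminus> \<one>) \<otimes> a)"
    using assms hneg_closed by (intro hadd_scale) auto
  ultimately show "hzero F \<in> a \<boxplus> b"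
    using assms mult_hzero[of a] hzero_closed hneg_eq_mult[of a] by (simp add: m_comm)
qed (use assms hneg_unique in blast)

lemma nonzero_group_simps [simp]:
  "carrier (nonzero_group F) = D" "x \<otimes>\<^bsub>nonzero_group F\<^esub> y = x \<otimes> y" "\<one>\<^bsub>nonzero_group F\<^esub> = \<one>"
  by (simp_all add: nonzero_group_def)


section \<open>The ring $K_*F$\<close>

abbreviation "FR \<equiv> free_ring D"
abbreviation "TA \<equiv> tensor_algebra (nonzero_group F)"

text \<open>The composite of the two quotient maps. It lets elements of \<open>K_ring F\<close> be
  handled as combinations of words, bypassing the cosets in the tensor algebra.\<close>

definition kappa :: "('a list \<Rightarrow>\<^sub>0 int) \<Rightarrow> ('a list \<Rightarrow>\<^sub>0 int) set set" where
  "kappa p = K_rel F +>\<^bsub>TA\<^esub> (tensor_rel (nonzero_group F) +>\<^bsub>FR\<^esub> p)"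

lemma free_gen_closed [simp]: "a \<in> S \<Longrightarrow> Poly_Mapping.keys (free_gen a) \<subseteq> lists S"
  by (simp add: free_gen_def)

lemma ideal_tensor_rel: "ideal (tensor_rel (nonzero_group F)) FR"
proof -
  interpret ring FR by (rule ring_free_ring)
  have "Poly_Mapping.keys (free_gen (x \<otimes> y) - free_gen x - free_gen y) \<subseteq> lists D"
    if "x \<in> D" "y \<in> D" for x y
    using keys_diff[of "free_gen (x \<otimes> y) - free_gen x" "free_gen y"]
      keys_diff[of "free_gen (x \<otimes> y)" "free_gen x"]
      free_gen_closed[OF D_mult[OF that]] free_gen_closed[OF that(1)] free_gen_closed[OF that(2)]
    by blast
  then show ?thesis
    unfolding tensor_rel_def nonzero_group_simps by (intro genideal_ideal) auto
qed

lemma ring_tensor_algebra: "ring TA"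
  using ideal.quotient_is_ring[OF ideal_tensor_rel] by (simp add: tensor_algebra_def)

lemma tensor_gen_closed: "a \<in> D \<Longrightarrow> tensor_gen (nonzero_group F) a \<in> carrier TA"
  unfolding tensor_gen_def tensor_algebra_def nonzero_group_simps
  by (rule ring_hom_closed[OF ideal.rcos_ring_hom[OF ideal_tensor_rel]]) simp

text \<open>Zero lies in \<open>1 - a\<close> only for \<open>a = 1\<close>. So the restriction on
  \<open>a\<close> in \<open>K_rel\<close> guarantees that the second factor of each relation is
  again a generator of the tensor algebra.\<close>

lemma one_minus_nonzero:
  assumes "a \<in> D" "a \<noteq> \<one>" "b \<in> \<one> \<boxplus> (\<boxminus> a)"
  shows "b \<in> D"
proof -
  have "b \<in> carrier F"
    using assms hadd_closed[of "\<one>" "\<boxminus> a"] hneg_closed by auto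
  moreover have "b \<noteq> hzero F"
    using assms hzero_in_sum[of "\<one>" "\<boxminus> a"] hneg_hneg[of a] hneg_hneg[of "\<one>"] by (metis D_neg D_one DiffD1)
  ultimately show ?thesis by simp
qed

abbreviation "Krels \<equiv> {tensor_gen (nonzero_group F) a \<otimes>\<^bsub>TA\<^esub> tensor_gen (nonzero_group F) b
       | a b. a \<in> D \<and> a \<noteq> \<one> \<and> b \<in> \<one> \<boxplus> (\<boxminus> a)}"

lemma Krels_closed: "Krels \<subseteq> carrier TA"
proof -
  interpret ring TA by (rule ring_tensor_algebra)
  show ?thesis
    using one_minus_nonzero tensor_gen_closed by blast
qed

lemma ideal_K_rel: "ideal (K_rel F) TA"
  unfolding K_rel_def by (rule ring.genideal_ideal[OF ring_tensor_algebra Krels_closed])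

lemma ring_K_ring: "ring (K_ring F)"
  using ideal.quotient_is_ring[OF ideal_K_rel] by (simp add: K_ring_def)

sublocale K: ring "K_ring F"
  by (rule ring_K_ring)

lemma tensor_coset_hom: "(\<lambda>p. tensor_rel (nonzero_group F) +>\<^bsub>FR\<^esub> p) \<in> ring_hom FR TA"
  using ideal.rcos_ring_hom[OF ideal_tensor_rel] by (simp add: tensor_algebra_def)

lemma K_coset_hom: "(\<lambda>t. K_rel F +>\<^bsub>TA\<^esub> t) \<in> ring_hom TA (K_ring F)"
  using ideal.rcos_ring_hom[OF ideal_K_rel] by (simp add: K_ring_def)

lemma kappa_hom: "kappa \<in> ring_hom FR (K_ring F)"
  using ring_hom_trans[OF tensor_coset_hom K_coset_hom]
  by (simp add: kappa_def[abs_def] comp_def)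

lemma kappa_closed [simp]: "Poly_Mapping.keys p \<subseteq> lists D \<Longrightarrow> kappa p \<in> carrier (K_ring F)"
  using ring_hom_closed[OF kappa_hom, of p] by simp

lemma kappa_add:
  "\<lbrakk>Poly_Mapping.keys p \<subseteq> lists D; Poly_Mapping.keys q \<subseteq> lists D\<rbrakk> \<Longrightarrow>
    kappa (p + q) = kappa p \<oplus>\<^bsub>K_ring F\<^esub> kappa q"
  using ring_hom_add[OF kappa_hom, of p q] by simp

lemma kappa_mult:
  "\<lbrakk>Poly_Mapping.keys p \<subseteq> lists D; Poly_Mapping.keys q \<subseteq> lists D\<rbrakk> \<Longrightarrow>
    kappa (p * q) = kappa p \<otimes>\<^bsub>K_ring F\<^esub> kappa q"
  using ring_hom_mult[OF kappa_hom, of p q] by simp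

lemma kappa_one [simp]: "kappa 1 = \<one>\<^bsub>K_ring F\<^esub>"
  using ring_hom_one[OF kappa_hom] by simp

lemma kappa_zero [simp]: "kappa 0 = \<zero>\<^bsub>K_ring F\<^esub>"
  using ring_hom_zero[OF kappa_hom ring_free_ring ring_K_ring] by simp

lemma kappa_diff:
  assumes "Poly_Mapping.keys p \<subseteq> lists D" "Poly_Mapping.keys q \<subseteq> lists D"
  shows "kappa (p - q) = kappa p \<ominus>\<^bsub>K_ring F\<^esub> kappa q"
proof -
  have k: "Poly_Mapping.keys (p - q) \<subseteq> lists D"
    using keys_diff[of p q] assms by blast
  have "kappa p = kappa (p - q) \<oplus>\<^bsub>K_ring F\<^esub> kappa q"
    using kappa_add[OF k assms(2)] by simp
  then show ?thesis
    using kappa_closed[OF k] kappa_closed[OF assms(2)] by (simp add: K.minus_eq K.a_assoc K.r_neg)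
qed

section \<open>Relations and universal property of \<open>K_ring\<close>\<close>

lemma K_rho_eq_kappa: "K_rho F a = kappa (free_gen a)"
  by (simp add: K_rho_def kappa_def tensor_gen_def)

lemma K_rho_closed [simp]: "a \<in> D \<Longrightarrow> K_rho F a \<in> carrier (K_ring F)"
  by (simp add: K_rho_eq_kappa)

lemma K_rho_mult:
  assumes "a \<in> D" "b \<in> D"
  shows "K_rho F (a \<otimes> b) = K_rho F a \<oplus>\<^bsub>K_ring F\<^esub> K_rho F b"
proof -
  interpret FR: ring FR by (rule ring_free_ring)
  interpret T: ring TA by (rule ring_tensor_algebra)
  interpret I: ideal "tensor_rel (nonzero_group F)" FR by (rule ideal_tensor_rel)
  let ?d = "free_gen (a \<otimes> b) - free_gen a - free_gen b"
  have g: "Poly_Mapping.keys (free_gen (a \<otimes> b)) \<subseteq> lists D"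
      "Poly_Mapping.keys (free_gen a + free_gen b) \<subseteq> lists D"
    using assms free_gen_closed[OF D_mult[OF assms]] keys_add[of "free_gen a" "free_gen b"]
      free_gen_closed[OF assms(1)] free_gen_closed[OF assms(2)] by blast+
  have "?d \<in> {free_gen (x \<otimes>\<^bsub>nonzero_group F\<^esub> y) - free_gen x - free_gen y |
      x y. x \<in> carrier (nonzero_group F) \<and> y \<in> carrier (nonzero_group F)}" (is "_ \<in> ?X")
    using assms unfolding nonzero_group_simps by blast
  moreover have "?X \<subseteq> tensor_rel (nonzero_group F)"
    unfolding tensor_rel_def genideal_def by blast
  ultimately have d: "?d \<in> tensor_rel (nonzero_group F)" by blast
  have kd: "Poly_Mapping.keys ?d \<subseteq> lists D"
    using I.Icarr[OF d] by simp
  have "kappa ?d = K_rel F +>\<^bsub>TA\<^esub> \<zero>\<^bsub>TA\<^esub>"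
    using I.a_rcos_const[OF d]
    by (simp add: kappa_def tensor_algebra_def FactRing_def)
  also have "\<dots> = \<zero>\<^bsub>K_ring F\<^esub>"
    using ring_hom_zero[OF K_coset_hom ring_tensor_algebra ring_K_ring] .
  finally have "kappa (free_gen (a \<otimes> b)) = kappa (free_gen a + free_gen b)"
    using kappa_add[OF kd g(2)] kappa_closed[OF g(2)] by (simp add: algebra_simps)
  then show ?thesis
    using assms by (simp add: K_rho_eq_kappa kappa_add)
qed

lemma K_rho_relation:
  assumes "a \<in> D" "a \<noteq> \<one>" "b \<in> \<one> \<boxplus> (\<boxminus> a)"
  shows "K_rho F a \<otimes>\<^bsub>K_ring F\<^esub> K_rho F b = \<zero>\<^bsub>K_ring F\<^esub>"
proof -
  interpret I: ideal "K_rel F" TA by (rule ideal_K_rel)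
  have b: "b \<in> D" using one_minus_nonzero assms .
  have "tensor_gen (nonzero_group F) a \<otimes>\<^bsub>TA\<^esub> tensor_gen (nonzero_group F) b \<in> Krels"
    using assms by blast
  moreover have "Krels \<subseteq> K_rel F"
    unfolding K_rel_def genideal_def by blast
  ultimately have d: "tensor_gen (nonzero_group F) a \<otimes>\<^bsub>TA\<^esub> tensor_gen (nonzero_group F) b \<in> K_rel F"
    by blast
  have "K_rho F a \<otimes>\<^bsub>K_ring F\<^esub> K_rho F b =
      K_rel F +>\<^bsub>TA\<^esub> (tensor_gen (nonzero_group F) a \<otimes>\<^bsub>TA\<^esub> tensor_gen (nonzero_group F) b)"
    unfolding K_rho_def
    by (rule ring_hom_mult[OF K_coset_hom, symmetric]) (use assms b tensor_gen_closed in blast)+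
  also have "\<dots> = \<zero>\<^bsub>K_ring F\<^esub>"
    using I.a_rcos_const[OF d] by (simp add: K_ring_def FactRing_def)
  finally show ?thesis .
qed

text \<open>Since \<open>1 * 1 = 1\<close>, the element rho(1) equals its own double. This covers
  the case \<open>a = \<one>\<close> that the relations exclude.\<close>

lemma K_rho_one [simp]: "K_rho F \<one> = \<zero>\<^bsub>K_ring F\<^esub>"
  using K_rho_mult[of "\<one>" "\<one>"] K_rho_closed[OF D_one] by (metis D_one D_sq K.add.l_cancel_one')

text \<open>The map out of the free ring factors through the two quotients in turn:
  \<open>f_mult\<close> kills the multilinearity relations, \<open>f_rel\<close> the relations of
  K-theory.\<close>

lemma K_ring_universal:
  assumes "ring A" and f: "f \<in> D \<rightarrow> carrier A"
    and f_mult: "\<And>a b. \<lbrakk>a \<in> D; b \<in> D\<rbrakk> \<Longrightarrow> f (a \<otimes> b) = f a \<oplus>\<^bsub>A\<^esub> f b"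
    and f_rel: "\<And>a b. \<lbrakk>a \<in> D; a \<noteq> \<one>; b \<in> D; b \<in> \<one> \<boxplus> (\<boxminus> a)\<rbrakk> \<Longrightarrow> f a \<otimes>\<^bsub>A\<^esub> f b = \<zero>\<^bsub>A\<^esub>"
  obtains h where "h \<in> ring_hom (K_ring F) A" "\<And>a. a \<in> D \<Longrightarrow> h (K_rho F a) = f a"
proof -
  interpret A: ring A by fact
  obtain h0 where h0: "h0 \<in> ring_hom FR A"
    and h0w: "\<And>w. w \<in> lists D \<Longrightarrow>
      h0 (Poly_Mapping.single w 1) = foldr (\<lambda>a x. f a \<otimes>\<^bsub>A\<^esub> x) w \<one>\<^bsub>A\<^esub>"
    using free_ring_universal[OF assms(1) f] by metis
  have fc: "f a \<in> carrier A" if "a \<in> D" for a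
    using f that by blast
  have h0g: "h0 (free_gen a) = f a" if "a \<in> D" for a
    using h0w[of "[a]"] that fc by (simp add: free_gen_def)
  let ?X = "{free_gen (x \<otimes> y) - free_gen x - free_gen y | x y. x \<in> D \<and> y \<in> D}"
  \<comment> \<open>The generators lie in the ideal that they generate, and
    \<open>ideal_tensor_rel\<close> places that ideal inside the carrier.\<close>
  have X: "?X \<subseteq> carrier FR"
    using ideal.Icarr[OF ideal_tensor_rel] unfolding tensor_rel_def nonzero_group_simps genideal_def
    by blast
  have "h0 (free_gen (x \<otimes> y) - free_gen x - free_gen y) = \<zero>\<^bsub>A\<^esub>" if xy: "x \<in> D" "y \<in> D" for x y
  proof -
    let ?d = "free_gen (x \<otimes> y) - free_gen x - free_gen y"
    have d: "?d \<in> carrier FR" using X xy by blast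
    have g: "free_gen x \<in> carrier FR" "free_gen y \<in> carrier FR" "free_gen x + free_gen y \<in> carrier FR"
      using free_gen_closed[OF xy(1)] free_gen_closed[OF xy(2)] keys_add[of "free_gen x" "free_gen y"]
      unfolding carrier_free_ring by blast+
    have "h0 (free_gen (x \<otimes> y)) = h0 ?d \<oplus>\<^bsub>A\<^esub> h0 (free_gen x + free_gen y)"
      using ring_hom_add[OF h0 d g(3)] by (simp add: algebra_simps)
    moreover have "h0 (free_gen x + free_gen y) = f x \<oplus>\<^bsub>A\<^esub> f y"
      using ring_hom_add[OF h0 g(1,2)] xy h0g by simp
    moreover have "h0 (free_gen (x \<otimes> y)) = f x \<oplus>\<^bsub>A\<^esub> f y"
      using h0g[OF D_mult[OF xy]] f_mult[OF xy] by simp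
    ultimately show ?thesis
      using ring_hom_closed[OF h0 d] fc[OF xy(1)] fc[OF xy(2)] by (metis A.add.r_cancel_one A.a_closed)
  qed
  then obtain h1 where h1: "h1 \<in> ring_hom TA A"
    and h1g: "\<And>p. p \<in> carrier FR \<Longrightarrow> h1 (tensor_rel (nonzero_group F) +>\<^bsub>FR\<^esub> p) = h0 p"
    using ring_hom_Quot_genideal[OF ring_free_ring assms(1) h0 X]
    unfolding tensor_algebra_def tensor_rel_def nonzero_group_simps by blast
  have h1t: "h1 (tensor_gen (nonzero_group F) a) = f a" if "a \<in> D" for a
    using h1g[of "free_gen a"] that h0g[OF that] by (simp add: tensor_gen_def)
  have "h1 x = \<zero>\<^bsub>A\<^esub>" if xK: "x \<in> Krels" for x
  proof -
    obtain a b where x: "x = tensor_gen (nonzero_group F) a \<otimes>\<^bsub>TA\<^esub> tensor_gen (nonzero_group F) b"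
      and ab: "a \<in> D" "a \<noteq> \<one>" "b \<in> \<one> \<boxplus> (\<boxminus> a)"
      using xK by blast
    have b: "b \<in> D" using one_minus_nonzero ab .
    show ?thesis
      unfolding x ring_hom_mult[OF h1 tensor_gen_closed[OF ab(1)] tensor_gen_closed[OF b]]
      using h1t[OF ab(1)] h1t[OF b] f_rel[OF ab(1,2) b ab(3)] by simp
  qed
  then obtain h where h: "h \<in> ring_hom (K_ring F) A"
    and hg: "\<And>t. t \<in> carrier TA \<Longrightarrow> h (K_rel F +>\<^bsub>TA\<^esub> t) = h1 t"
    using ring_hom_Quot_genideal[OF ring_tensor_algebra assms(1) h1 Krels_closed]
    unfolding K_ring_def K_rel_def by blast
  have "h (K_rho F a) = f a" if "a \<in> D" for a
    unfolding K_rho_def using hg[OF tensor_gen_closed[OF that]] h1t[OF that] by simp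
  then show thesis using that h by blast
qed

section \<open>The groups $K_nF$ and $k_nF$\<close>

abbreviation "KC n \<equiv> carrier (K_group F n)"

text \<open>The product inside \<open>k_symbol\<close>, before its class modulo doubles is
  taken.\<close>

definition K_word :: "'a list \<Rightarrow> ('a list \<Rightarrow>\<^sub>0 int) set set" where
  "K_word w = foldr (\<lambda>a x. K_rho F a \<otimes>\<^bsub>K_ring F\<^esub> x) w \<one>\<^bsub>K_ring F\<^esub>"

lemma K_word_simps [simp]:
  "K_word [] = \<one>\<^bsub>K_ring F\<^esub>" "K_word (a # w) = K_rho F a \<otimes>\<^bsub>K_ring F\<^esub> K_word w"
  by (simp_all add: K_word_def)

lemma K_word_eq_kappa: "w \<in> lists D \<Longrightarrow> K_word w = kappa (Poly_Mapping.single w 1)"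
proof (induction w rule: lists.induct)
  case Nil
  then show ?case by (simp add: one_free_ring_eq_single flip: kappa_one)
next
  case (Cons a w)
  have "Poly_Mapping.single (a # w) 1 = free_gen a * (Poly_Mapping.single w 1 :: _ \<Rightarrow>\<^sub>0 int)"
    by (simp add: free_gen_def mult_single plus_list_def)
  then have "kappa (Poly_Mapping.single (a # w) 1) = kappa (free_gen a) \<otimes>\<^bsub>K_ring F\<^esub> kappa (Poly_Mapping.single w 1)"
    using kappa_mult[of "free_gen a" "Poly_Mapping.single w 1"] free_gen_closed[OF Cons.hyps(1)] Cons.hyps(2)
    by simp
  then show ?case
    using Cons.IH by (simp add: K_rho_eq_kappa)
qed

lemma K_word_closed [simp]: "w \<in> lists D \<Longrightarrow> K_word w \<in> carrier (K_ring F)"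
  by (simp add: K_word_eq_kappa)

lemma K_word_append:
  "\<lbrakk>v \<in> lists D; w \<in> lists D\<rbrakk> \<Longrightarrow> K_word (v @ w) = K_word v \<otimes>\<^bsub>K_ring F\<^esub> K_word w"
proof (induction v rule: lists.induct)
  case (Cons a v)
  then show ?case
    using K_rho_closed[OF Cons.hyps(1)] K_word_closed[OF Cons.hyps(2)] K_word_closed[OF Cons.prems]
    by (simp add: K.m_assoc)
qed simp

text \<open>Turns homogeneity into a condition on supports, so that elements of degree
  \<open>n\<close> are accessible to \<open>frag_induction\<close>.\<close>

lemma carrier_K_group:
  "KC n = kappa ` {p. Poly_Mapping.keys p \<subseteq> {w \<in> lists D. length w = n}}"
proof -
  have "{p. Poly_Mapping.keys p \<subseteq> {w \<in> lists D. length w = n}} =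
      {p \<in> carrier FR. \<forall>w\<in>Poly_Mapping.keys p. length w = n}"
    unfolding carrier_free_ring[abs_def] by blast
  then show ?thesis
    by (auto simp: K_group_def tensor_power_def kappa_def nonzero_group_simps)
qed

lemma K_group_simps [simp]:
  "x \<otimes>\<^bsub>K_group F n\<^esub> y = x \<oplus>\<^bsub>K_ring F\<^esub> y" "\<one>\<^bsub>K_group F n\<^esub> = \<zero>\<^bsub>K_ring F\<^esub>"
  by (simp_all add: K_group_def)

lemma K_group_subset: "x \<in> KC n \<Longrightarrow> x \<in> carrier (K_ring F)"
  unfolding carrier_K_group by (auto intro!: kappa_closed)

lemma K_word_in_K_group [simp]: "\<lbrakk>w \<in> lists D; length w = n\<rbrakk> \<Longrightarrow> K_word w \<in> KC n"
  unfolding carrier_K_group by (rule image_eqI[where x = "Poly_Mapping.single w 1"]) (auto simp: K_word_eq_kappa)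

lemma K_group_zero [simp]: "\<zero>\<^bsub>K_ring F\<^esub> \<in> KC n"
  unfolding carrier_K_group by (rule image_eqI[where x = 0]) auto

lemma K_group_diff [simp]:
  assumes "x \<in> KC n" "y \<in> KC n"
  shows "x \<ominus>\<^bsub>K_ring F\<^esub> y \<in> KC n"
proof -
  let ?W = "{w \<in> lists D. length w = n}"
  obtain p q where pq: "Poly_Mapping.keys p \<subseteq> ?W" "Poly_Mapping.keys q \<subseteq> ?W" "x = kappa p" "y = kappa q"
    using assms unfolding carrier_K_group by blast
  have "Poly_Mapping.keys (p - q) \<subseteq> ?W"
    using keys_diff[of p q] pq by blast
  moreover have "x \<ominus>\<^bsub>K_ring F\<^esub> y = kappa (p - q)"
    unfolding pq(3,4) by (rule kappa_diff[symmetric]) (use pq in blast)+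
  ultimately show ?thesis
    unfolding carrier_K_group by blast
qed

text \<open>\<open>frag_induction\<close> over words of length \<open>n\<close>, transported by
  \<open>kappa\<close>. Differences suffice as the only step, since together with zero they produce
  negatives and sums.\<close>

lemma K_group_induct [consumes 1, case_names zero word diff]:
  assumes x: "x \<in> KC n"
    and zero: "P \<zero>\<^bsub>K_ring F\<^esub>"
    and word: "\<And>w. \<lbrakk>w \<in> lists D; length w = n\<rbrakk> \<Longrightarrow> P (K_word w)"
    and diff: "\<And>x y. \<lbrakk>x \<in> KC n; y \<in> KC n; P x; P y\<rbrakk> \<Longrightarrow> P (x \<ominus>\<^bsub>K_ring F\<^esub> y)"
  shows "P x"
proof -
  let ?W = "{w \<in> lists D. length w = n}"
  obtain p where p: "Poly_Mapping.keys p \<subseteq> ?W" "x = kappa p"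
    using x unfolding carrier_K_group by blast
  have "Poly_Mapping.keys p \<subseteq> ?W \<and> P (kappa p)"
    using p(1)
  proof (induction p rule: frag_induction)
    case zero
    then show ?case using assms(2) by simp
  next
    case (one w)
    then show ?case using word[of w] K_word_eq_kappa[of w] by simp
  next
    case (diff a b)
    have "Poly_Mapping.keys (a - b) \<subseteq> ?W"
      using keys_diff[of a b] diff by blast
    moreover have "kappa (a - b) = kappa a \<ominus>\<^bsub>K_ring F\<^esub> kappa b"
      by (rule kappa_diff) (use diff in blast)+
    moreover have "kappa a \<in> KC n" "kappa b \<in> KC n"
      unfolding carrier_K_group using diff by blast+
    ultimately show ?case
      using diff assms(4) by simp
  qed
  then show ?thesis using p(2) by simp
qed

lemma K_group_neg [simp]: "x \<in> KC n \<Longrightarrow> \<ominus>\<^bsub>K_ring F\<^esub> x \<in> KC n"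
  using K_group_diff[OF K_group_zero, of x n] K_group_subset[of x n] by (simp add: K.minus_eq)

lemma K_group_add [simp]: "\<lbrakk>x \<in> KC n; y \<in> KC n\<rbrakk> \<Longrightarrow> x \<oplus>\<^bsub>K_ring F\<^esub> y \<in> KC n"
  using K_group_diff[of x n "\<ominus>\<^bsub>K_ring F\<^esub> y"] K_group_neg[of y n] K_group_subset[of y n]
  by (simp add: K.minus_eq)

lemma K_group_mult:
  assumes "x \<in> KC n" "y \<in> KC m"
  shows "x \<otimes>\<^bsub>K_ring F\<^esub> y \<in> KC (n + m)"
proof -
  have w: "K_word v \<otimes>\<^bsub>K_ring F\<^esub> y \<in> KC (n + m)" if "v \<in> lists D" "length v = n" for v
    using assms(2)
  proof (induction y rule: K_group_induct)
    case (word w)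
    then show ?case
      using that K_word_in_K_group[of "v @ w" "n + m"] K_word_append[of v w] by auto
  next
    case (diff x y)
    then show ?case
      using K_word_closed[OF that(1)] K_group_subset[of x m] K_group_subset[of y m]
        K_group_diff[OF diff(3,4)]
      by (simp add: K.minus_eq K.r_distr K.r_minus)
  qed (use that in simp)
  show ?thesis
    using assms(1)
  proof (induction x rule: K_group_induct)
    case (diff u v)
    then show ?case
      using K_group_subset[of u n] K_group_subset[of v n] K_group_subset[OF assms(2)]
        K_group_diff[OF diff(3,4)]
      by (simp add: K.minus_eq K.l_distr K.l_minus)
  qed (use w assms K_group_subset[OF assms(2)] in auto)
qed

lemma comm_group_K_group: "comm_group (K_group F n)"
proof (rule comm_groupI)
  fix x assume "x \<in> KC n"
  then show "\<exists>y\<in>KC n. y \<otimes>\<^bsub>K_group F n\<^esub> x = \<one>\<^bsub>K_group F n\<^esub>"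
    using K_group_subset[of x n] by (intro bexI[of _ "\<ominus>\<^bsub>K_ring F\<^esub> x"]) (auto simp: K.l_neg)
qed (auto simp: K_group_subset K.a_ac)

lemma subgroup_K_double: "subgroup (K_double F n) (K_group F n)"
proof -
  interpret G: comm_group "K_group F n" by (rule comm_group_K_group)
  have inv: "inv\<^bsub>K_group F n\<^esub> x = \<ominus>\<^bsub>K_ring F\<^esub> x" if "x \<in> KC n" for x
    by (rule G.inv_equality) (use that K_group_subset[OF that] in \<open>auto simp: K.l_neg\<close>)
  show ?thesis
  proof (rule G.subgroupI)
    show "K_double F n \<subseteq> KC n" "K_double F n \<noteq> {}"
      using K_group_zero by (auto simp: K_double_def)
  next
    fix a assume "a \<in> K_double F n"
    then obtain x where x: "x \<in> KC n" "a = x \<oplus>\<^bsub>K_ring F\<^esub> x" by (auto simp: K_double_def)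
    then have "inv\<^bsub>K_group F n\<^esub> a = (\<ominus>\<^bsub>K_ring F\<^esub> x) \<oplus>\<^bsub>K_ring F\<^esub> (\<ominus>\<^bsub>K_ring F\<^esub> x)"
      using K_group_subset[OF x(1)] by (simp add: inv K.minus_add)
    then show "inv\<^bsub>K_group F n\<^esub> a \<in> K_double F n"
      using K_group_neg[OF x(1)] unfolding K_double_def by blast
  next
    fix a b assume "a \<in> K_double F n" "b \<in> K_double F n"
    then obtain x y where x: "x \<in> KC n" "a = x \<oplus>\<^bsub>K_ring F\<^esub> x" and y: "y \<in> KC n" "b = y \<oplus>\<^bsub>K_ring F\<^esub> y"
      by (auto simp: K_double_def)
    then have "a \<otimes>\<^bsub>K_group F n\<^esub> b = (x \<oplus>\<^bsub>K_ring F\<^esub> y) \<oplus>\<^bsub>K_ring F\<^esub> (x \<oplus>\<^bsub>K_ring F\<^esub> y)"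
      using K_group_subset[OF x(1)] K_group_subset[OF y(1)] by (simp add: K.a_ac)
    then show "a \<otimes>\<^bsub>K_group F n\<^esub> b \<in> K_double F n"
      using K_group_add[OF x(1) y(1)] unfolding K_double_def by blast
  qed
qed

section \<open>Classes modulo doubles and their products\<close>

lemma normal_K_double: "K_double F n \<lhd> K_group F n"
  by (rule comm_group.subgroup_imp_normal[OF comm_group_K_group]) (rule subgroup_K_double)

lemma group_k_group: "group (k_group F n)"
  unfolding k_group_def by (rule normal.factorgroup_is_group[OF normal_K_double])

lemma k_class_hom: "k_class F n \<in> hom (K_group F n) (k_group F n)"
  using normal.r_coset_hom_Mod[OF normal_K_double[of n]]
  by (simp add: k_class_def[abs_def] k_group_def)

lemma k_class_closed [simp]: "x \<in> KC n \<Longrightarrow> k_class F n x \<in> carrier (k_group F n)"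
  using k_class_hom by (rule hom_in_carrier)

lemma k_class_add:
  "\<lbrakk>x \<in> KC n; y \<in> KC n\<rbrakk> \<Longrightarrow>
    k_class F n (x \<oplus>\<^bsub>K_ring F\<^esub> y) = k_class F n x \<otimes>\<^bsub>k_group F n\<^esub> k_class F n y"
  using hom_mult[OF k_class_hom] by simp

lemma k_class_zero [simp]: "k_class F n \<zero>\<^bsub>K_ring F\<^esub> = \<one>\<^bsub>k_group F n\<^esub>"
  using hom_one[OF k_class_hom[of n]] comm_group_K_group[of n] group_k_group[of n]
  by (simp add: comm_group_def)

lemma k_group_cases:
  assumes "X \<in> carrier (k_group F n)"
  obtains x where "x \<in> KC n" "X = k_class F n x"
  using assms by (auto simp: k_group_def FactGroup_def RCOSETS_def k_class_def)

lemma k_class_eq: "x \<in> KC n \<Longrightarrow> k_class F n x = {z \<oplus>\<^bsub>K_ring F\<^esub> z \<oplus>\<^bsub>K_ring F\<^esub> x | z. z \<in> KC n}"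
  by (auto simp: k_class_def r_coset_def K_double_def)

lemma k_class_self: "x \<in> KC n \<Longrightarrow> x \<in> k_class F n x"
  unfolding k_class_eq using K_group_zero[of n] K_group_subset[of x n]
  by (intro CollectI exI[of _ "\<zero>\<^bsub>K_ring F\<^esub>"]) simp

lemma k_class_subset: "x \<in> KC n \<Longrightarrow> y \<in> k_class F n x \<Longrightarrow> y \<in> KC n"
  by (auto simp: k_class_eq)

lemma k_group_sq:
  assumes "X \<in> carrier (k_group F n)"
  shows "X \<otimes>\<^bsub>k_group F n\<^esub> X = \<one>\<^bsub>k_group F n\<^esub>"
proof -
  interpret G: group "K_group F n" using comm_group_K_group by (rule comm_group.axioms)
  obtain x where x: "x \<in> KC n" "X = k_class F n x" using k_group_cases[OF assms] .
  have "x \<oplus>\<^bsub>K_ring F\<^esub> x \<in> K_double F n"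
    using x by (auto simp: K_double_def)
  then have "k_class F n (x \<oplus>\<^bsub>K_ring F\<^esub> x) = K_double F n"
    unfolding k_class_def using subgroup.rcos_const[OF subgroup_K_double G.is_group] by simp
  then show ?thesis
    using x by (simp add: k_class_add k_group_def FactGroup_def)
qed

text \<open>In exponent 2 a difference is a sum. This turns the difference case of
  \<open>K_group_induct\<close> into the product case of \<open>k_group_induct\<close>.\<close>

lemma k_class_diff:
  assumes "x \<in> KC n" "y \<in> KC n"
  shows "k_class F n (x \<ominus>\<^bsub>K_ring F\<^esub> y) = k_class F n x \<otimes>\<^bsub>k_group F n\<^esub> k_class F n y"
proof -
  interpret k: group "k_group F n" by (rule group_k_group)
  have "k_class F n x = k_class F n (x \<ominus>\<^bsub>K_ring F\<^esub> y) \<otimes>\<^bsub>k_group F n\<^esub> k_class F n y"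
    using k_class_add[OF K_group_diff[OF assms] assms(2)] assms K_group_subset
    by (metis K.add.inv_closed K.add.inv_solve_right K.minus_eq K.add.m_assoc K.l_neg K.r_zero)
  then show ?thesis
    using assms k_group_sq[OF k_class_closed[OF assms(2)]] by (simp add: k.m_assoc)
qed

text \<open>Members of one class differ by some \<open>z + z\<close>, and \<open>h\<close> kills it
  in characteristic 2. This is how maps out of K-theory descend to reduced K-theory.\<close>

lemma k_class_constant:
  assumes "ring A" and h: "h \<in> ring_hom (K_ring F) A"
    and sq: "\<And>a. a \<in> carrier A \<Longrightarrow> a \<oplus>\<^bsub>A\<^esub> a = \<zero>\<^bsub>A\<^esub>"
    and x: "x \<in> KC n" and y: "y \<in> k_class F n x"
  shows "h y = h x"
proof -
  interpret A: ring A by fact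
  obtain z where z: "z \<in> KC n" "y = z \<oplus>\<^bsub>K_ring F\<^esub> z \<oplus>\<^bsub>K_ring F\<^esub> x"
    using y unfolding k_class_eq[OF x] by blast
  have c: "z \<in> carrier (K_ring F)" "x \<in> carrier (K_ring F)" "z \<oplus>\<^bsub>K_ring F\<^esub> z \<in> carrier (K_ring F)"
    using K_group_subset z x by auto
  show ?thesis
    unfolding z(2) using ring_hom_add[OF h c(3,2)] ring_hom_add[OF h c(1,1)]
      sq[OF ring_hom_closed[OF h c(1)]] ring_hom_closed[OF h c(2)] by simp
qed

text \<open>\<open>k_mult\<close> unites the classes of all products of representatives. By
  distributivity, changing a representative by a double changes the product by a double, so the
  united classes all coincide; \<open>k_class_self\<close> ensures that the union is not
  empty.\<close>

lemma k_mult_class: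
  assumes x: "x \<in> KC n" and y: "y \<in> KC m"
  shows "k_mult F n m (k_class F n x) (k_class F m y) = k_class F (n + m) (x \<otimes>\<^bsub>K_ring F\<^esub> y)"
proof -
  interpret k: group "k_group F (n + m)" by (rule group_k_group)
  have eq: "k_class F (n + m) (x' \<otimes>\<^bsub>K_ring F\<^esub> y') = k_class F (n + m) (x \<otimes>\<^bsub>K_ring F\<^esub> y)"
    if x': "x' \<in> k_class F n x" and y': "y' \<in> k_class F m y" for x' y'
  proof -
    obtain z where z: "z \<in> KC n" "x' = z \<oplus>\<^bsub>K_ring F\<^esub> z \<oplus>\<^bsub>K_ring F\<^esub> x"
      using x' unfolding k_class_eq[OF x] by blast
    obtain u where u: "u \<in> KC m" "y' = u \<oplus>\<^bsub>K_ring F\<^esub> u \<oplus>\<^bsub>K_ring F\<^esub> y"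
      using y' unfolding k_class_eq[OF y] by blast
    have yc: "y' \<in> KC m" using k_class_subset[OF y y'] .
    have c: "z \<in> carrier (K_ring F)" "x \<in> carrier (K_ring F)" "u \<in> carrier (K_ring F)"
        "y \<in> carrier (K_ring F)" "y' \<in> carrier (K_ring F)"
      using K_group_subset z x u y yc by blast+
    have e1: "x' \<otimes>\<^bsub>K_ring F\<^esub> y' = z \<otimes>\<^bsub>K_ring F\<^esub> y' \<oplus>\<^bsub>K_ring F\<^esub> z \<otimes>\<^bsub>K_ring F\<^esub> y' \<oplus>\<^bsub>K_ring F\<^esub> x \<otimes>\<^bsub>K_ring F\<^esub> y'"
      unfolding z(2) using c by (simp add: K.l_distr)
    have e2: "x \<otimes>\<^bsub>K_ring F\<^esub> y' = x \<otimes>\<^bsub>K_ring F\<^esub> u \<oplus>\<^bsub>K_ring F\<^esub> x \<otimes>\<^bsub>K_ring F\<^esub> u \<oplus>\<^bsub>K_ring F\<^esub> x \<otimes>\<^bsub>K_ring F\<^esub> y"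
      unfolding u(2) using c by (simp add: K.r_distr)
    have m: "z \<otimes>\<^bsub>K_ring F\<^esub> y' \<in> KC (n + m)" "x \<otimes>\<^bsub>K_ring F\<^esub> y' \<in> KC (n + m)"
        "x \<otimes>\<^bsub>K_ring F\<^esub> u \<in> KC (n + m)" "x \<otimes>\<^bsub>K_ring F\<^esub> y \<in> KC (n + m)"
      using K_group_mult z x u y yc by blast+
    have "k_class F (n + m) (x' \<otimes>\<^bsub>K_ring F\<^esub> y') = k_class F (n + m) (x \<otimes>\<^bsub>K_ring F\<^esub> y')"
      unfolding e1 using m by (simp add: k_class_add k_group_sq)
    also have "\<dots> = k_class F (n + m) (x \<otimes>\<^bsub>K_ring F\<^esub> y)"
      unfolding e2 using m by (simp add: k_class_add k_group_sq)
    finally show ?thesis .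
  qed
  have "k_mult F n m (k_class F n x) (k_class F m y) =
      (\<Union>x'\<in>k_class F n x. \<Union>y'\<in>k_class F m y. k_class F (n + m) (x \<otimes>\<^bsub>K_ring F\<^esub> y))"
    unfolding k_mult_def by (intro SUP_cong refl eq)
  moreover have "k_class F n x \<noteq> {}" "k_class F m y \<noteq> {}"
    using k_class_self[OF x] k_class_self[OF y] by auto
  ultimately show ?thesis by simp
qed

section \<open>Reduced K-theory as an inductive graded ring\<close>

lemma K_rho_double:
  assumes "a \<in> D"
  shows "K_rho F a \<oplus>\<^bsub>K_ring F\<^esub> K_rho F a = \<zero>\<^bsub>K_ring F\<^esub>"
  using K_rho_mult[OF assms assms] D_sq[OF assms] by simp

lemma K_rho_neg:
  assumes "a \<in> D"
  shows "K_rho F a \<otimes>\<^bsub>K_ring F\<^esub> K_rho F (\<boxminus> a) = \<zero>\<^bsub>K_ring F\<^esub>"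
proof (cases "a = \<one>")
  case True
  then show ?thesis using K_rho_closed[OF D_neg_one] by simp
next
  case False
  then show ?thesis using K_rho_relation[OF assms] neg_in_one_minus[OF assms] by blast
qed

text \<open>Expanding \<open>\<rho>(ab)\<rho>(-ab) = 0\<close>.\<close>

lemma K_rho_commute:
  assumes a: "a \<in> D" and b: "b \<in> D"
  shows "K_rho F a \<otimes>\<^bsub>K_ring F\<^esub> K_rho F b = K_rho F b \<otimes>\<^bsub>K_ring F\<^esub> K_rho F a"
proof -
  let ?x = "K_rho F a" and ?y = "K_rho F b" and ?t = "K_rho F (\<boxminus> \<one>)"
  have c: "?x \<in> carrier (K_ring F)" "?y \<in> carrier (K_ring F)" "?t \<in> carrier (K_ring F)"
    using K_rho_closed a b D_neg_one by blast+
  have neg: "K_rho F (\<boxminus> d) = ?t \<oplus>\<^bsub>K_ring F\<^esub> K_rho F d" if "d \<in> D" for d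
    using K_rho_mult[OF D_neg_one that] hneg_eq_mult[of d] that by (metis DiffD1)
  have n1: "?x \<otimes>\<^bsub>K_ring F\<^esub> (?t \<oplus>\<^bsub>K_ring F\<^esub> ?x) = \<zero>\<^bsub>K_ring F\<^esub>"
    using K_rho_neg[OF a] neg[OF a] by simp
  have n2: "?y \<otimes>\<^bsub>K_ring F\<^esub> (?t \<oplus>\<^bsub>K_ring F\<^esub> ?y) = \<zero>\<^bsub>K_ring F\<^esub>"
    using K_rho_neg[OF b] neg[OF b] by simp
  have "\<zero>\<^bsub>K_ring F\<^esub> = (?x \<oplus>\<^bsub>K_ring F\<^esub> ?y) \<otimes>\<^bsub>K_ring F\<^esub> (?t \<oplus>\<^bsub>K_ring F\<^esub> (?x \<oplus>\<^bsub>K_ring F\<^esub> ?y))"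
    using K_rho_neg[OF D_mult[OF a b]] neg[OF D_mult[OF a b]] K_rho_mult[OF a b] by simp
  also have "\<dots> = ?x \<otimes>\<^bsub>K_ring F\<^esub> (?t \<oplus>\<^bsub>K_ring F\<^esub> ?x) \<oplus>\<^bsub>K_ring F\<^esub> ?y \<otimes>\<^bsub>K_ring F\<^esub> (?t \<oplus>\<^bsub>K_ring F\<^esub> ?y)
      \<oplus>\<^bsub>K_ring F\<^esub> (?x \<otimes>\<^bsub>K_ring F\<^esub> ?y \<oplus>\<^bsub>K_ring F\<^esub> ?y \<otimes>\<^bsub>K_ring F\<^esub> ?x)"
    using c by (simp add: K.l_distr K.r_distr K.a_ac)
  also have "\<dots> = ?x \<otimes>\<^bsub>K_ring F\<^esub> ?y \<oplus>\<^bsub>K_ring F\<^esub> ?y \<otimes>\<^bsub>K_ring F\<^esub> ?x"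
    unfolding n1 n2 using c by simp
  finally have "?x \<otimes>\<^bsub>K_ring F\<^esub> ?y = \<ominus>\<^bsub>K_ring F\<^esub> (?y \<otimes>\<^bsub>K_ring F\<^esub> ?x)"
    using c by (intro K.minus_equality[symmetric]) auto
  \<comment> \<open>The expansion only yields anticommutativity. The sign disappears because
    \<open>aa = 1\<close> makes \<open>2 rho(a) = 0\<close>.\<close>
  moreover have "?y \<otimes>\<^bsub>K_ring F\<^esub> ?x \<oplus>\<^bsub>K_ring F\<^esub> ?y \<otimes>\<^bsub>K_ring F\<^esub> ?x = \<zero>\<^bsub>K_ring F\<^esub>"
    using c K_rho_double[OF a] by (simp flip: K.r_distr)
  then have "\<ominus>\<^bsub>K_ring F\<^esub> (?y \<otimes>\<^bsub>K_ring F\<^esub> ?x) = ?y \<otimes>\<^bsub>K_ring F\<^esub> ?x"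
    using c by (intro K.minus_equality) auto
  ultimately show ?thesis by simp
qed

lemma K_rho_word_commute:
  assumes a: "a \<in> D" and w: "w \<in> lists D"
  shows "K_rho F a \<otimes>\<^bsub>K_ring F\<^esub> K_word w = K_word w \<otimes>\<^bsub>K_ring F\<^esub> K_rho F a"
  using w
proof (induction w rule: lists.induct)
  case Nil
  then show ?case using K_rho_closed[OF a] by simp
next
  case (Cons b w)
  have c: "K_rho F a \<in> carrier (K_ring F)" "K_rho F b \<in> carrier (K_ring F)" "K_word w \<in> carrier (K_ring F)"
    using K_rho_closed[OF a] K_rho_closed[OF Cons.hyps(1)] K_word_closed[OF Cons.hyps(2)] by blast+
  have "K_rho F a \<otimes>\<^bsub>K_ring F\<^esub> K_word (b # w) =
      (K_rho F a \<otimes>\<^bsub>K_ring F\<^esub> K_rho F b) \<otimes>\<^bsub>K_ring F\<^esub> K_word w"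
    using c by (simp add: K.m_assoc)
  also have "\<dots> = K_rho F b \<otimes>\<^bsub>K_ring F\<^esub> (K_rho F a \<otimes>\<^bsub>K_ring F\<^esub> K_word w)"
    using c K_rho_commute[OF a Cons.hyps(1)] by (simp add: K.m_assoc)
  also have "\<dots> = K_word (b # w) \<otimes>\<^bsub>K_ring F\<^esub> K_rho F a"
    using c Cons.IH by (simp add: K.m_assoc)
  finally show ?case .
qed

lemma K_word_commute:
  assumes v: "v \<in> lists D" and w: "w \<in> lists D"
  shows "K_word v \<otimes>\<^bsub>K_ring F\<^esub> K_word w = K_word w \<otimes>\<^bsub>K_ring F\<^esub> K_word v"
  using v
proof (induction v rule: lists.induct)
  case Nil
  then show ?case using K_word_closed[OF w] by simp
next
  case (Cons a v)
  have c: "K_rho F a \<in> carrier (K_ring F)" "K_word v \<in> carrier (K_ring F)" "K_word w \<in> carrier (K_ring F)"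
    using K_rho_closed[OF Cons.hyps(1)] K_word_closed[OF Cons.hyps(2)] K_word_closed[OF w] by blast+
  have "K_word (a # v) \<otimes>\<^bsub>K_ring F\<^esub> K_word w = (K_rho F a \<otimes>\<^bsub>K_ring F\<^esub> K_word w) \<otimes>\<^bsub>K_ring F\<^esub> K_word v"
    using c Cons.IH by (simp add: K.m_assoc)
  also have "\<dots> = K_word w \<otimes>\<^bsub>K_ring F\<^esub> K_word (a # v)"
    using c K_rho_word_commute[OF Cons.hyps(1) w] by (simp add: K.m_assoc)
  finally show ?case .
qed

lemma K_group_commute:
  assumes x: "x \<in> KC n" and y: "y \<in> KC m"
  shows "x \<otimes>\<^bsub>K_ring F\<^esub> y = y \<otimes>\<^bsub>K_ring F\<^esub> x"
proof -
  have w: "K_word v \<otimes>\<^bsub>K_ring F\<^esub> y = y \<otimes>\<^bsub>K_ring F\<^esub> K_word v" if v: "v \<in> lists D" for v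
    using y
  proof (induction y rule: K_group_induct)
    case (diff x y)
    then show ?case
      using K_word_closed[OF v] K_group_subset[OF diff(1)] K_group_subset[OF diff(2)]
      by (simp add: K.minus_eq K.l_distr K.r_distr K.l_minus K.r_minus)
  qed (use v K_word_closed[OF v] K_word_commute[OF v] in simp_all)
  show ?thesis
    using x
  proof (induction x rule: K_group_induct)
    case (diff u v)
    then show ?case
      using K_group_subset[OF y] K_group_subset[OF diff(1)] K_group_subset[OF diff(2)]
      by (simp add: K.minus_eq K.l_distr K.r_distr K.l_minus K.r_minus)
  qed (use K_group_subset[OF y] w in simp_all)
qed

section \<open>Symbols as generators of reduced K-theory\<close>

lemma k_symbol_eq: "k_symbol F w = k_class F (length w) (K_word w)"
  by (simp add: k_symbol_def K_word_def)

lemma k_symbol_closed [simp]: "\<lbrakk>w \<in> lists D; length w = n\<rbrakk> \<Longrightarrow> k_symbol F w \<in> carrier (k_group F n)"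
  unfolding k_symbol_eq by (auto intro!: k_class_closed K_word_in_K_group)

lemma k_group_induct [consumes 1, case_names one symbol mult]:
  assumes X: "X \<in> carrier (k_group F n)"
    and one: "P \<one>\<^bsub>k_group F n\<^esub>"
    and symbol: "\<And>w. \<lbrakk>w \<in> lists D; length w = n\<rbrakk> \<Longrightarrow> P (k_symbol F w)"
    and mult: "\<And>X Y. \<lbrakk>X \<in> carrier (k_group F n); Y \<in> carrier (k_group F n); P X; P Y\<rbrakk> \<Longrightarrow>
      P (X \<otimes>\<^bsub>k_group F n\<^esub> Y)"
  shows "P X"
proof -
  obtain x where x: "x \<in> KC n" "X = k_class F n x"
    using k_group_cases[OF X] .
  have "P (k_class F n x)"
    using x(1)
  proof (induction x rule: K_group_induct)
    case zero
    then show ?case using one by simp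
  next
    case (word w)
    then show ?case using symbol[OF word] by (simp add: k_symbol_eq)
  next
    case (diff x y)
    then show ?case using mult by (simp add: k_class_diff)
  qed
  then show ?thesis using x by simp
qed

lemma k_symbol_append:
  assumes "v \<in> lists D" "w \<in> lists D"
  shows "k_mult F (length v) (length w) (k_symbol F v) (k_symbol F w) = k_symbol F (v @ w)"
  unfolding k_symbol_eq using assms by (simp add: k_mult_class K_word_append del: in_lists_conv_set)

lemma k_symbol_Cons:
  assumes "a \<in> D" "w \<in> lists D"
  shows "k_mult F (Suc 0) (length w) (k_symbol F [a]) (k_symbol F w) = k_symbol F (a # w)"
  using k_symbol_append[of "[a]" w] assms by simp

lemma k_symbol_mult:
  assumes a: "a \<in> D" and b: "b \<in> D"
  shows "k_symbol F [a \<otimes> b] = k_symbol F [a] \<otimes>\<^bsub>k_group F (Suc 0)\<^esub> k_symbol F [b]"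
proof -
  have "K_rho F a \<in> KC (Suc 0)" "K_rho F b \<in> KC (Suc 0)"
    using K_word_in_K_group[of "[a]" "Suc 0"] K_word_in_K_group[of "[b]" "Suc 0"] a b
      K_rho_closed[OF a] K_rho_closed[OF b] by auto
  then show ?thesis
    using K_rho_mult[OF a b] K_rho_closed[OF a] K_rho_closed[OF b]
    by (simp add: k_symbol_eq k_class_add)
qed

lemma k_symbol_one: "k_symbol F [\<one>] = \<one>\<^bsub>k_group F (Suc 0)\<^esub>"
  by (simp add: k_symbol_eq)

lemma k_symbol_relation:
  assumes "a \<in> D" "a \<noteq> \<one>" "b \<in> \<one> \<boxplus> (\<boxminus> a)"
  shows "k_symbol F [a, b] = \<one>\<^bsub>k_group F 2\<^esub>"
  using K_rho_relation[OF assms] one_minus_nonzero[OF assms] K_rho_closed[of b]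
  by (simp add: k_symbol_eq numeral_2_eq_2)

text \<open>The symbols of length 1 are closed under the group operation, by
  \<open>k_symbol_mult\<close>, and they generate degree 1; so they exhaust it.\<close>

lemma k_group_1_cases:
  assumes "X \<in> carrier (k_group F (Suc 0))"
  obtains a where "a \<in> D" "X = k_symbol F [a]"
proof -
  have "\<exists>a\<in>D. X = k_symbol F [a]"
    using assms
  proof (induction X rule: k_group_induct)
    case one
    then show ?case using k_symbol_one D_one by metis
  next
    case (symbol w)
    then show ?case by (cases w) auto
  next
    case (mult X Y)
    then show ?case using k_symbol_mult D_mult by metis
  qed
  then show thesis using that by blast
qed

section \<open>The axioms of an inductive graded ring for \<open>k_obj\<close>\<close>

lemma k_obj_simps [simp]:
  "igr_group (k_obj F) = k_group F" "igr_mult (k_obj F) = k_mult F"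
  "igr_top (k_obj F) n = k_symbol F (replicate n (\<boxminus> \<one>))"
  "igr_h (k_obj F) n = k_mult F 1 n (k_symbol F [\<boxminus> \<one>])"
  by (simp_all add: k_obj_def)

lemma replicate_neg_one [simp]: "replicate n (\<boxminus> \<one>) \<in> lists D"
  using D_neg_one by (simp add: in_lists_conv_set)

lemma k_mult_hom_right:
  assumes "X \<in> carrier (k_group F n)"
  shows "k_mult F n m X \<in> hom (k_group F m) (k_group F (n + m))"
proof -
  obtain x where x: "x \<in> KC n" "X = k_class F n x" using k_group_cases[OF assms] .
  show ?thesis
  proof (rule homI)
    fix Y assume "Y \<in> carrier (k_group F m)"
    then obtain y where y: "y \<in> KC m" "Y = k_class F m y" using k_group_cases by blast
    then show "k_mult F n m X Y \<in> carrier (k_group F (n + m))"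
      using x y by (simp add: k_mult_class K_group_mult)
    fix Y' assume "Y' \<in> carrier (k_group F m)"
    then obtain y' where y': "y' \<in> KC m" "Y' = k_class F m y'" using k_group_cases by blast
    have YY': "Y \<otimes>\<^bsub>k_group F m\<^esub> Y' = k_class F m (y \<oplus>\<^bsub>K_ring F\<^esub> y')"
      using y y' by (simp add: k_class_add)
    show "k_mult F n m X (Y \<otimes>\<^bsub>k_group F m\<^esub> Y') =
        k_mult F n m X Y \<otimes>\<^bsub>k_group F (n + m)\<^esub> k_mult F n m X Y'"
      unfolding YY' unfolding x(2) y(2) y'(2) k_mult_class[OF x(1) K_group_add[OF y(1) y'(1)]]
      using x y y' K_group_subset[OF x(1)] K_group_subset[OF y(1)] K_group_subset[OF y'(1)]
      by (simp add: k_mult_class K.r_distr k_class_add K_group_mult)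
  qed
qed

lemma k_mult_commute:
  assumes "X \<in> carrier (k_group F n)" "Y \<in> carrier (k_group F m)"
  shows "k_mult F n m X Y = k_mult F m n Y X"
proof -
  obtain x where x: "x \<in> KC n" "X = k_class F n x" using k_group_cases[OF assms(1)] .
  obtain y where y: "y \<in> KC m" "Y = k_class F m y" using k_group_cases[OF assms(2)] .
  show ?thesis
    using x y K_group_commute[OF x(1) y(1)] by (simp add: k_mult_class add.commute)
qed

lemma k_mult_assoc:
  assumes "X \<in> carrier (k_group F n)" "Y \<in> carrier (k_group F m)" "Z \<in> carrier (k_group F l)"
  shows "k_mult F (n + m) l (k_mult F n m X Y) Z = k_mult F n (m + l) X (k_mult F m l Y Z)"
proof -
  obtain x where x: "x \<in> KC n" "X = k_class F n x" using k_group_cases[OF assms(1)] .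
  obtain y where y: "y \<in> KC m" "Y = k_class F m y" using k_group_cases[OF assms(2)] .
  obtain z where z: "z \<in> KC l" "Z = k_class F l z" using k_group_cases[OF assms(3)] .
  show ?thesis
    using x y z K_group_subset[OF x(1)] K_group_subset[OF y(1)] K_group_subset[OF z(1)]
    by (simp add: k_mult_class K_group_mult K.m_assoc add.assoc)
qed

lemma k_mult_one:
  assumes "X \<in> carrier (k_group F n)"
  shows "k_mult F 0 n (k_symbol F []) X = X"
proof -
  obtain x where x: "x \<in> KC n" "X = k_class F n x" using k_group_cases[OF assms(1)] .
  have "\<one>\<^bsub>K_ring F\<^esub> \<in> KC 0"
    using K_word_in_K_group[of "[]" 0] by simp
  then show ?thesis
    using x K_group_subset[OF x(1)] by (simp add: k_symbol_eq k_mult_class)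
qed

text \<open>The ring homomorphism \<open>K\<^sub>*F \<rightarrow> \<int>\<close> that kills all \<open>\<rho>(a)\<close> shows that \<open>1\<close> is not in \<open>2K\<^sub>0F\<close>.\<close>

lemma k_symbol_Nil_nonzero: "k_symbol F [] \<noteq> \<one>\<^bsub>k_group F 0\<^esub>"
proof
  assume "k_symbol F [] = \<one>\<^bsub>k_group F 0\<^esub>"
  then have "k_class F 0 \<one>\<^bsub>K_ring F\<^esub> = k_class F 0 \<zero>\<^bsub>K_ring F\<^esub>"
    by (simp add: k_symbol_eq)
  moreover have "\<one>\<^bsub>K_ring F\<^esub> \<in> k_class F 0 \<one>\<^bsub>K_ring F\<^esub>"
    using K_word_in_K_group[of "[]" 0] by (intro k_class_self) simp
  ultimately obtain z where z: "z \<in> KC 0" "\<one>\<^bsub>K_ring F\<^esub> = z \<oplus>\<^bsub>K_ring F\<^esub> z \<oplus>\<^bsub>K_ring F\<^esub> \<zero>\<^bsub>K_ring F\<^esub>"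
    using k_class_eq[OF K_group_zero] by blast
  have zc: "z \<in> carrier (K_ring F)" using K_group_subset[OF z(1)] .
  obtain h where h: "h \<in> ring_hom (K_ring F) \<Z>"
    by (rule K_ring_universal[of \<Z> "\<lambda>_. 0"]) (use cring.axioms(1)[OF int_is_cring] in auto)
  have "h (z \<oplus>\<^bsub>K_ring F\<^esub> z) = h z + h z"
    using ring_hom_add[OF h zc zc] by simp
  then have "(1::int) = h z + h z"
    using z(2) zc ring_hom_one[OF h] by simp
  then show False by presburger
qed

text \<open>The only word of length 0 is the empty one, so degree 0 has at most the two elements
  \<open>?e\<close> and \<open>?t\<close>; \<open>k_symbol_Nil_nonzero\<close> keeps them
  apart.\<close>

lemma k_group_0_iso: "k_group F 0 \<cong> integer_mod_group 2"
proof -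
  interpret k: group "k_group F 0" by (rule group_k_group)
  let ?e = "\<one>\<^bsub>k_group F 0\<^esub>" and ?t = "k_symbol F []"
  have t: "?t \<in> carrier (k_group F 0)" by simp
  have cases: "X = ?e \<or> X = ?t" if "X \<in> carrier (k_group F 0)" for X
    using that
  proof (induction X rule: k_group_induct)
    case (mult X Y)
    then show ?case using k_group_sq[OF t] t k.l_one k.r_one by metis
  qed simp_all
  have car: "carrier (k_group F 0) = {?e, ?t}"
    using cases t k.one_closed by blast
  define f where "f X = (if X = ?e then 0 else 1 :: int)" for X
  have "f \<in> iso (k_group F 0) (integer_mod_group 2)"
  proof (rule isoI)
    show "f \<in> hom (k_group F 0) (integer_mod_group 2)"
      using k_group_sq[OF t] t k_symbol_Nil_nonzero
      by (auto simp: hom_def car f_def carrier_integer_mod_group)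
    show "bij_betw f (carrier (k_group F 0)) (carrier (integer_mod_group 2))"
      using k_symbol_Nil_nonzero
      by (auto simp: bij_betw_def inj_on_def car f_def carrier_integer_mod_group)
  qed
  then show ?thesis by (auto simp: is_iso_def)
qed

lemma comm_group_k_group: "comm_group (k_group F n)"
  using group_k_group k_group_sq
  by (intro group_exp2_imp_comm_group) (simp_all add: numeral_2_eq_2 group.is_monoid)

lemma graded_pairing_k_obj: "graded_pairing (k_obj F)"
proof (rule graded_pairing.intro)
  \<comment> \<open>Linearity in the left argument is linearity in the right one, carried over by
    \<open>k_mult_commute\<close>.\<close>
  fix n m Y assume Y: "Y \<in> carrier (igr_group (k_obj F) m)"
  have "k_mult F m n Y \<in> hom (k_group F n) (k_group F (n + m))"
    using k_mult_hom_right[of Y m n] Y by (simp add: add.commute)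
  then show "(\<lambda>X. igr_mult (k_obj F) n m X Y) \<in> hom (igr_group (k_obj F) n) (igr_group (k_obj F) (n + m))"
    using Y k_mult_commute[of _ n Y m] comm_group_k_group
    by (auto simp: hom_def comm_group_def Group.group_def monoid.m_closed)
qed (use k_mult_hom_right comm_group_k_group in auto)

lemma is_igr_k_obj: "is_igr (k_obj F)"
proof -
  interpret graded_pairing "k_obj F" by (rule graded_pairing_k_obj)
  have h_top: "k_mult F (Suc 0) n (k_symbol F [\<boxminus> \<one>]) (k_symbol F (replicate n (\<boxminus> \<one>))) =
      k_symbol F (replicate (Suc n) (\<boxminus> \<one>))" for n
    using k_symbol_Cons[OF D_neg_one, of "replicate n (\<boxminus> \<one>)"] by simp
  show ?thesis
    by (rule is_igrI)
      (use k_group_0_iso k_symbol_Nil_nonzero k_group_sq h_top k_mult_assoc k_mult_commute k_mult_one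
        in \<open>auto intro!: k_symbol_closed replicate_neg_one\<close>)
qed

sublocale k: inductive_graded_ring "k_obj F"
  by (rule is_igr_inductive_graded_ring[OF is_igr_k_obj])

lemma igr_prod_k_obj: "w \<in> lists D \<Longrightarrow> igr_prod (k_obj F) (map (\<lambda>a. k_symbol F [a]) w) = k_symbol F w"
  by (induction w rule: lists.induct) (simp_all add: k_symbol_Cons del: in_lists_conv_set)

lemma is_igr_plus_k_obj: "is_igr_plus (k_obj F)"
proof -
  define Q where "Q n X \<longleftrightarrow> (\<exists>k c. (\<forall>i<k. length (c i) = n \<and> set (c i) \<subseteq> carrier (k_group F 1)) \<and>
    X = (\<Otimes>\<^bsub>k_group F n\<^esub>i\<in>{..<k::nat}. igr_prod (k_obj F) (c i)))" for n X
  have Q_one: "Q n \<one>\<^bsub>k_group F n\<^esub>" for n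
    unfolding Q_def
    by (intro exI[of _ 0]) (simp add: comm_monoid.finprod_empty[OF comm_group.axioms(1)[OF comm_group_k_group]])
  have Q_symbol: "Q n (k_symbol F w \<otimes>\<^bsub>k_group F n\<^esub> X)" if w: "w \<in> lists D" "length w = n" and "Q n X" for n w X
  proof -
    interpret G: comm_group "k_group F n" by (rule comm_group_k_group)
    obtain l c where c: "\<And>i. i < l \<Longrightarrow> length (c i) = n \<and> set (c i) \<subseteq> carrier (k_group F 1)"
      and X: "X = (\<Otimes>\<^bsub>k_group F n\<^esub>i\<in>{..<l::nat}. igr_prod (k_obj F) (c i))"
      using \<open>Q n X\<close> unfolding Q_def by blast
    \<comment> \<open>Adds, at the new index \<open>l\<close>, the list of degree 1 symbols whose
      product is \<open>k_symbol F w\<close>.\<close>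
    define c' where "c' = c(l := map (\<lambda>a. k_symbol F [a]) w)"
    have c': "length (c' i) = n \<and> set (c' i) \<subseteq> carrier (k_group F 1)" if "i < Suc l" for i
      using that c[of i] w by (auto simp: c'_def less_Suc_eq intro!: k_symbol_closed)
    have closed: "igr_prod (k_obj F) (c' i) \<in> carrier (k_group F n)" if "i < Suc l" for i
      using k.igr_prod_closed[of "c' i"] c'[OF that] by simp
    have "(\<Otimes>\<^bsub>k_group F n\<^esub>i\<in>{..<Suc l}. igr_prod (k_obj F) (c' i)) =
        igr_prod (k_obj F) (c' l) \<otimes>\<^bsub>k_group F n\<^esub> (\<Otimes>\<^bsub>k_group F n\<^esub>i\<in>{..<l}. igr_prod (k_obj F) (c' i))"
      unfolding lessThan_Suc by (rule G.finprod_insert) (use closed in auto)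
    also have "igr_prod (k_obj F) (c' l) = k_symbol F w"
      using igr_prod_k_obj[OF w(1)] by (simp add: c'_def)
    also have "(\<Otimes>\<^bsub>k_group F n\<^esub>i\<in>{..<l}. igr_prod (k_obj F) (c' i)) = X"
      unfolding X by (rule G.finprod_cong') (use k.igr_prod_closed c in \<open>auto simp: c'_def\<close>)
    finally show ?thesis
      unfolding Q_def using c' by metis
  qed
  have "Q n X" if X: "X \<in> carrier (k_group F n)" for n X
  proof -
    interpret G: comm_group "k_group F n" by (rule comm_group_k_group)
    \<comment> \<open>The claim is strengthened to multiplication of any \<open>Y\<close> satisfying
      \<open>Q\<close> by \<open>X\<close>. Then only one symbol is added at a time, and two indexed
      families never have to be joined; \<open>Y = 1\<close> gives \<open>Q n X\<close>
      itself.\<close>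
    have "\<forall>Y\<in>carrier (k_group F n). Q n Y \<longrightarrow> Q n (X \<otimes>\<^bsub>k_group F n\<^esub> Y)"
      using X
    proof (induction X rule: k_group_induct)
      case (mult X Y)
      then show ?case by (simp add: G.m_assoc)
    qed (use Q_symbol in auto)
    then show ?thesis
      using Q_one X by fastforce
  qed
  moreover have "k_mult F 1 1 (k_symbol F [\<boxminus> \<one>] \<otimes>\<^bsub>k_group F 1\<^esub> X) X = \<one>\<^bsub>k_group F 2\<^esub>"
    if X: "X \<in> carrier (k_group F 1)" for X
  proof -
    obtain a where a: "a \<in> D" "X = k_symbol F [a]"
      using k_group_1_cases X by auto
    have na: "\<boxminus> a \<in> D" using D_neg[OF a(1)] .
    have "k_symbol F [\<boxminus> \<one>] \<otimes>\<^bsub>k_group F 1\<^esub> X = k_symbol F [\<boxminus> a]"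
      using k_symbol_mult[OF D_neg_one a(1)] hneg_eq_mult[of a] a by simp
    moreover have "k_mult F 1 1 (k_symbol F [\<boxminus> a]) (k_symbol F [a]) = k_symbol F [\<boxminus> a, a]"
      using k_symbol_Cons[OF na, of "[a]"] a(1) by simp
    \<comment> \<open>\<open>K_rho_neg\<close> is applied at \<open>-a\<close>, whose negative is
      \<open>a\<close>.\<close>
    moreover have "k_symbol F [\<boxminus> a, a] = \<one>\<^bsub>k_group F 2\<^esub>"
      using K_rho_neg[OF na] K_rho_closed[OF a(1)] a(1) by (simp add: k_symbol_eq numeral_2_eq_2)
    ultimately show ?thesis using a by simp
  qed
  ultimately show ?thesis
    using is_igr_k_obj unfolding is_igr_plus_def Q_def by simp
qed


section \<open>Morphisms out of reduced K-theory\<close>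

lemma k_hom_symbol:
  assumes "is_igr R" "g \<in> igr_hom (k_obj F) R" "w \<in> lists D"
  shows "g (length w) (k_symbol F w) = igr_prod R (map (\<lambda>a. g 1 (k_symbol F [a])) w)"
  using igr_prod_hom[OF is_igr_k_obj assms(1,2), of "map (\<lambda>a. k_symbol F [a]) w"]
    igr_prod_k_obj[OF assms(3)] assms(3)
  by (force simp: comp_def intro!: k_symbol_closed)

text \<open>Symbols generate every degree, and each symbol is a product of symbols of length 1, so a
  morphism is determined by its values there. Outside the carriers extensionality fixes it.\<close>

lemma k_hom_eqI:
  assumes R: "is_igr R" and g: "g \<in> igr_hom (k_obj F) R" and g': "g' \<in> igr_hom (k_obj F) R"
    and eq: "\<And>a. a \<in> D \<Longrightarrow> g 1 (k_symbol F [a]) = g' 1 (k_symbol F [a])"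
  shows "g = g'"
proof (intro ext)
  fix n X
  have hom: "g n \<in> hom (k_group F n) (igr_group R n)" "g' n \<in> hom (k_group F n) (igr_group R n)"
    and ext: "g n \<in> extensional (carrier (k_group F n))" "g' n \<in> extensional (carrier (k_group F n))"
    using g g' by (auto simp: igr_hom_iff[OF is_igr_k_obj R])
  have R_grp: "group (igr_group R n)"
    using R by (simp add: is_igr_def)
  show "g n X = g' n X"
  proof (cases "X \<in> carrier (k_group F n)")
    case True
    then show ?thesis
    proof (induction X rule: k_group_induct)
      case one
      then show ?case
        using hom_one[OF hom(1) group_k_group R_grp] hom_one[OF hom(2) group_k_group R_grp] by simp
    next
      case (symbol w)
      have "map (\<lambda>a. g 1 (k_symbol F [a])) w = map (\<lambda>a. g' 1 (k_symbol F [a])) w"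
        by (rule map_cong[OF refl]) (use symbol(1) eq in blast)
      then have "g (length w) (k_symbol F w) = g' (length w) (k_symbol F w)"
        unfolding k_hom_symbol[OF R g symbol(1)] k_hom_symbol[OF R g' symbol(1)] by (simp only:)
      then show ?case using symbol(2) by simp
    next
      case (mult X Y)
      then show ?case using hom by (simp add: hom_mult)
    qed
  next
    case False
    then show ?thesis using ext by (simp add: extensional_def)
  qed
qed

text \<open>\<open>K_ring_universal\<close> is applied to \<open>a \<mapsto> delta 1 (f a)\<close>,
  with values in \<open>igr_ring R\<close>. A word of length \<open>n\<close> then goes to a product
  of \<open>n\<close> elements of degree 1, so the resulting \<open>h\<close> respects degrees, and
  \<open>g n\<close> reads off its component in degree \<open>n\<close> at a representative.\<close>

lemma k_universal:
  assumes R: "is_igr R" and f: "f \<in> D \<rightarrow> carrier (igr_group R 1)"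
    and f_mult: "\<And>a b. \<lbrakk>a \<in> D; b \<in> D\<rbrakk> \<Longrightarrow> f (a \<otimes> b) = f a \<otimes>\<^bsub>igr_group R 1\<^esub> f b"
    and f_top: "f (\<boxminus> \<one>) = igr_top R 1"
    and f_rel: "\<And>a b. \<lbrakk>a \<in> D; a \<noteq> \<one>; b \<in> D; b \<in> \<one> \<boxplus> (\<boxminus> a)\<rbrakk> \<Longrightarrow>
      igr_mult R 1 1 (f a) (f b) = \<one>\<^bsub>igr_group R 2\<^esub>"
  obtains g where "g \<in> igr_hom (k_obj F) R" "\<And>a. a \<in> D \<Longrightarrow> g 1 (k_symbol F [a]) = f a"
proof -
  interpret R: inductive_graded_ring R by (rule is_igr_inductive_graded_ring[OF R])
  have fc: "f a \<in> R.C 1" if "a \<in> D" for a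
    using f that by blast
  obtain h where h: "h \<in> ring_hom (K_ring F) (igr_ring R)"
    and h_rho: "\<And>a. a \<in> D \<Longrightarrow> h (K_rho F a) = R.delta 1 (f a)"
  proof (rule K_ring_universal[of "igr_ring R" "\<lambda>a. R.delta 1 (f a)"])
    show "(\<lambda>a. R.delta 1 (f a)) \<in> D \<rightarrow> carrier (igr_ring R)"
      using fc by (auto intro!: R.delta_closed)
    show "R.delta 1 (f (a \<otimes> b)) = R.delta 1 (f a) \<oplus>\<^bsub>igr_ring R\<^esub> R.delta 1 (f b)"
      if "a \<in> D" "b \<in> D" for a b
      using R.delta_add[OF fc fc] f_mult that by metis
    show "R.delta 1 (f a) \<otimes>\<^bsub>igr_ring R\<^esub> R.delta 1 (f b) = \<zero>\<^bsub>igr_ring R\<^esub>"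
      if "a \<in> D" "a \<noteq> \<one>" "b \<in> D" "b \<in> \<one> \<boxplus> (\<boxminus> a)" for a b
      using R.delta_mult[OF fc[OF that(1)] fc[OF that(3)]] f_rel[OF that] R.delta_zero[of 2]
      by (simp add: numeral_2_eq_2)
  qed (use R.ring.ring_axioms in auto)
  have sq: "x \<oplus>\<^bsub>igr_ring R\<^esub> x = \<zero>\<^bsub>igr_ring R\<^esub>" if "x \<in> carrier (igr_ring R)" for x
    using that by (auto simp: R.add_igr_ring R.zero_igr_ring R.carrier_igr_ring)
  have neg: "\<ominus>\<^bsub>igr_ring R\<^esub> x = x" if "x \<in> carrier (igr_ring R)" for x
    using sq[OF that] that by (intro R.ring.minus_equality)
  have prod_closed: "igr_prod R (map f w) \<in> R.C (length w)" if "w \<in> lists D" for w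
    using R.igr_prod_closed[of "map f w"] that fc by (auto simp: image_subset_iff)
  have h_word: "h (K_word w) = R.delta (length w) (igr_prod R (map f w))" if "w \<in> lists D" for w
    using that
  proof (induction w rule: lists.induct)
    case Nil
    then show ?case using ring_hom_one[OF h] by (simp add: R.one_igr_ring)
  next
    case (Cons a w)
    then show ?case
      using ring_hom_mult[OF h K_rho_closed[OF Cons.hyps(1)] K_word_closed[OF Cons.hyps(2)]]
        R.delta_mult[OF fc[OF Cons.hyps(1)] prod_closed[OF Cons.hyps(2)]] h_rho[OF Cons.hyps(1)]
      by simp
  qed
  \<comment> \<open>Both parts are proved together because the difference case needs both: in
    characteristic 2 the image of a difference is the sum of two elements concentrated in degree
    \<open>n\<close>.\<close>
  have h_K: "h x n \<in> R.C n \<and> h x = R.delta n (h x n)" if "x \<in> KC n" for n x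
    using that
  proof (induction x rule: K_group_induct)
    case zero
    then show ?case
      using ring_hom_zero[OF h ring_K_ring R.ring.ring_axioms] R.delta_zero[of n]
      by (simp add: R.zero_igr_ring)
  next
    case (word w)
    then show ?case using h_word[OF word(1)] prod_closed[OF word(1)] by simp
  next
    case (diff x y)
    have c: "x \<in> carrier (K_ring F)" "y \<in> carrier (K_ring F)"
      using diff K_group_subset by blast+
    have hy: "h y \<in> carrier (igr_ring R)" using ring_hom_closed[OF h c(2)] .
    have "h (\<ominus>\<^bsub>K_ring F\<^esub> y) = \<ominus>\<^bsub>igr_ring R\<^esub> h y"
      using ring_hom_add[OF h c(2) K.a_inv_closed[OF c(2)]] ring_hom_closed[OF h K.a_inv_closed[OF c(2)]]
        hy ring_hom_zero[OF h ring_K_ring R.ring.ring_axioms] c(2)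
      by (intro R.ring.minus_equality[symmetric]) (simp_all add: K.r_neg R.ring.a_comm)
    then have "h (x \<ominus>\<^bsub>K_ring F\<^esub> y) = h x \<oplus>\<^bsub>igr_ring R\<^esub> h y"
      using ring_hom_add[OF h c(1) K.a_inv_closed[OF c(2)]] neg[OF hy] by (simp add: K.minus_eq)
    also have "\<dots> = R.delta n (h x n) \<oplus>\<^bsub>igr_ring R\<^esub> R.delta n (h y n)"
      by (rule arg_cong2[where f = "(\<oplus>\<^bsub>igr_ring R\<^esub>)"]) (use diff in blast)+
    also have "\<dots> = R.delta n (h x n \<otimes>\<^bsub>igr_group R n\<^esub> h y n)"
      using diff by (intro R.delta_add) blast+
    finally have e: "h (x \<ominus>\<^bsub>K_ring F\<^esub> y) = R.delta n (h x n \<otimes>\<^bsub>igr_group R n\<^esub> h y n)" .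
    have "h x n \<otimes>\<^bsub>igr_group R n\<^esub> h y n \<in> R.C n"
      using diff by (intro R.grp.m_closed) blast+
    then show ?case by (simp add: e)
  qed
  \<comment> \<open>The choice of representative is harmless by \<open>k_class_constant\<close>; the
    restriction makes \<open>g n\<close> extensional, as \<open>igr_hom\<close> demands.\<close>
  define g where "g = (\<lambda>n. \<lambda>X\<in>carrier (k_group F n). h (SOME x. x \<in> X) n)"
  have g_class: "g n (k_class F n x) = h x n" if x: "x \<in> KC n" for n x
  proof -
    have "(SOME y. y \<in> k_class F n x) \<in> k_class F n x"
      using k_class_self[OF x] by (rule someI)
    then show ?thesis
      using k_class_constant[OF R.ring.ring_axioms h sq x] x by (simp add: g_def)
  qed
  have g_symbol: "g (length w) (k_symbol F w) = igr_prod R (map f w)" if "w \<in> lists D" for w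
    using g_class[OF K_word_in_K_group[OF that refl]] h_word[OF that] by (simp add: k_symbol_eq)
  have "g \<in> igr_hom (k_obj F) R"
    unfolding igr_hom_iff[OF is_igr_k_obj R] k_obj_simps
  proof (intro conjI allI ballI)
    fix n
    show "g n \<in> hom (k_group F n) (igr_group R n)"
    proof (rule homI)
      fix X assume "X \<in> carrier (k_group F n)"
      then obtain x where x: "x \<in> KC n" "X = k_class F n x" using k_group_cases by blast
      then show "g n X \<in> R.C n" using h_K[OF x(1), THEN conjunct1] g_class by simp
      fix Y assume "Y \<in> carrier (k_group F n)"
      then obtain y where y: "y \<in> KC n" "Y = k_class F n y" using k_group_cases by blast
      have "h (x \<oplus>\<^bsub>K_ring F\<^esub> y) n = h x n \<otimes>\<^bsub>igr_group R n\<^esub> h y n"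
        using ring_hom_add[OF h K_group_subset[OF x(1)] K_group_subset[OF y(1)]]
        by (simp add: R.add_igr_ring)
      then show "g n (X \<otimes>\<^bsub>k_group F n\<^esub> Y) = g n X \<otimes>\<^bsub>igr_group R n\<^esub> g n Y"
        using x y g_class[OF K_group_add[OF x(1) y(1)]] by (simp add: g_class k_class_add)
    qed
    show "g n \<in> extensional (carrier (k_group F n))"
      by (simp add: g_def)
    \<comment> \<open>On both sides the distinguished elements are powers of the one in degree 1, so
      \<open>f_top\<close> suffices for all degrees.\<close>
    show "g n (k_symbol F (replicate n (\<boxminus> \<one>))) = igr_top R n"
      using g_symbol[OF replicate_neg_one[of n]] R.igr_prod_replicate_top[of n] f_top by simp
  next
    fix n m X Y assume "X \<in> carrier (k_group F n)" "Y \<in> carrier (k_group F m)"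
    then obtain x y where x: "x \<in> KC n" "X = k_class F n x" and y: "y \<in> KC m" "Y = k_class F m y"
      using k_group_cases by metis
    have "h (x \<otimes>\<^bsub>K_ring F\<^esub> y) = h x \<otimes>\<^bsub>igr_ring R\<^esub> h y"
      using ring_hom_mult[OF h K_group_subset[OF x(1)] K_group_subset[OF y(1)]] .
    also have "\<dots> = R.delta n (h x n) \<otimes>\<^bsub>igr_ring R\<^esub> R.delta m (h y m)"
      by (rule arg_cong2[where f = "(\<otimes>\<^bsub>igr_ring R\<^esub>)"]) (use h_K x(1) y(1) in blast)+
    also have "\<dots> = R.delta (n + m) (R.B n m (h x n) (h y m))"
      using h_K x(1) y(1) by (intro R.delta_mult) blast+
    finally show "g (n + m) (k_mult F n m X Y) = igr_mult R n m (g n X) (g m Y)"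
      using x y g_class[OF K_group_mult[OF x(1) y(1)]] by (simp add: g_class k_mult_class)
  qed
  \<comment> \<open>\<open>igr_prod R [f a]\<close> is still multiplied by
    \<open>igr_top R 0\<close> on the right; commutativity reduces this to the left unit
    law.\<close>
  moreover have "g 1 (k_symbol F [a]) = f a" if "a \<in> D" for a
    using g_symbol[of "[a]"] that R.mult_comm[OF fc[OF that] R.top_closed] R.mult_top_left[OF fc[OF that]]
    by simp
  ultimately show thesis using that by blast
qed

end

section \<open>Sums in the hyperfield of a pairing\<close>

text \<open>Only degrees 1 and 2 enter the sums of \<open>Gamma_obj\<close>. They are isolated here
  as \<open>G\<close> and \<open>H\<close>, with \<open>t\<close> in the role of \<open>-1\<close>.
  The law \<open>pr_self\<close> is the condition \<open>(t + x) * x = 0\<close> rewritten in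
  exponent 2.\<close>

locale exp2_pairing =
  G: comm_group G + H: comm_group H for G :: "'r monoid" and H :: "'s monoid" +
  fixes t :: 'r and pr :: "'r \<Rightarrow> 'r \<Rightarrow> 's"
  assumes G_sq [simp]: "x \<in> carrier G \<Longrightarrow> x \<otimes>\<^bsub>G\<^esub> x = \<one>\<^bsub>G\<^esub>"
    and H_sq [simp]: "u \<in> carrier H \<Longrightarrow> u \<otimes>\<^bsub>H\<^esub> u = \<one>\<^bsub>H\<^esub>"
    and t_closed [simp]: "t \<in> carrier G"
    and pr_closed [simp]: "\<lbrakk>x \<in> carrier G; y \<in> carrier G\<rbrakk> \<Longrightarrow> pr x y \<in> carrier H"
    and pr_mult_left:
      "\<lbrakk>x \<in> carrier G; y \<in> carrier G; z \<in> carrier G\<rbrakk> \<Longrightarrow> pr (x \<otimes>\<^bsub>G\<^esub> y) z = pr x z \<otimes>\<^bsub>H\<^esub> pr y z"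
    and pr_commute: "\<lbrakk>x \<in> carrier G; y \<in> carrier G\<rbrakk> \<Longrightarrow> pr x y = pr y x"
    and pr_self: "x \<in> carrier G \<Longrightarrow> pr x x = pr t x"
begin

lemma pr_mult_right:
  "\<lbrakk>x \<in> carrier G; y \<in> carrier G; z \<in> carrier G\<rbrakk> \<Longrightarrow> pr x (y \<otimes>\<^bsub>G\<^esub> z) = pr x y \<otimes>\<^bsub>H\<^esub> pr x z"
  using pr_mult_left[of y z x] pr_commute[of x] by simp

lemma G_cancel [simp]: "\<lbrakk>x \<in> carrier G; y \<in> carrier G\<rbrakk> \<Longrightarrow> x \<otimes>\<^bsub>G\<^esub> (x \<otimes>\<^bsub>G\<^esub> y) = y"
  by (simp flip: G.m_assoc)

lemma H_cancel [simp]: "\<lbrakk>x \<in> carrier H; y \<in> carrier H\<rbrakk> \<Longrightarrow> x \<otimes>\<^bsub>H\<^esub> (x \<otimes>\<^bsub>H\<^esub> y) = y"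
  by (simp flip: H.m_assoc)

lemma H_eq_iff: "\<lbrakk>x \<in> carrier H; y \<in> carrier H\<rbrakk> \<Longrightarrow> x = y \<longleftrightarrow> x \<otimes>\<^bsub>H\<^esub> y = \<one>\<^bsub>H\<^esub>"
  by (metis H_cancel H.r_one H_sq)

lemma pr_one_left [simp]: "y \<in> carrier G \<Longrightarrow> pr \<one>\<^bsub>G\<^esub> y = \<one>\<^bsub>H\<^esub>"
  using pr_mult_left[of "\<one>\<^bsub>G\<^esub>" "\<one>\<^bsub>G\<^esub>" y] by simp

text \<open>If \<open>ab = cd\<close> then \<open>d = abc\<close>, and since \<open>pr c c = pr t c\<close> the condition \<open>pr a b = pr c d\<close> says that
  the following element is trivial.\<close>

definition defect :: "'r \<Rightarrow> 'r \<Rightarrow> 'r \<Rightarrow> 's" where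
  "defect a b c = pr t c \<otimes>\<^bsub>H\<^esub> pr a c \<otimes>\<^bsub>H\<^esub> pr a b \<otimes>\<^bsub>H\<^esub> pr b c"

lemmas pr_simps = pr_mult_left pr_mult_right G.m_ac H.m_ac

lemma represented_iff_defect:
  assumes a: "a \<in> carrier G" and b: "b \<in> carrier G" and c: "c \<in> carrier G"
  shows "(\<exists>d\<in>carrier G. a \<otimes>\<^bsub>G\<^esub> b = c \<otimes>\<^bsub>G\<^esub> d \<and> pr a b = pr c d) \<longleftrightarrow> defect a b c = \<one>\<^bsub>H\<^esub>"
proof -
  let ?d = "a \<otimes>\<^bsub>G\<^esub> b \<otimes>\<^bsub>G\<^esub> c"
  have "d = ?d" if "d \<in> carrier G" "a \<otimes>\<^bsub>G\<^esub> b = c \<otimes>\<^bsub>G\<^esub> d" for d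
    using that assms by (simp add: G.m_ac)
  moreover have "a \<otimes>\<^bsub>G\<^esub> b = c \<otimes>\<^bsub>G\<^esub> ?d"
    using assms by (simp add: G.m_ac)
  ultimately have "(\<exists>d\<in>carrier G. a \<otimes>\<^bsub>G\<^esub> b = c \<otimes>\<^bsub>G\<^esub> d \<and> pr a b = pr c d) \<longleftrightarrow> pr a b = pr c ?d"
    using assms by (metis G.m_closed)
  also have "\<dots> \<longleftrightarrow> pr a b \<otimes>\<^bsub>H\<^esub> pr c ?d = \<one>\<^bsub>H\<^esub>"
    using assms by (intro H_eq_iff) simp_all
  also have "pr a b \<otimes>\<^bsub>H\<^esub> pr c ?d = defect a b c"
    unfolding defect_def using assms pr_commute[OF c a] pr_commute[OF c b] pr_self[OF c]
    by (simp add: pr_simps)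
  finally show ?thesis .
qed

text \<open>Expanding the right-hand side produces the two additional terms \<open>pr t a\<close>
  and \<open>pr a a\<close>, which cancel. The factored form is the one that a single relation of
  K-theory can kill; see \<open>phi_sum\<close>.\<close>

lemma defect_eq:
  assumes "a \<in> carrier G" "b \<in> carrier G" "c \<in> carrier G"
  shows "defect a b c = pr (t \<otimes>\<^bsub>G\<^esub> (a \<otimes>\<^bsub>G\<^esub> b)) (a \<otimes>\<^bsub>G\<^esub> c)"
  unfolding defect_def using assms pr_self[OF assms(1)] pr_commute[OF assms(2,1)]
  by (simp add: pr_simps)

section \<open>Identities for \<open>defect\<close> that become hyperfield axioms of
  \<open>Gamma_obj\<close>\<close>

lemma defect_commute:
  assumes "a \<in> carrier G" "b \<in> carrier G" "c \<in> carrier G"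
  shows "defect b a c = defect a b c"
  unfolding defect_def using assms pr_commute[OF assms(2,1)] by (simp add: H.m_ac)

text \<open>Places \<open>a\<close> in \<open>a + b\<close>, so that sums of non-zero elements are
  not empty.\<close>

lemma defect_self:
  assumes "a \<in> carrier G" "b \<in> carrier G"
  shows "defect a b a = \<one>\<^bsub>H\<^esub>"
  unfolding defect_def using assms pr_self[OF assms(1)] pr_commute[OF assms(2,1)] by (simp add: H.m_ac)

text \<open>For opposite summands the criterion accepts every non-zero \<open>c\<close>, in
  agreement with the separate clause for \<open>a + (-a)\<close> in \<open>Gamma_obj\<close>. Hence
  \<open>Some_in_Gamma_sum\<close> gets by without a case distinction.\<close>

lemma defect_opposite:
  assumes "b \<in> carrier G" "c \<in> carrier G"
  shows "defect (t \<otimes>\<^bsub>G\<^esub> b) b c = \<one>\<^bsub>H\<^esub>"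
  unfolding defect_def using assms pr_self[OF assms(1)] by (simp add: pr_simps)

lemma defect_reverse_left:
  assumes "a \<in> carrier G" "b \<in> carrier G" "c \<in> carrier G"
  shows "defect c (t \<otimes>\<^bsub>G\<^esub> b) a = defect a b c"
  unfolding defect_def
  using assms pr_commute[OF assms(3,1)] pr_commute[OF assms(2,1)] pr_commute[OF assms(3,2)]
    pr_commute[OF assms(3) t_closed]
  by (simp add: pr_simps)

lemma defect_reverse_right:
  assumes "a \<in> carrier G" "b \<in> carrier G" "c \<in> carrier G"
  shows "defect (t \<otimes>\<^bsub>G\<^esub> a) c b = defect a b c"
  unfolding defect_def
  using assms pr_commute[OF assms(3,1)] pr_commute[OF assms(2,1)] pr_commute[OF assms(3,2)]
  by (simp add: pr_simps)

lemma defect_scale: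
  assumes "a \<in> carrier G" "b \<in> carrier G" "c \<in> carrier G" "d \<in> carrier G"
  shows "defect (a \<otimes>\<^bsub>G\<^esub> d) (b \<otimes>\<^bsub>G\<^esub> d) (c \<otimes>\<^bsub>G\<^esub> d) = defect a b c"
  unfolding defect_def
  using assms pr_self[OF assms(4)] pr_commute[OF assms(4,1)] pr_commute[OF assms(4,2)] pr_commute[OF assms(4,3)]
  by (simp add: pr_simps)

text \<open>Membership in \<open>1 - a\<close> thereby becomes a condition linear in
  \<open>c\<close>. Closure of \<open>1 - a\<close> under products follows, as does the match with
  the relations of K-theory.\<close>

lemma defect_one_minus:
  assumes "a \<in> carrier G" "c \<in> carrier G"
  shows "defect \<one>\<^bsub>G\<^esub> (t \<otimes>\<^bsub>G\<^esub> a) c = pr a c"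
  unfolding defect_def using assms by (simp add: pr_simps)

end

locale igr_plus = inductive_graded_ring R for R :: "'r igr" +
  assumes top_mult: "a \<in> carrier (igr_group R 1) \<Longrightarrow>
    igr_mult R 1 1 (igr_top R 1 \<otimes>\<^bsub>igr_group R 1\<^esub> a) a = \<one>\<^bsub>igr_group R 2\<^esub>"

lemma is_igr_plus_igr_plus: "is_igr_plus R \<Longrightarrow> igr_plus R"
  by (simp add: is_igr_plus_def igr_plus_def igr_plus_axioms_def is_igr_inductive_graded_ring)

sublocale igr_plus \<subseteq> P: exp2_pairing "igr_group R 1" "igr_group R 2" "igr_top R 1" "igr_mult R 1 1"
proof (unfold_locales)
  have add: "igr_mult R 1 1 (x \<otimes>\<^bsub>igr_group R 1\<^esub> y) z =
      igr_mult R 1 1 x z \<otimes>\<^bsub>igr_group R 2\<^esub> igr_mult R 1 1 y z"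
    if "x \<in> C 1" "y \<in> C 1" "z \<in> C 1" for x y z
    using mult_add_left[OF that] by (simp add: numeral_2_eq_2)
  then show "igr_mult R 1 1 (x \<otimes>\<^bsub>igr_group R 1\<^esub> y) z =
      igr_mult R 1 1 x z \<otimes>\<^bsub>igr_group R 2\<^esub> igr_mult R 1 1 y z"
    if "x \<in> C 1" "y \<in> C 1" "z \<in> C 1" for x y z
    using that .
  show closed: "igr_mult R 1 1 x y \<in> C 2" if "x \<in> C 1" "y \<in> C 1" for x y
    using mult_closed[OF that] by (simp add: numeral_2_eq_2)
  \<comment> \<open>Expanding \<open>(t + x) * x = 0\<close> shows that \<open>t * x\<close> and
    \<open>x * x\<close> add up to zero; in exponent 2 they are then equal.\<close>
  show "igr_mult R 1 1 x x = igr_mult R 1 1 (igr_top R 1) x" if "x \<in> C 1" for x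
  proof -
    have "igr_mult R 1 1 (igr_top R 1) x \<otimes>\<^bsub>igr_group R 2\<^esub> igr_mult R 1 1 x x = Z 2"
      using top_mult[OF that] add[OF top_closed_all that that] by simp
    moreover have "igr_mult R 1 1 x x \<otimes>\<^bsub>igr_group R 2\<^esub> igr_mult R 1 1 x x = Z 2"
      using closed[OF that that] by simp
    ultimately show ?thesis
      using closed[OF that that] closed[OF top_closed_all that] grp.right_cancel by metis
  qed
qed (use mult_comm in auto)

section \<open>The functor $\Gamma$ on objects and morphisms\<close>

context igr_plus
begin

context
  notes One_nat_def [simp del]
begin

abbreviation "\<Gamma> \<equiv> Gamma_obj R"
abbreviation "G \<equiv> igr_group R 1"
abbreviation "T \<equiv> igr_top R 1"

lemma Gamma_simps [simp]:
  "carrier \<Gamma> = insert None (Some ` C 1)" "hzero \<Gamma> = None" "\<one>\<^bsub>\<Gamma>\<^esub> = Some (Z 1)"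
  "Some a \<otimes>\<^bsub>\<Gamma>\<^esub> Some b = Some (a \<otimes>\<^bsub>G\<^esub> b)" "None \<otimes>\<^bsub>\<Gamma>\<^esub> y = None" "x \<otimes>\<^bsub>\<Gamma>\<^esub> None = None"
  "\<boxminus>\<^bsub>\<Gamma>\<^esub> None = None" "\<boxminus>\<^bsub>\<Gamma>\<^esub> Some a = Some (T \<otimes>\<^bsub>G\<^esub> a)"
  "None \<boxplus>\<^bsub>\<Gamma>\<^esub> y = {y}" "x \<boxplus>\<^bsub>\<Gamma>\<^esub> None = {x}"
  by (simp_all add: Gamma_obj_def Let_def split: option.split)

lemma None_in_Gamma_sum: "None \<in> Some a \<boxplus>\<^bsub>\<Gamma>\<^esub> Some b \<longleftrightarrow> a = T \<otimes>\<^bsub>G\<^esub> b"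
  by (simp add: Gamma_obj_def Let_def)

lemma Some_in_Gamma_sum:
  assumes "a \<in> C 1" "b \<in> C 1"
  shows "Some c \<in> Some a \<boxplus>\<^bsub>\<Gamma>\<^esub> Some b \<longleftrightarrow> c \<in> C 1 \<and> P.defect a b c = Z 2"
proof (cases "a = T \<otimes>\<^bsub>G\<^esub> b")
  case True
  then show ?thesis
    using P.defect_opposite[OF assms(2)] by (auto simp: Gamma_obj_def Let_def)
next
  case False
  then have "Some c \<in> Some a \<boxplus>\<^bsub>\<Gamma>\<^esub> Some b \<longleftrightarrow> c \<in> C 1 \<and>
      (\<exists>d\<in>C 1. a \<otimes>\<^bsub>G\<^esub> b = c \<otimes>\<^bsub>G\<^esub> d \<and> B 1 1 a b = B 1 1 c d)"
    by (auto simp: Gamma_obj_def Let_def)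
  then show ?thesis
    using P.represented_iff_defect[OF assms] by blast
qed

lemma Gamma_hadd_closed:
  "\<lbrakk>x \<in> carrier \<Gamma>; y \<in> carrier \<Gamma>; z \<in> x \<boxplus>\<^bsub>\<Gamma>\<^esub> y\<rbrakk> \<Longrightarrow> z \<in> carrier \<Gamma>"
  by (cases z) (auto simp: Some_in_Gamma_sum)

lemma Gamma_hadd_commute:
  assumes "x \<in> carrier \<Gamma>" "y \<in> carrier \<Gamma>"
  shows "x \<boxplus>\<^bsub>\<Gamma>\<^esub> y = y \<boxplus>\<^bsub>\<Gamma>\<^esub> x"
proof (cases "x = None \<or> y = None")
  case False
  then obtain a b where ab: "a \<in> C 1" "b \<in> C 1" "x = Some a" "y = Some b"
    using assms by auto
  have "a = T \<otimes>\<^bsub>G\<^esub> b \<longleftrightarrow> b = T \<otimes>\<^bsub>G\<^esub> a"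
    using ab P.G_cancel[OF P.t_closed] by metis
  then have "z \<in> x \<boxplus>\<^bsub>\<Gamma>\<^esub> y \<longleftrightarrow> z \<in> y \<boxplus>\<^bsub>\<Gamma>\<^esub> x" for z
    using ab P.defect_commute[OF ab(1,2)]
    by (cases z) (auto simp: Some_in_Gamma_sum None_in_Gamma_sum)
  then show ?thesis by blast
qed auto

lemma Gamma_hadd_reversible:
  assumes "x \<in> carrier \<Gamma>" "y \<in> carrier \<Gamma>" "z \<in> x \<boxplus>\<^bsub>\<Gamma>\<^esub> y"
  shows "x \<in> z \<boxplus>\<^bsub>\<Gamma>\<^esub> (\<boxminus>\<^bsub>\<Gamma>\<^esub> y) \<and> y \<in> (\<boxminus>\<^bsub>\<Gamma>\<^esub> x) \<boxplus>\<^bsub>\<Gamma>\<^esub> z"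
proof (cases "x = None \<or> y = None")
  case True
  then show ?thesis
    using assms by (auto simp: None_in_Gamma_sum Some_in_Gamma_sum)
next
  case False
  then obtain a b where ab: "a \<in> C 1" "b \<in> C 1" "x = Some a" "y = Some b"
    using assms by auto
  show ?thesis
  proof (cases z)
    case None
    then have "a = T \<otimes>\<^bsub>G\<^esub> b" using assms ab by (simp add: None_in_Gamma_sum)
    then show ?thesis using ab None by simp
  next
    case (Some c)
    then have c: "c \<in> C 1" "P.defect a b c = Z 2"
      using assms ab by (auto simp: Some_in_Gamma_sum)
    then show ?thesis
      using ab Some P.defect_reverse_left[OF ab(1,2) c(1)] P.defect_reverse_right[OF ab(1,2) c(1)]
      by (simp add: Some_in_Gamma_sum)
  qed
qed

lemma Gamma_distrib:
  assumes "x \<in> carrier \<Gamma>" "y \<in> carrier \<Gamma>" "w \<in> carrier \<Gamma>" "z \<in> x \<boxplus>\<^bsub>\<Gamma>\<^esub> y"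
  shows "z \<otimes>\<^bsub>\<Gamma>\<^esub> w \<in> (x \<otimes>\<^bsub>\<Gamma>\<^esub> w) \<boxplus>\<^bsub>\<Gamma>\<^esub> (y \<otimes>\<^bsub>\<Gamma>\<^esub> w)"
proof (cases "x = None \<or> y = None \<or> w = None")
  case True
  then show ?thesis using assms by auto
next
  case False
  then obtain a b d where ab: "a \<in> C 1" "b \<in> C 1" "d \<in> C 1" "x = Some a" "y = Some b" "w = Some d"
    using assms by auto
  show ?thesis
  proof (cases z)
    case None
    then have "a = T \<otimes>\<^bsub>G\<^esub> b" using assms ab by (simp add: None_in_Gamma_sum)
    then show ?thesis using ab None by (simp add: None_in_Gamma_sum grp.m_assoc)
  next
    case (Some c)
    then have c: "c \<in> C 1" "P.defect a b c = Z 2"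
      using assms ab by (auto simp: Some_in_Gamma_sum)
    then show ?thesis
      using ab Some P.defect_scale[OF ab(1,2) c(1) ab(3)] by (simp add: Some_in_Gamma_sum)
  qed
qed

lemma Gamma_represented_mult_closed:
  assumes "a \<in> C 1" "x \<in> \<one>\<^bsub>\<Gamma>\<^esub> \<boxplus>\<^bsub>\<Gamma>\<^esub> (\<boxminus>\<^bsub>\<Gamma>\<^esub> Some a)" "y \<in> \<one>\<^bsub>\<Gamma>\<^esub> \<boxplus>\<^bsub>\<Gamma>\<^esub> (\<boxminus>\<^bsub>\<Gamma>\<^esub> Some a)"
  shows "x \<otimes>\<^bsub>\<Gamma>\<^esub> y \<in> \<one>\<^bsub>\<Gamma>\<^esub> \<boxplus>\<^bsub>\<Gamma>\<^esub> (\<boxminus>\<^bsub>\<Gamma>\<^esub> Some a)"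
proof (cases "x = None \<or> y = None")
  case True
  then show ?thesis using assms by auto
next
  case False
  then obtain c d where cd: "x = Some c" "y = Some d" by auto
  then have "c \<in> C 1" "d \<in> C 1" "B 1 1 a c = Z 2" "B 1 1 a d = Z 2"
    using assms by (auto simp: Some_in_Gamma_sum P.defect_one_minus)
  then show ?thesis
    using assms(1) cd by (simp add: Some_in_Gamma_sum P.defect_one_minus P.pr_mult_right)
qed

text \<open>Associativity is a hypothesis because it can fail for an object satisfying
  \<open>is_igr_plus\<close>, as the example given with \<open>Gamma_obj\<close> shows. The
  remaining axioms about sums come from the identities for \<open>defect\<close>.\<close>

lemma pre_special_hyperfield_Gamma:
  assumes assoc: "\<And>x y z. \<lbrakk>x \<in> carrier \<Gamma>; y \<in> carrier \<Gamma>; z \<in> carrier \<Gamma>\<rbrakk> \<Longrightarrow>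
    (\<Union>w\<in>y \<boxplus>\<^bsub>\<Gamma>\<^esub> z. x \<boxplus>\<^bsub>\<Gamma>\<^esub> w) = (\<Union>w\<in>x \<boxplus>\<^bsub>\<Gamma>\<^esub> y. w \<boxplus>\<^bsub>\<Gamma>\<^esub> z)"
  shows "pre_special_hyperfield \<Gamma>"
proof (intro pre_special_hyperfield.intro hyperfield.intro multiring.intro)
  show "comm_multigroup \<Gamma>"
  proof (rule comm_multigroup.intro)
    fix x y assume xy: "x \<in> carrier \<Gamma>" "y \<in> carrier \<Gamma>"
    show "x \<boxplus>\<^bsub>\<Gamma>\<^esub> y \<subseteq> carrier \<Gamma>"
      using Gamma_hadd_closed[OF xy] by blast
    show "x \<boxplus>\<^bsub>\<Gamma>\<^esub> y \<noteq> {}"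
    proof (cases "x = None \<or> y = None")
      case False
      then obtain a b where ab: "a \<in> C 1" "b \<in> C 1" "x = Some a" "y = Some b"
        using xy by auto
      then have "x \<in> x \<boxplus>\<^bsub>\<Gamma>\<^esub> y"
        using P.defect_self[OF ab(1,2)] by (simp add: Some_in_Gamma_sum)
      then show ?thesis by blast
    qed auto
    show "x \<boxplus>\<^bsub>\<Gamma>\<^esub> y = y \<boxplus>\<^bsub>\<Gamma>\<^esub> x"
      using Gamma_hadd_commute[OF xy] .
    show "y \<in> hzero \<Gamma> \<boxplus>\<^bsub>\<Gamma>\<^esub> x \<longleftrightarrow> x = y"
      by auto
  qed (use assoc Gamma_hadd_reversible in auto)
  show "Group.comm_monoid \<Gamma>"
    by (rule comm_monoidI) (auto simp: grp.m_ac)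
  show "multiring_axioms \<Gamma>"
    by (rule multiring_axioms.intro) (auto intro: Gamma_distrib)
  have "\<exists>b\<in>C 1. b \<otimes>\<^bsub>G\<^esub> a = Z 1 \<and> a \<otimes>\<^bsub>G\<^esub> b = Z 1" if "a \<in> C 1" for a
    using P.G_sq[OF that] that by blast
  then show "hyperfield_axioms \<Gamma>"
    by (intro hyperfield_axioms.intro) (auto simp: Units_def)
  have "None \<in> \<one>\<^bsub>\<Gamma>\<^esub> \<boxplus>\<^bsub>\<Gamma>\<^esub> (\<boxminus>\<^bsub>\<Gamma>\<^esub> \<one>\<^bsub>\<Gamma>\<^esub>)"
    by (simp add: None_in_Gamma_sum)
  moreover have "Some c \<in> \<one>\<^bsub>\<Gamma>\<^esub> \<boxplus>\<^bsub>\<Gamma>\<^esub> (\<boxminus>\<^bsub>\<Gamma>\<^esub> \<one>\<^bsub>\<Gamma>\<^esub>)" if "c \<in> C 1" for c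
    using that P.defect_one_minus[of "Z 1" c] by (simp add: Some_in_Gamma_sum)
  ultimately have "\<one>\<^bsub>\<Gamma>\<^esub> \<boxplus>\<^bsub>\<Gamma>\<^esub> (\<boxminus>\<^bsub>\<Gamma>\<^esub> \<one>\<^bsub>\<Gamma>\<^esub>) = carrier \<Gamma>"
    using Gamma_hadd_closed[of "\<one>\<^bsub>\<Gamma>\<^esub>" "\<boxminus>\<^bsub>\<Gamma>\<^esub> \<one>\<^bsub>\<Gamma>\<^esub>"] by auto
  moreover have "x [^]\<^bsub>\<Gamma>\<^esub> (2::nat) = \<one>\<^bsub>\<Gamma>\<^esub>" if "x \<in> carrier \<Gamma> - {hzero \<Gamma>}" for x
    using that by (auto simp: numeral_2_eq_2 nat_pow_def)
  ultimately show "pre_special_hyperfield_axioms \<Gamma>"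
    using Gamma_represented_mult_closed
    by (intro pre_special_hyperfield_axioms.intro) (auto simp del: Gamma_simps(3,8))
qed

end

end

text \<open>A sum contains a non-zero element exactly when \<open>defect\<close> vanishes, and
  \<open>defect\<close> is built from operations in degrees 1 and 2 that every morphism preserves.
  For the zero element the condition is \<open>a = -b\<close>, which is preserved since
  \<open>f 1\<close> respects \<open>igr_top\<close>.\<close>

lemma Gamma_map_hom:
  assumes R: "is_igr_plus R" and S: "is_igr_plus S" and f: "f \<in> igr_hom R S"
  shows "Gamma_map R f \<in> multiring_hom (Gamma_obj R) (Gamma_obj S)"
proof -
  interpret R: igr_plus R by (rule is_igr_plus_igr_plus[OF R])
  interpret S: igr_plus S by (rule is_igr_plus_igr_plus[OF S])
  note hom = igr_hom_iff[OF R.igr S.igr, THEN iffD1, OF f]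
  have f1: "f 1 \<in> hom (igr_group R 1) (igr_group S 1)" and f2: "f 2 \<in> hom (igr_group R 2) (igr_group S 2)"
    and f_top: "f 1 (igr_top R 1) = igr_top S 1"
    using hom by blast+
  have f_mult: "f 2 (R.B 1 1 x y) = S.B 1 1 (f 1 x) (f 1 y)" if "x \<in> R.C 1" "y \<in> R.C 1" for x y
    using hom[THEN conjunct2, THEN spec[of _ 1], THEN spec[of _ 1]] that
    by (simp add: numeral_2_eq_2)
  have fc [simp]: "f 1 x \<in> S.C 1" if "x \<in> R.C 1" for x
    using hom_in_carrier[OF f1 that] .
  have f1_mult: "f 1 (x \<otimes>\<^bsub>igr_group R 1\<^esub> y) = f 1 x \<otimes>\<^bsub>igr_group S 1\<^esub> f 1 y"
    if "x \<in> R.C 1" "y \<in> R.C 1" for x y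
    using hom_mult[OF f1 that] .
  have f1_one: "f 1 (R.Z 1) = S.Z 1"
    using hom_one[OF f1 R.grp.is_group S.grp.is_group] .
  have f2_one: "f 2 (R.Z 2) = S.Z 2"
    using hom_one[OF f2 R.grp.is_group S.grp.is_group] .
  have f_defect: "f 2 (R.P.defect a b c) = S.P.defect (f 1 a) (f 1 b) (f 1 c)"
    if "a \<in> R.C 1" "b \<in> R.C 1" "c \<in> R.C 1" for a b c
    using that by (simp add: R.P.defect_def S.P.defect_def hom_mult[OF f2] f_mult f_top del: One_nat_def)
  have sum: "Gamma_map R f z \<in> Gamma_map R f x \<boxplus>\<^bsub>Gamma_obj S\<^esub> Gamma_map R f y"
    if x: "x \<in> carrier (Gamma_obj R)" and y: "y \<in> carrier (Gamma_obj R)" and z: "z \<in> x \<boxplus>\<^bsub>Gamma_obj R\<^esub> y"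
    for x y z
  proof (cases "x = None \<or> y = None")
    case True
    then show ?thesis using x y z by (auto simp: Gamma_map_def)
  next
    case False
    then obtain a b where ab: "a \<in> R.C 1" "b \<in> R.C 1" "x = Some a" "y = Some b"
      using x y by auto
    show ?thesis
    proof (cases z)
      case None
      then have "a = R.T \<otimes>\<^bsub>R.G\<^esub> b" using z ab by (simp add: R.None_in_Gamma_sum)
      then show ?thesis
        using ab None by (simp add: Gamma_map_def S.None_in_Gamma_sum f1_mult f_top del: One_nat_def)
    next
      case (Some c)
      then have c: "c \<in> R.C 1" "R.P.defect a b c = R.Z 2"
        using z ab by (auto simp: R.Some_in_Gamma_sum)
      then show ?thesis
        using ab Some f_defect[OF ab(1,2) c(1)] f2_one
        by (simp add: Gamma_map_def S.Some_in_Gamma_sum del: One_nat_def)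
    qed
  qed
  show ?thesis
    unfolding multiring_hom_def
  proof (intro CollectI conjI ballI)
    show "Gamma_map R f z \<in> Gamma_map R f x \<boxplus>\<^bsub>Gamma_obj S\<^esub> Gamma_map R f y"
      if "x \<in> carrier (Gamma_obj R)" "y \<in> carrier (Gamma_obj R)" "z \<in> x \<boxplus>\<^bsub>Gamma_obj R\<^esub> y" for x y z
      using sum[OF that] .
  qed (use R.grp.one_closed R.top_closed_all in
      \<open>auto simp: Gamma_map_def f1_mult f1_one f_top simp del: One_nat_def\<close>)
qed

lemma Gamma_map_id: 
  assumes "is_igr_plus R"
  shows "Gamma_map R (igr_id R) = (\<lambda>x\<in>carrier (Gamma_obj R). x)"
proof -
  interpret R: igr_plus R by (rule is_igr_plus_igr_plus[OF assms])
  show ?thesis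
    by (auto simp: Gamma_map_def igr_id_def fun_eq_iff)
qed

lemma Gamma_map_compose:
  assumes R: "is_igr_plus R" and S: "is_igr_plus S" and f: "f \<in> igr_hom R S"
  shows "Gamma_map R (igr_compose R g f) = compose (carrier (Gamma_obj R)) (Gamma_map S g) (Gamma_map R f)"
proof -
  interpret R: igr_plus R by (rule is_igr_plus_igr_plus[OF R])
  interpret S: igr_plus S by (rule is_igr_plus_igr_plus[OF S])
  have "f 1 \<in> hom (igr_group R 1) (igr_group S 1)"
    using igr_hom_iff[OF R.igr S.igr, THEN iffD1, OF f] by blast
  then have "f 1 x \<in> S.C 1" if "x \<in> R.C 1" for x
    using that by (rule hom_in_carrier)
  then show ?thesis
    by (auto simp: Gamma_map_def igr_compose_def compose_def fun_eq_iff simp del: One_nat_def)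
qed

section \<open>The adjunction\<close>

lemma multiring_homD:
  assumes "f \<in> multiring_hom F L"
  shows "f \<in> carrier F \<rightarrow>\<^sub>E carrier L"
    and "\<lbrakk>a \<in> carrier F; b \<in> carrier F; c \<in> a \<boxplus>\<^bsub>F\<^esub> b\<rbrakk> \<Longrightarrow> f c \<in> f a \<boxplus>\<^bsub>L\<^esub> f b"
    and "a \<in> carrier F \<Longrightarrow> f (\<boxminus>\<^bsub>F\<^esub> a) = \<boxminus>\<^bsub>L\<^esub> f a"
    and "f (hzero F) = hzero L"
    and "\<lbrakk>a \<in> carrier F; b \<in> carrier F\<rbrakk> \<Longrightarrow> f (a \<otimes>\<^bsub>F\<^esub> b) = f a \<otimes>\<^bsub>L\<^esub> f b"
    and "f \<one>\<^bsub>F\<^esub> = \<one>\<^bsub>L\<^esub>"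
  using assms by (auto simp: multiring_hom_def)

lemma (in pre_special_hyperfield) multiring_hom_compose:
  assumes f: "f \<in> multiring_hom F L" and g: "g \<in> multiring_hom L M"
  shows "compose (carrier F) g f \<in> multiring_hom F M"
proof -
  note f' = multiring_homD[OF f] and g' = multiring_homD[OF g]
  have fc: "f a \<in> carrier L" if "a \<in> carrier F" for a
    using f'(1) that by blast
  have gc: "g a \<in> carrier M" if "a \<in> carrier L" for a
    using g'(1) that by blast
  have sum: "compose (carrier F) g f c \<in> compose (carrier F) g f a \<boxplus>\<^bsub>M\<^esub> compose (carrier F) g f b"
    if "a \<in> carrier F" "b \<in> carrier F" "c \<in> a \<boxplus> b" for a b c
  proof -
    have "c \<in> carrier F" using that hadd_closed by blast
    then show ?thesis
      using that f'(2)[OF that] g'(2)[OF fc fc] by (simp add: compose_def)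
  qed
  show ?thesis
    unfolding multiring_hom_def
  proof (intro CollectI conjI ballI)
    show "compose (carrier F) g f c \<in> compose (carrier F) g f a \<boxplus>\<^bsub>M\<^esub> compose (carrier F) g f b"
      if "a \<in> carrier F" "b \<in> carrier F" "c \<in> a \<boxplus> b" for a b c
      using sum[OF that] .
  qed (use fc gc f'(3-6) g'(3-6) hzero_closed hneg_closed in \<open>auto simp: compose_def\<close>)
qed

text \<open>The image of \<open>a\<close> squares to \<open>\<one>\<close>, which zero does
  not.\<close>

lemma (in pre_special_hyperfield) multiring_hom_nonzero:
  assumes L: "pre_special_hyperfield L" and f: "f \<in> multiring_hom F L" and a: "a \<in> D"
  shows "f a \<in> carrier L - {hzero L}"
proof -
  interpret L: pre_special_hyperfield L by (rule L)
  note f' = multiring_homD[OF f]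
  have fa: "f a \<in> carrier L" using f'(1) a by blast
  have "f a \<otimes>\<^bsub>L\<^esub> f a = \<one>\<^bsub>L\<^esub>"
    using f'(5)[of a a] f'(6) a D_sq[OF a] by simp
  then have "f a \<noteq> hzero L"
    using L.mult_hzero[OF fa] L.one_not_hzero by metis
  then show ?thesis using fa by simp
qed

section \<open>The unit of the adjunction\<close>

context pre_special_hyperfield
begin

sublocale kp: igr_plus "k_obj F"
  by (rule is_igr_plus_igr_plus[OF is_igr_plus_k_obj])

lemma phi_nonzero: "a \<in> D \<Longrightarrow> phi F a = Some (k_symbol F [a])"
  by (simp add: phi_def)

lemma phi_zero: "phi F (hzero F) = None"
  by (simp add: phi_def hzero_closed)

lemma k_symbol_neg:
  assumes "a \<in> D"
  shows "k_symbol F [\<boxminus> a] = igr_top (k_obj F) 1 \<otimes>\<^bsub>igr_group (k_obj F) 1\<^esub> k_symbol F [a]"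
  using k_symbol_mult[OF D_neg_one assms] hneg_eq_mult[of a] assms by simp

lemma k_symbol_single_closed: "a \<in> D \<Longrightarrow> k_symbol F [a] \<in> carrier (igr_group (k_obj F) 1)"
  by simp

text \<open>By \<open>scaled_sum\<close>, \<open>c \<in> a + b\<close> gives
  \<open>ac \<in> 1 - (-ab)\<close>, and by \<open>defect_eq\<close> the defect of the three images
  is the symbol of \<open>-ab\<close> and \<open>ac\<close>, so a defining relation kills
  it.\<close>

lemma phi_sum:
  assumes "a \<in> carrier F" "b \<in> carrier F" "c \<in> a \<boxplus> b"
  shows "phi F c \<in> phi F a \<boxplus>\<^bsub>Gamma_obj (k_obj F)\<^esub> phi F b"
proof -
  have c: "c \<in> carrier F" using assms hadd_closed by blast
  consider "a = hzero F" | "b = hzero F" | "a \<in> D" "b \<in> D" "c = hzero F" | "a \<in> D" "b \<in> D" "c \<in> D"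
    using assms c by blast
  then show ?thesis
  proof cases
    case 1
    then have "c = b" using hadd_zero assms c by blast
    then show ?thesis using 1 by (simp add: phi_zero)
  next
    case 2
    then have "c = a" using hadd_zero[OF assms(1) c] hadd_comm[OF assms(1,2)] assms by blast
    then show ?thesis using 2 by (simp add: phi_zero)
  next
    case 3
    then have "b = \<boxminus> a" using hzero_in_sum assms by blast
    then have "a = \<boxminus> b" using hneg_hneg assms by simp
    then show ?thesis
      using 3 k_symbol_neg[OF 3(2)] by (simp add: phi_zero phi_nonzero kp.None_in_Gamma_sum del: k_obj_simps)
  next
    case 4
    let ?G = "igr_group (k_obj F) 1" and ?d = "\<boxminus> (a \<otimes> b)"
    let ?s = "\<lambda>a. k_symbol F [a]"
    have ab: "a \<otimes> b \<in> D" and ac: "a \<otimes> c \<in> D" using D_mult[OF 4(1,2)] D_mult[OF 4(1,3)] by blast+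
    have d: "?d \<in> D" using D_neg[OF ab] .
    have mult: "?s (x \<otimes> y) = ?s x \<otimes>\<^bsub>?G\<^esub> ?s y" if "x \<in> D" "y \<in> D" for x y
      using k_symbol_mult[OF that] by simp
    have "kp.P.defect (?s a) (?s b) (?s c) = igr_mult (k_obj F) 1 1 (?s ?d) (?s (a \<otimes> c))"
      unfolding k_symbol_neg[OF ab] mult[OF 4(1,2)] mult[OF 4(1,3)]
      by (rule kp.P.defect_eq) (use 4 k_symbol_single_closed in blast)+
    also have "\<dots> = k_symbol F [?d, a \<otimes> c]"
      using k_symbol_Cons[OF d, of "[a \<otimes> c]"] ac by simp
    also have "\<dots> = \<one>\<^bsub>k_group F 2\<^esub>"
    \<comment> \<open>The relations exclude \<open>?d = \<one>\<close>, that is,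
      \<open>b = -a\<close>; there the symbol vanishes because rho(1) = 0.\<close>
    proof (cases "?d = \<one>")
      case True
      then show ?thesis using K_rho_closed[OF ac] by (simp add: k_symbol_eq numeral_2_eq_2)
    next
      case False
      have "a \<otimes> c \<in> \<one> \<boxplus> (\<boxminus> ?d)"
        using scaled_sum[OF 4(1,2) assms(3)] ab by simp
      then show ?thesis using k_symbol_relation[OF d False] by blast
    qed
    finally show ?thesis
      unfolding phi_nonzero[OF 4(1)] phi_nonzero[OF 4(2)] phi_nonzero[OF 4(3)]
      using kp.Some_in_Gamma_sum[OF k_symbol_single_closed[OF 4(1)] k_symbol_single_closed[OF 4(2)]]
        k_symbol_single_closed[OF 4(3)] by simp
  qed
qed

lemma phi_hom: "phi F \<in> multiring_hom F (Gamma_obj (k_obj F))"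
  unfolding multiring_hom_def
proof (intro CollectI conjI ballI)
  show "phi F \<in> carrier F \<rightarrow>\<^sub>E carrier (Gamma_obj (k_obj F))"
    by (auto simp: phi_def kp.Gamma_simps intro!: k_symbol_closed)
  show "phi F c \<in> phi F a \<boxplus>\<^bsub>Gamma_obj (k_obj F)\<^esub> phi F b"
    if "a \<in> carrier F" "b \<in> carrier F" "c \<in> a \<boxplus> b" for a b c
    using phi_sum[OF that] .
  show "phi F (\<boxminus> a) = \<boxminus>\<^bsub>Gamma_obj (k_obj F)\<^esub> phi F a" if a: "a \<in> carrier F" for a
  proof (cases "a = hzero F")
    case False
    then have "a \<in> D" using a by simp
    then show ?thesis
      unfolding phi_nonzero[OF \<open>a \<in> D\<close>] phi_nonzero[OF D_neg[OF \<open>a \<in> D\<close>]] k_symbol_neg[OF \<open>a \<in> D\<close>]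
      by (simp add: kp.Gamma_simps del: k_obj_simps)
  qed (simp add: phi_zero hneg_hzero)
  show "phi F (hzero F) = hzero (Gamma_obj (k_obj F))"
    by (simp add: phi_zero)
  show "phi F \<one> = \<one>\<^bsub>Gamma_obj (k_obj F)\<^esub>"
    using phi_nonzero[OF D_one] k_symbol_one by simp
  show "phi F (a \<otimes> b) = phi F a \<otimes>\<^bsub>Gamma_obj (k_obj F)\<^esub> phi F b"
    if ab: "a \<in> carrier F" "b \<in> carrier F" for a b
  proof -
    consider "a = hzero F" | "b = hzero F" | "a \<in> D" "b \<in> D"
      using ab by blast
    then show ?thesis
    proof cases
      case 1
      then show ?thesis using mult_hzero[OF ab(2)] m_comm[OF ab] by (simp add: phi_zero)
    next
      case 2
      then show ?thesis using mult_hzero[OF ab(1)] by (simp add: phi_zero)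
    next
      case 3
      then show ?thesis
        unfolding phi_nonzero[OF 3(1)] phi_nonzero[OF 3(2)] phi_nonzero[OF D_mult[OF 3]] k_symbol_mult[OF 3]
        by (simp add: kp.Gamma_simps)
    qed
  qed
qed

lemma Gamma_map_phi:
  "a \<in> D \<Longrightarrow> Gamma_map (k_obj F) g (phi F a) = Some (g 1 (k_symbol F [a]))"
  "Gamma_map (k_obj F) g (phi F (hzero F)) = None"
  using k_symbol_single_closed[of a] by (simp_all add: phi_nonzero phi_zero Gamma_map_def kp.Gamma_simps)

text \<open>If \<open>b \<in> 1 - a\<close> then \<open>f b \<in> 1 - f a\<close>, which by
  \<open>defect_one_minus\<close> says that the product of the two values in \<open>R\<close>
  vanishes. So \<open>f\<close> without its option wrapper meets the hypotheses of
  \<open>k_universal\<close>. Uniqueness holds because composing with \<open>phi F\<close> recovers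
  the values of a morphism at the symbols of length 1.\<close>

lemma adjunction:
  assumes R: "is_igr_plus R" and f: "f \<in> multiring_hom F (Gamma_obj R)"
  shows "\<exists>!g. g \<in> igr_hom (k_obj F) R \<and> compose (carrier F) (Gamma_map (k_obj F) g) (phi F) = f"
proof -
  interpret R: igr_plus R by (rule is_igr_plus_igr_plus[OF R])
  note f' = multiring_homD[OF f]
  \<comment> \<open>On non-zero elements \<open>f a\<close> is never \<open>None\<close>, since it
    squares to the unit while \<open>None\<close> squares to \<open>None\<close>; so
    \<open>the\<close> never meets its unspecified value there.\<close>
  define f\<^sub>0 where "f\<^sub>0 a = the (f a)" for a
  have f0: "f a = Some (f\<^sub>0 a) \<and> f\<^sub>0 a \<in> R.C 1" if a: "a \<in> D" for a
  proof -
    have "f a \<otimes>\<^bsub>Gamma_obj R\<^esub> f a = \<one>\<^bsub>Gamma_obj R\<^esub>"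
      using f'(5)[of a a] f'(6) a D_sq[OF a] by simp
    then have "f a \<noteq> None" by (cases "f a") auto
    moreover have "f a \<in> carrier (Gamma_obj R)" using f'(1) a by blast
    ultimately show ?thesis by (auto simp: f\<^sub>0_def)
  qed
  note f0_eq = f0[THEN conjunct1] and f0_closed = f0[THEN conjunct2]
  obtain g where g: "g \<in> igr_hom (k_obj F) R" "\<And>a. a \<in> D \<Longrightarrow> g 1 (k_symbol F [a]) = f\<^sub>0 a"
  proof (rule k_universal[OF R.igr, of f\<^sub>0])
    show "f\<^sub>0 \<in> D \<rightarrow> R.C 1" using f0_closed by blast
    show "f\<^sub>0 (a \<otimes> b) = f\<^sub>0 a \<otimes>\<^bsub>igr_group R 1\<^esub> f\<^sub>0 b" if ab: "a \<in> D" "b \<in> D" for a b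
      using f'(5)[of a b] f0_eq[OF ab(1)] f0_eq[OF ab(2)] f0_eq[OF D_mult[OF ab]] ab by simp
    show "f\<^sub>0 (\<boxminus> \<one>) = igr_top R 1"
      using f'(3)[of "\<one>"] f'(6) f0_eq[OF D_neg_one] by (simp del: One_nat_def)
    show "R.B 1 1 (f\<^sub>0 a) (f\<^sub>0 b) = R.Z 2" if "a \<in> D" "a \<noteq> \<one>" "b \<in> D" "b \<in> \<one> \<boxplus> (\<boxminus> a)" for a b
    proof -
      have "f b \<in> f \<one> \<boxplus>\<^bsub>Gamma_obj R\<^esub> f (\<boxminus> a)"
        using f'(2)[OF one_closed _ that(4)] that(1) hneg_closed by blast
      then have "Some (f\<^sub>0 b) \<in> Some (R.Z 1) \<boxplus>\<^bsub>Gamma_obj R\<^esub> Some (R.T \<otimes>\<^bsub>R.G\<^esub> f\<^sub>0 a)"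
        using f'(3)[of a] f'(6) f0_eq[OF that(1)] f0_eq[OF that(3)] that(1)
        by (simp del: One_nat_def)
      then show ?thesis
        using f0_closed[OF that(1)] f0_closed[OF that(3)]
        by (simp add: R.Some_in_Gamma_sum R.P.defect_one_minus del: One_nat_def)
    qed
  qed (rule that)
  show ?thesis
  proof (rule ex1I[of _ g])
    have "compose (carrier F) (Gamma_map (k_obj F) g) (phi F) a = f a" for a
    proof -
      consider "a \<notin> carrier F" | "a = hzero F" | "a \<in> D" by blast
      then show ?thesis
      proof cases
        case 1
        then show ?thesis using f'(1) by (auto simp: compose_def)
      next
        case 2
        then show ?thesis using f'(4) hzero_closed by (simp add: compose_def Gamma_map_phi)
      next
        case 3
        then show ?thesis using g(2)[OF 3] f0_eq[OF 3] Gamma_map_phi(1)[OF 3, of g] by (simp add: compose_def)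
      qed
    qed
    then show "g \<in> igr_hom (k_obj F) R \<and> compose (carrier F) (Gamma_map (k_obj F) g) (phi F) = f"
      using g(1) by blast
  next
    fix g' assume g': "g' \<in> igr_hom (k_obj F) R \<and> compose (carrier F) (Gamma_map (k_obj F) g') (phi F) = f"
    have "g' 1 (k_symbol F [a]) = g 1 (k_symbol F [a])" if a: "a \<in> D" for a
    proof -
      have "f a = Some (g' 1 (k_symbol F [a]))"
        using g' a Gamma_map_phi(1)[OF a, of g'] by (auto simp: compose_def)
      then show ?thesis using f0_eq[OF a] g(2)[OF a] by simp
    qed
    then show "g' = g"
      using g' g(1) k_hom_eqI[OF R.igr] by blast
  qed
qed

text \<open>Justifies the definite description in \<open>k_map\<close>. The morphism is the one that
  the adjunction assigns to \<open>f\<close> followed by \<open>phi L\<close>.\<close>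

lemma k_map_unique:
  assumes L: "pre_special_hyperfield L" and f: "f \<in> multiring_hom F L"
  shows "\<exists>!g. g \<in> igr_hom (k_obj F) (k_obj L) \<and>
    (\<forall>as\<in>lists D. g (length as) (k_symbol F as) = k_symbol L (map f as))"
proof -
  interpret L: pre_special_hyperfield L by (rule L)
  have "compose (carrier F) (phi L) f \<in> multiring_hom F (Gamma_obj (k_obj L))"
    by (rule multiring_hom_compose[OF f L.phi_hom])
  then obtain g where g: "g \<in> igr_hom (k_obj F) (k_obj L)"
    and gf: "compose (carrier F) (Gamma_map (k_obj F) g) (phi F) = compose (carrier F) (phi L) f"
    using adjunction[OF L.is_igr_plus_k_obj] by blast
  have fD: "f a \<in> L.D" if "a \<in> D" for a
    using multiring_hom_nonzero[OF L f that] .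
  have g1: "g 1 (k_symbol F [a]) = k_symbol L [f a]" if a: "a \<in> D" for a
  proof -
    have "Gamma_map (k_obj F) g (phi F a) = phi L (f a)"
      using fun_cong[OF gf, of a] a by (simp add: compose_def)
    then show ?thesis
      using Gamma_map_phi(1)[OF a, of g] L.phi_nonzero[OF fD[OF a]] by simp
  qed
  have word: "g (length as) (k_symbol F as) = k_symbol L (map f as)" if as: "as \<in> lists D" for as
  proof -
    have "map f as \<in> lists L.D" using as fD by (induction as) auto
    moreover have "map (\<lambda>a. g 1 (k_symbol F [a])) as = map (\<lambda>a. k_symbol L [a]) (map f as)"
      unfolding map_map comp_def by (rule map_cong[OF refl]) (use as g1 in blast)
    ultimately show ?thesis
      using L.igr_prod_k_obj[of "map f as"] k_hom_symbol[OF L.is_igr_k_obj g as] by metis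
  qed
  show ?thesis
  proof (rule ex1I[of _ g])
    fix g' assume g': "g' \<in> igr_hom (k_obj F) (k_obj L) \<and>
      (\<forall>as\<in>lists D. g' (length as) (k_symbol F as) = k_symbol L (map f as))"
    have "g' 1 (k_symbol F [a]) = g 1 (k_symbol F [a])" if a: "a \<in> D" for a
    proof -
      have "[a] \<in> lists D" using a by simp
      then have "g' (length [a]) (k_symbol F [a]) = k_symbol L (map f [a])" using g' by blast
      then show ?thesis using g1[OF a] by simp
    qed
    then show "g' = g"
      using g' g k_hom_eqI[OF L.is_igr_k_obj] by blast
  qed (use g word in blast)
qed

lemma k_map_hom:
  assumes "pre_special_hyperfield L" "f \<in> multiring_hom F L"
  shows "k_map F L f \<in> igr_hom (k_obj F) (k_obj L)"
  using theI'[OF k_map_unique[OF assms]] unfolding k_map_def by blast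

lemma k_map_symbol:
  assumes "pre_special_hyperfield L" "f \<in> multiring_hom F L" "a \<in> D"
  shows "k_map F L f 1 (k_symbol F [a]) = k_symbol L [f a]"
proof -
  have "[a] \<in> lists D" using assms(3) by simp
  then have "k_map F L f (length [a]) (k_symbol F [a]) = k_symbol L (map f [a])"
    using theI'[OF k_map_unique[OF assms(1,2)]] unfolding k_map_def by blast
  then show ?thesis by simp
qed

lemma k_map_id: "k_map F F (\<lambda>x\<in>carrier F. x) = igr_id (k_obj F)"
proof -
  have id: "(\<lambda>x\<in>carrier F. x) \<in> multiring_hom F F"
    unfolding multiring_hom_def
  proof (intro CollectI conjI ballI)
    fix a b c assume abc: "a \<in> carrier F" "b \<in> carrier F" "c \<in> a \<boxplus> b"
    then have "c \<in> carrier F" using hadd_closed by blast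
    with abc show "(\<lambda>x\<in>carrier F. x) c \<in> (\<lambda>x\<in>carrier F. x) a \<boxplus> (\<lambda>x\<in>carrier F. x) b"
      by simp
  qed (use hneg_closed hzero_closed in auto)
  show ?thesis
  proof (rule k_hom_eqI[OF is_igr_k_obj k_map_hom[OF pre_special_hyperfield_axioms id] igr_id_hom[OF is_igr_k_obj]])
    fix a assume a: "a \<in> D"
    show "k_map F F (\<lambda>x\<in>carrier F. x) 1 (k_symbol F [a]) = igr_id (k_obj F) 1 (k_symbol F [a])"
      using k_map_symbol[OF pre_special_hyperfield_axioms id a] k_symbol_single_closed[OF a] a
      by (simp add: igr_id_def)
  qed
qed

lemma k_map_compose:
  assumes L: "pre_special_hyperfield L" and M: "pre_special_hyperfield M"
    and f: "f \<in> multiring_hom F L" and g: "g \<in> multiring_hom L M"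
  shows "k_map F M (compose (carrier F) g f) = igr_compose (k_obj F) (k_map L M g) (k_map F L f)"
proof -
  interpret L: pre_special_hyperfield L by (rule L)
  interpret M: pre_special_hyperfield M by (rule M)
  note gf = multiring_hom_compose[OF f g]
  show ?thesis
  proof (rule k_hom_eqI[OF M.is_igr_k_obj k_map_hom[OF M gf] igr_compose_hom[OF is_igr_k_obj L.is_igr_k_obj
          M.is_igr_k_obj k_map_hom[OF L f] L.k_map_hom[OF M g]]])
    fix a assume a: "a \<in> D"
    show "k_map F M (compose (carrier F) g f) 1 (k_symbol F [a]) =
        igr_compose (k_obj F) (k_map L M g) (k_map F L f) 1 (k_symbol F [a])"
      using k_map_symbol[OF M gf a] k_map_symbol[OF L f a]
        L.k_map_symbol[OF M g multiring_hom_nonzero[OF L f a]] k_symbol_single_closed[OF a] a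
      by (simp add: igr_compose_def compose_def)
  qed
qed

lemma phi_natural:
  assumes L: "pre_special_hyperfield L" and f: "f \<in> multiring_hom F L"
  shows "compose (carrier F) (Gamma_map (k_obj F) (k_map F L f)) (phi F) = compose (carrier F) (phi L) f"
proof
  fix a
  interpret L: pre_special_hyperfield L by (rule L)
  consider "a \<notin> carrier F" | "a = hzero F" | "a \<in> D" by blast
  then show "compose (carrier F) (Gamma_map (k_obj F) (k_map F L f)) (phi F) a = compose (carrier F) (phi L) f a"
  proof cases
    case 1
    then show ?thesis by (simp add: compose_def)
  next
    case 2
    then show ?thesis
      using multiring_homD(4)[OF f] hzero_closed by (simp add: compose_def Gamma_map_phi L.phi_zero)
  next
    case 3
    then show ?thesis
      using Gamma_map_phi(1)[OF 3, of "k_map F L f"] k_map_symbol[OF L f 3]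
        L.phi_nonzero[OF multiring_hom_nonzero[OF L f 3]] by (simp add: compose_def)
  qed
qed

end

theorem theorem4p20:
  fixes F :: "'a multistruct" and L :: "'b multistruct" and M :: "'c multistruct"
    and R :: "'r igr" and S :: "'s igr" and T :: "'t igr"
  assumes "pre_special_hyperfield F" "pre_special_hyperfield L" "pre_special_hyperfield M"
    and "is_igr_plus R" "is_igr_plus S" "is_igr_plus T"
  shows
    \<comment> \<open>\<open>k\<close> is a functor\<close>
    "is_igr_plus (k_obj F) \<and>
     (\<forall>f\<in>multiring_hom F L. k_map F L f \<in> igr_hom (k_obj F) (k_obj L)) \<and>
     k_map F F (\<lambda>x\<in>carrier F. x) = igr_id (k_obj F) \<and>
     (\<forall>f\<in>multiring_hom F L. \<forall>g\<in>multiring_hom L M.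
        k_map F M (compose (carrier F) g f) = igr_compose (k_obj F) (k_map L M g) (k_map F L f)) \<and>
    \<comment> \<open>\<open>\<Gamma>\<close> is a functor; associativity of \<open>\<Gamma> R\<close> is not automatic, see \<^const>\<open>Gamma_obj\<close>\<close>
     ((\<forall>x\<in>carrier (Gamma_obj R). \<forall>y\<in>carrier (Gamma_obj R). \<forall>z\<in>carrier (Gamma_obj R).
         (\<Union>w\<in>y \<boxplus>\<^bsub>Gamma_obj R\<^esub> z. x \<boxplus>\<^bsub>Gamma_obj R\<^esub> w) =
         (\<Union>w\<in>x \<boxplus>\<^bsub>Gamma_obj R\<^esub> y. w \<boxplus>\<^bsub>Gamma_obj R\<^esub> z)) \<longrightarrow>
       pre_special_hyperfield (Gamma_obj R)) \<and>
     (\<forall>f\<in>igr_hom R S. Gamma_map R f \<in> multiring_hom (Gamma_obj R) (Gamma_obj S)) \<and>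
     Gamma_map R (igr_id R) = (\<lambda>x\<in>carrier (Gamma_obj R). x) \<and>
     (\<forall>f\<in>igr_hom R S. \<forall>g\<in>igr_hom S T.
        Gamma_map R (igr_compose R g f) =
        compose (carrier (Gamma_obj R)) (Gamma_map S g) (Gamma_map R f)) \<and>
    \<comment> \<open>\<open>\<phi>\<close> is a natural transformation\<close>
     phi F \<in> multiring_hom F (Gamma_obj (k_obj F)) \<and>
     (\<forall>f\<in>multiring_hom F L.
        compose (carrier F) (Gamma_map (k_obj F) (k_map F L f)) (phi F) =
        compose (carrier F) (phi L) f) \<and>
    \<comment> \<open>\<open>\<phi>\<close> is the unit of the adjunction\<close>
     (\<forall>f\<in>multiring_hom F (Gamma_obj R). \<exists>!f'. f' \<in> igr_hom (k_obj F) R \<and>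
        compose (carrier F) (Gamma_map (k_obj F) f') (phi F) = f)"
proof -
  interpret F: pre_special_hyperfield F by (rule assms(1))
  interpret R: igr_plus R by (rule is_igr_plus_igr_plus[OF assms(4)])
  show ?thesis
  proof (intro conjI ballI impI)
    show "is_igr_plus (k_obj F)"
      by (rule F.is_igr_plus_k_obj)
    show "k_map F L f \<in> igr_hom (k_obj F) (k_obj L)" if "f \<in> multiring_hom F L" for f
      by (rule F.k_map_hom[OF assms(2) that])
    show "k_map F F (\<lambda>x\<in>carrier F. x) = igr_id (k_obj F)"
      by (rule F.k_map_id)
    show "k_map F M (compose (carrier F) g f) = igr_compose (k_obj F) (k_map L M g) (k_map F L f)"
      if "f \<in> multiring_hom F L" "g \<in> multiring_hom L M" for f g
      by (rule F.k_map_compose[OF assms(2,3) that])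
    show "pre_special_hyperfield (Gamma_obj R)"
      if "\<forall>x\<in>carrier (Gamma_obj R). \<forall>y\<in>carrier (Gamma_obj R). \<forall>z\<in>carrier (Gamma_obj R).
         (\<Union>w\<in>y \<boxplus>\<^bsub>Gamma_obj R\<^esub> z. x \<boxplus>\<^bsub>Gamma_obj R\<^esub> w) =
         (\<Union>w\<in>x \<boxplus>\<^bsub>Gamma_obj R\<^esub> y. w \<boxplus>\<^bsub>Gamma_obj R\<^esub> z)"
      by (rule R.pre_special_hyperfield_Gamma) (use that in blast)
    show "Gamma_map R f \<in> multiring_hom (Gamma_obj R) (Gamma_obj S)" if "f \<in> igr_hom R S" for f
      by (rule Gamma_map_hom[OF assms(4,5) that])
    show "Gamma_map R (igr_id R) = (\<lambda>x\<in>carrier (Gamma_obj R). x)"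
      by (rule Gamma_map_id[OF assms(4)])
    show "Gamma_map R (igr_compose R g f) =
        compose (carrier (Gamma_obj R)) (Gamma_map S g) (Gamma_map R f)"
      if "f \<in> igr_hom R S" "g \<in> igr_hom S T" for f g
      by (rule Gamma_map_compose[OF assms(4,5) that(1)])
    show "phi F \<in> multiring_hom F (Gamma_obj (k_obj F))"
      by (rule F.phi_hom)
    show "compose (carrier F) (Gamma_map (k_obj F) (k_map F L f)) (phi F) =
        compose (carrier F) (phi L) f" if "f \<in> multiring_hom F L" for f
      by (rule F.phi_natural[OF assms(2) that])
    show "\<exists>!f'. f' \<in> igr_hom (k_obj F) R \<and> compose (carrier F) (Gamma_map (k_obj F) f') (phi F) = f"
      if "f \<in> multiring_hom F (Gamma_obj R)" for f
      by (rule F.adjunction[OF assms(4) that])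
  qed
qed

end
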